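(* Let $M$ be a factor (a $W^*$-algebra with trivial center) and let $\alpha\in Aut(M)$ be a $*$-automorphism of $M$. Then the algebra $\rho_\pi(H^{\infty}({}_{\alpha}M))\subseteq B(\mathcal{F}({}_\alpha M)\otimes_\pi H)$ is reflexive for any normal representation $\pi:M\to B(H)$ on a Hilbert space $H$.
   Context: A Hilbert $W^*$-module over a $W^*$-algebra $M$ is a self-dual right Hilbert $C^*$-module $E$ over $M$ (the $M$-valued inner product is linear in the second variable); $\mathcal{L}(E)$ is the $W^*$-algebra of adjointable operators on $E$. A $W^*$-correspondence over $M$ is a Hilbert $W^*$-module $E$ over $M$ with a left action given by a normal $*$-homomorphism $\phi:M\to\mathcal{L}(E)$. The correspondence ${}_\alpha M$ is $M$ regarded as a right Hilbert module over itself with $\langle a,b\rangle=a^*b$ and left action $\phi(a)b=\alpha(a)b$. For a $W^*$-correspondence $E$ over $M$: $E^{\otimes 0}=M$ with $\phi_0(a)b=ab$; for $n\ge1$, $E^{\otimes n}$ is the self-dual completion of the internal tensor power balanced over $\phi$ (inner product $\langle\xi_1\otimes\eta_1,\xi_2\otimes\eta_2\rangle=\langle\eta_1,\phi(\langle\xi_1,\xi_2\rangle)\eta_2\rangle$), with left action $\phi_n(a)(\xi_1\otimes\dots\otimes\xi_n)=(\phi(a)\xi_1)\otimes\xi_2\otimes\dots\otimes\xi_n$. The full Fock space $\mathcal{F}(E)=\sum^{\oplus}_{n\ge0}E^{\otimes n}$ is the ultraweak direct sum (self-dual completion of the Hilbert module direct sum), with left action $\phi_\infty(a)=\sum_{n\ge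 0}\phi_n(a)$. For $\xi\in E$, $T_\xi\in\mathcal{L}(\mathcal{F}(E))$ is $T_\xi\eta=\xi\otimes\eta$. The Hardy algebra $H^\infty(E)$ is the weak$^*$ (ultraweak) closure in $\mathcal{L}(\mathcal{F}(E))$ of the algebra generated by all $T_\xi$ ($\xi\in E$) and all $\phi_\infty(a)$ ($a\in M$). For a normal (nondegenerate) representation $\pi:M\to B(H)$ and a Hilbert $W^*$-module $F$ over $M$, $F\otimes_\pi H$ is the Hilbert space completion of the algebraic tensor product with $\langle\xi_1\otimes h_1,\xi_2\otimes h_2\rangle=\langle h_1,\pi(\langle\xi_1,\xi_2\rangle)h_2\rangle$. The induced representation $\rho_\pi$ of $H^\infty(E)$ on $\mathcal{F}(E)\otimes_\pi H$ is $\rho_\pi(X)=X\otimes I_H$. For a subalgebra $\mathcal{A}\subseteq B(K)$, $Lat\,\mathcal{A}$ is the lattice of closed $\mathcal{A}$-invariant subspaces of $K$, $Alg\,Lat\,\mathcal{A}=\{T\in B(K):T\mathcal{N}\subseteq\mathcal{N}\ \forall \mathcal{N}\in Lat\,\mathcal{A}\}$, and $\mathcal{A}$ is reflexive if $\mathcal{A}=Alg\,Lat\,\mathcal{A}$. *)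

theory Defs
  imports "HOL-Analysis.Analysis"
begin

section \<open>Complex Banach spaces and Hilbert spaces\<close>

class complex_banach = banach +
  fixes scaleC :: "complex \<Rightarrow> 'a \<Rightarrow> 'a"  (infixr "*\<^sub>C" 75)
  assumes scaleC_add_right: "c *\<^sub>C (x + y) = c *\<^sub>C x + c *\<^sub>C y"
    and scaleC_add_left: "(c + d) *\<^sub>C x = c *\<^sub>C x + d *\<^sub>C x"
    and scaleC_scaleC: "c *\<^sub>C d *\<^sub>C x = (c * d) *\<^sub>C x"
    and scaleC_one: "1 *\<^sub>C x = x"
    and scaleR_scaleC: "r *\<^sub>R x = complex_of_real r *\<^sub>C x"
    and norm_scaleC: "norm (c *\<^sub>C x) = cmod c * norm x"

instantiation complex :: complex_banach
begin

definition scaleC_complex :: "complex \<Rightarrow> complex \<Rightarrow> complex"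
  where "scaleC_complex c x = c * x"

instance
  by standard (auto simp: scaleC_complex_def algebra_simps norm_mult scaleR_conv_of_real)

end

abbreviation cspan :: "'a::complex_banach set \<Rightarrow> 'a set"
  where "cspan \<equiv> module.span scaleC"

abbreviation csubspace :: "'a::complex_banach set \<Rightarrow> bool"
  where "csubspace \<equiv> module.subspace scaleC"

definition bounded_clinear :: "('a::complex_banach \<Rightarrow> 'b::complex_banach) \<Rightarrow> bool"
  where "bounded_clinear f \<longleftrightarrow> bounded_linear f \<and> (\<forall>c x. f (c *\<^sub>C x) = c *\<^sub>C f x)"

class complex_hilbert = complex_banach +
  fixes cinner :: "'a \<Rightarrow> 'a \<Rightarrow> complex"
  assumes cinner_commute: "cinner x y = cnj (cinner y x)"
    and cinner_add_right: "cinner x (y + z) = cinner x y + cinner x z"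
    and cinner_scaleC_right: "cinner x (c *\<^sub>C y) = c * cinner x y"
    and cinner_norm: "cinner x x = complex_of_real ((norm x)\<^sup>2)"

section \<open>Weak topologies\<close>

text \<open>The topology \<open>\<sigma>(D, V)\<close> on \<open>D\<close> defined by a set \<open>V\<close> of functionals.\<close>

definition weak_topology :: "'x set \<Rightarrow> ('x \<Rightarrow> complex) set \<Rightarrow> 'x topology"
  where "weak_topology D V = topology_generated_by {{x \<in> D. f x \<in> U} | f U. f \<in> V \<and> open U}"

text \<open>The norm closure, inside the dual of the normed space \<open>(D, nrm)\<close>, of the set of finite sums of
  members of \<open>B\<close>. Every \<open>B\<close> used below is closed under multiplication by complex scalars, so
  these sums are the linear span of \<open>B\<close>.\<close>

definition closed_sums ::
    "('x \<Rightarrow> real) \<Rightarrow> 'x set \<Rightarrow> ('x \<Rightarrow> complex) set \<Rightarrow> ('x \<Rightarrow> complex) set"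
  where "closed_sums nrm D B =
    {f. \<forall>e>0. \<exists>gs. set gs \<subseteq> B \<and> (\<forall>x\<in>D. cmod (f x - (\<Sum>g\<leftarrow>gs. g x)) \<le> e * nrm x)}"

section \<open>$C^*$-algebras and $W^*$-algebras\<close>

class cstar_algebra = complex_banach + real_normed_algebra_1 +
  fixes star :: "'a \<Rightarrow> 'a"  ("(_\<^sup>\<star>)" [1000] 999)
  assumes scaleC_mult_left: "(c *\<^sub>C a) * b = c *\<^sub>C (a * b)"
    and scaleC_mult_right: "a * (c *\<^sub>C b) = c *\<^sub>C (a * b)"
    and star_star: "(a\<^sup>\<star>)\<^sup>\<star> = a"
    and star_add: "(a + b)\<^sup>\<star> = a\<^sup>\<star> + b\<^sup>\<star>"
    and star_scaleC: "(c *\<^sub>C a)\<^sup>\<star> = cnj c *\<^sub>C a\<^sup>\<star>"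
    and star_mult: "(a * b)\<^sup>\<star> = b\<^sup>\<star> * a\<^sup>\<star>"
    and norm_star_mult: "norm (a\<^sup>\<star> * a) = (norm a)\<^sup>2"

text \<open>\<open>f\<close> is a linear functional of norm at most \<open>C\<close>. This definition and the next one avoid
  \<^const>\<open>bounded_linear\<close> and \<^const>\<open>onorm\<close> because class assumptions may not refer to them.\<close>

definition (in complex_banach) functional_le :: "('a \<Rightarrow> complex) \<Rightarrow> real \<Rightarrow> bool"
  where "functional_le f C \<longleftrightarrow>
    (\<forall>x y. f (x + y) = f x + f y) \<and> (\<forall>c x. f (c *\<^sub>C x) = c * f x) \<and>
    (\<forall>x. cmod (f x) \<le> C * norm x)"

text \<open>\<open>P\<close> is a norm closed subspace of the dual of \<open>'a\<close> such that the canonical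
  map from \<open>'a\<close> to the dual of \<open>P\<close> is isometric and onto.\<close>

definition (in complex_banach) is_predual :: "('a \<Rightarrow> complex) set \<Rightarrow> bool"
  where "is_predual P \<longleftrightarrow>
    (\<forall>f\<in>P. \<exists>C. functional_le f C) \<and>
    (\<lambda>_. 0) \<in> P \<and>
    (\<forall>f\<in>P. \<forall>g\<in>P. (\<lambda>x. f x + g x) \<in> P) \<and>
    (\<forall>c. \<forall>f\<in>P. (\<lambda>x. c * f x) \<in> P) \<and>
    (\<forall>f. (\<forall>e>0. \<exists>g\<in>P. functional_le (\<lambda>x. f x - g x) e) \<longrightarrow> f \<in> P) \<and>
    (\<forall>a. norm a = (SUP f\<in>{f \<in> P. functional_le f 1}. cmod (f a))) \<and>
    (\<forall>\<Phi>. (\<forall>f\<in>P. \<forall>g\<in>P. \<Phi> (\<lambda>x. f x + g x) = \<Phi> f + \<Phi> g) \<and>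
         (\<forall>c. \<forall>f\<in>P. \<Phi> (\<lambda>x. c * f x) = c * \<Phi> f) \<and>
         (\<exists>K. \<forall>f\<in>P. \<forall>C. functional_le f C \<longrightarrow> cmod (\<Phi> f) \<le> K * C)
       \<longrightarrow> (\<exists>a. \<forall>f\<in>P. \<Phi> f = f a))"

text \<open>$W^*$-algebras in the sense of Sakai: $C^*$-algebras that are dual spaces. They are
  automatically unital; being a \<^class>\<open>real_normed_algebra_1\<close>, they are here also nonzero.\<close>

class wstar_algebra = cstar_algebra +
  assumes ex_predual: "\<exists>P. is_predual P"

text \<open>The predual is unique (Sakai), so that nothing depends on the choice.\<close>

definition predual :: "('m::wstar_algebra \<Rightarrow> complex) set"
  where "predual = (SOME P. is_predual P)"

lemma is_predual_predual: "is_predual (predual :: ('m::wstar_algebra \<Rightarrow> complex) set)"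
  unfolding predual_def by (rule someI_ex) (rule ex_predual)

definition center :: "'m::cstar_algebra set"
  where "center = {z. \<forall>a. z * a = a * z}"

definition star_automorphism :: "('m::cstar_algebra \<Rightarrow> 'm) \<Rightarrow> bool"
  where "star_automorphism \<alpha> \<longleftrightarrow> bij \<alpha> \<and>
    (\<forall>a b. \<alpha> (a + b) = \<alpha> a + \<alpha> b) \<and> (\<forall>c a. \<alpha> (c *\<^sub>C a) = c *\<^sub>C \<alpha> a) \<and>
    (\<forall>a b. \<alpha> (a * b) = \<alpha> a * \<alpha> b) \<and> (\<forall>a. \<alpha> (a\<^sup>\<star>) = (\<alpha> a)\<^sup>\<star>)"

section \<open>Operators on Hilbert spaces: normal representations, reflexivity\<close>

definition bounded_operators :: "('h::complex_hilbert \<Rightarrow> 'h) set"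
  where "bounded_operators = {T. bounded_clinear T}"

text \<open>The predual of \<open>B(H)\<close>, i.e. the closed linear span of the vector functionals, which
  consists of the ultraweakly continuous functionals on \<open>B(H)\<close>.\<close>

definition bounded_operators_predual :: "(('h::complex_hilbert \<Rightarrow> 'h) \<Rightarrow> complex) set"
  where "bounded_operators_predual =
    closed_sums onorm bounded_operators {\<lambda>T. cinner h (T k) | h k. True}"

locale normal_representation =
  fixes \<pi> :: "'m::wstar_algebra \<Rightarrow> 'h::complex_hilbert \<Rightarrow> 'h"
  assumes rep_bounded: "\<pi> a \<in> bounded_operators"
    and rep_add: "\<pi> (a + b) h = \<pi> a h + \<pi> b h"
    and rep_scaleC: "\<pi> (c *\<^sub>C a) h = c *\<^sub>C \<pi> a h"
    and rep_mult: "\<pi> (a * b) h = \<pi> a (\<pi> b h)"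
    and rep_star: "cinner (\<pi> a h) k = cinner h (\<pi> (a\<^sup>\<star>) k)"
    and rep_normal: "continuous_map (weak_topology UNIV predual)
      (weak_topology bounded_operators bounded_operators_predual) \<pi>"
    and rep_nondegenerate: "closure (cspan {\<pi> a h | a h. True}) = UNIV"

definition Lat :: "('k::complex_hilbert \<Rightarrow> 'k) set \<Rightarrow> 'k set set"
  where "Lat \<A> = {N. closed N \<and> csubspace N \<and> (\<forall>T\<in>\<A>. T ` N \<subseteq> N)}"

definition AlgLat :: "('k::complex_hilbert \<Rightarrow> 'k) set \<Rightarrow> ('k \<Rightarrow> 'k) set"
  where "AlgLat \<A> = {T \<in> bounded_operators. \<forall>N\<in>Lat \<A>. T ` N \<subseteq> N}"

definition reflexive :: "('k::complex_hilbert \<Rightarrow> 'k) set \<Rightarrow> bool"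
  where "reflexive \<A> \<longleftrightarrow> \<A> = AlgLat \<A>"

section \<open>Hilbert $W^*$-modules\<close>

record ('m, 'e) hilbert_module =
  minner :: "'e \<Rightarrow> 'e \<Rightarrow> 'm"
  ract :: "'e \<Rightarrow> 'm \<Rightarrow> 'e"

definition adjointable :: "('m, 'e, 'z) hilbert_module_scheme \<Rightarrow> ('e \<Rightarrow> 'e) set"
  where "adjointable E = {T. \<exists>S. \<forall>x y. minner E (T x) y = minner E x (S y)}"

text \<open>The norm and the completeness required of a Hilbert module are those of the class
  \<^class>\<open>complex_banach\<close>.\<close>

locale hilbert_wstar_module =
  fixes E :: "('m::wstar_algebra, 'e::complex_banach, 'z) hilbert_module_scheme"
  assumes ract_add_left: "ract E (x + y) a = ract E x a + ract E y a"
    and ract_add_right: "ract E x (a + b) = ract E x a + ract E x b"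
    and ract_scaleC_left: "ract E (c *\<^sub>C x) a = c *\<^sub>C ract E x a"
    and ract_scaleC_right: "ract E x (c *\<^sub>C a) = c *\<^sub>C ract E x a"
    and ract_mult: "ract E x (a * b) = ract E (ract E x a) b"
    and ract_one: "ract E x 1 = x"
    and minner_add: "minner E x (y + z) = minner E x y + minner E x z"
    and minner_scaleC: "minner E x (c *\<^sub>C y) = c *\<^sub>C minner E x y"
    and minner_ract: "minner E x (ract E y a) = minner E x y * a"
    and minner_star: "(minner E x y)\<^sup>\<star> = minner E y x"
    and minner_positive: "\<exists>a. minner E x x = a\<^sup>\<star> * a"
    and norm_minner: "norm x = sqrt (norm (minner E x x))"
    and self_dual: "bounded_clinear f \<Longrightarrow> (\<And>x a. f (ract E x a) = f x * a)
      \<Longrightarrow> \<exists>y. f = minner E y"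

text \<open>The predual of a Hilbert $W^*$-module \<open>E\<close> and the predual of the $W^*$-algebra \<open>adjointable E\<close>
  of adjointable operators (Paschke).\<close>

definition module_predual ::
    "('m::wstar_algebra, 'e::complex_banach, 'z) hilbert_module_scheme \<Rightarrow> ('e \<Rightarrow> complex) set"
  where "module_predual E =
    closed_sums norm UNIV {\<lambda>x. \<omega> (minner E y x) | \<omega> y. \<omega> \<in> predual}"

definition adjointable_predual ::
    "('m::wstar_algebra, 'e::complex_banach, 'z) hilbert_module_scheme \<Rightarrow> (('e \<Rightarrow> 'e) \<Rightarrow> complex) set"
  where "adjointable_predual E =
    closed_sums onorm (adjointable E) {\<lambda>T. \<omega> (minner E x (T y)) | \<omega> x y. \<omega> \<in> predual}"

definition module_ultraweak ::
    "('m::wstar_algebra, 'e::complex_banach, 'z) hilbert_module_scheme \<Rightarrow> 'e topology"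
  where "module_ultraweak E = weak_topology UNIV (module_predual E)"

definition adjointable_ultraweak ::
    "('m::wstar_algebra, 'e::complex_banach, 'z) hilbert_module_scheme \<Rightarrow> ('e \<Rightarrow> 'e) topology"
  where "adjointable_ultraweak E = weak_topology (adjointable E) (adjointable_predual E)"

section \<open>Correspondences\<close>

record ('m, 'e) correspondence = "('m, 'e) hilbert_module" +
  lact :: "'m \<Rightarrow> 'e \<Rightarrow> 'e"

text \<open>A $W^*$-correspondence is a correspondence in the following sense whose left action
  is moreover normal. Normality plays no role in forming the Fock space, and it is
  automatic for \<open>twisted \<alpha>\<close>, because $*$-automorphisms of $W^*$-algebras are normal.\<close>

locale correspondence = hilbert_wstar_module E
  for E :: "('m::wstar_algebra, 'e::complex_banach, 'z) correspondence_scheme" +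
  assumes lact_add: "lact E (a + b) x = lact E a x + lact E b x"
    and lact_scaleC: "lact E (c *\<^sub>C a) x = c *\<^sub>C lact E a x"
    and lact_mult: "lact E (a * b) x = lact E a (lact E b x)"
    and lact_star: "minner E (lact E a x) y = minner E x (lact E (a\<^sup>\<star>) y)"

locale wstar_correspondence = correspondence +
  assumes lact_normal:
    "continuous_map (weak_topology UNIV predual) (adjointable_ultraweak E) (lact E)"

text \<open>The correspondence ${}_\alpha M$.\<close>

definition twisted :: "('m::wstar_algebra \<Rightarrow> 'm) \<Rightarrow> ('m, 'm) correspondence"
  where "twisted \<alpha> =
    \<lparr>minner = (\<lambda>a b. a\<^sup>\<star> * b), ract = (\<lambda>b a. b * a), lact = (\<lambda>a b. \<alpha> a * b)\<rparr>"

lemma correspondence_twisted: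
  assumes "star_automorphism \<alpha>"
  shows "correspondence (twisted \<alpha>)"
proof
  fix f :: "'a \<Rightarrow> 'a"
  assume f: "\<And>x a. f (ract (twisted \<alpha>) x a) = f x * a"
  have "f x = minner (twisted \<alpha>) ((f 1)\<^sup>\<star>) x" for x
    using f[of 1 x] by (simp add: twisted_def star_star)
  then show "\<exists>y. f = minner (twisted \<alpha>) y" by blast
qed (use assms in \<open>auto simp: twisted_def star_automorphism_def algebra_simps scaleC_mult_left
      scaleC_mult_right star_mult star_star norm_star_mult\<close>)

section \<open>The full Fock space and the Hardy algebra\<close>

text \<open>Inner products of elementary tensors \<open>\<xi>\<^sub>1 \<otimes> \<dots> \<otimes> \<xi>\<^sub>n\<close>, \<open>n \<ge> 1\<close>. Tensors of different degrees
  are orthogonal.\<close>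

fun tensor_inner :: "('m::wstar_algebra, 'e, 'z) correspondence_scheme \<Rightarrow> 'e list \<Rightarrow> 'e list \<Rightarrow> 'm"
  where
    "tensor_inner E [\<xi>] [\<eta>] = minner E \<xi> \<eta>"
  | "tensor_inner E (\<xi> # \<xi>' # \<xi>s) (\<eta> # \<eta>' # \<eta>s) =
      tensor_inner E (\<xi>' # \<xi>s) (lact E (minner E \<xi> \<eta>) \<eta>' # \<eta>s)"
  | "tensor_inner E _ _ = 0"

text \<open>The full Fock space is a self-dual completion and as such is determined up to
  isomorphism. A realization consists of a Hilbert $W^*$-module together with the embedding
  \<open>vac\<close> of the summand $E^{\otimes 0} = M$, the elementary tensors \<open>tens [\<xi>\<^sub>1, \<dots>, \<xi>\<^sub>n]\<close>, \<open>n \<ge> 1\<close>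
  (the value \<open>tens []\<close> is irrelevant), the operators \<open>creation \<xi>\<close> $= T_\xi$ and, as \<open>lact\<close>,
  the left action $\phi_\infty$.\<close>

record ('m, 'e, 'f) fock_module = "('m, 'f) correspondence" +
  vac :: "'m \<Rightarrow> 'f"
  tens :: "'e list \<Rightarrow> 'f"
  creation :: "'e \<Rightarrow> 'f \<Rightarrow> 'f"

text \<open>The summand $E^{\otimes n}$. The ultraweak closure of a submodule of a Hilbert
  $W^*$-module is its self-dual completion.\<close>

definition tensor_power ::
    "('m::wstar_algebra, 'e, 'f::complex_banach, 'z) fock_module_scheme \<Rightarrow> nat \<Rightarrow> 'f set"
  where "tensor_power F n = (if n = 0 then range (vac F)
    else module_ultraweak F closure_of (cspan (tens F ` {\<xi>s. length \<xi>s = n})))"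

text \<open>Multilinearity and balancedness of \<open>tens\<close>, and the behaviour of the right action on
  \<open>vac\<close> and \<open>tens\<close>, are consequences of the inner product formulas. In
  \<open>creation_vac\<close>, the module \<open>E \<otimes> M\<close> is identified with \<open>E\<close> via \<open>\<xi> \<otimes> b = \<xi>b\<close>.\<close>

locale full_fock_space = E: correspondence E + F: hilbert_wstar_module F
  for E :: "('m::wstar_algebra, 'e::complex_banach, 'y) correspondence_scheme"
    and F :: "('m, 'e, 'f::complex_banach, 'z) fock_module_scheme" +
  assumes inner_vac: "minner F (vac F a) (vac F b) = a\<^sup>\<star> * b"
    and inner_vac_tens: "\<xi>s \<noteq> [] \<Longrightarrow> minner F (vac F a) (tens F \<xi>s) = 0"
    and inner_tens: "\<xi>s \<noteq> [] \<Longrightarrow> \<eta>s \<noteq> [] \<Longrightarrow>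
      minner F (tens F \<xi>s) (tens F \<eta>s) = tensor_inner E \<xi>s \<eta>s"
    and total: "module_ultraweak F closure_of (cspan (\<Union>n. tensor_power F n)) = UNIV"
    and creation_adjointable: "creation F \<xi> \<in> adjointable F"
    and creation_vac: "creation F \<xi> (vac F b) = tens F [ract E \<xi> b]"
    and creation_tens: "\<xi>s \<noteq> [] \<Longrightarrow> creation F \<xi> (tens F \<xi>s) = tens F (\<xi> # \<xi>s)"
    and lact_adjointable: "lact F a \<in> adjointable F"
    and lact_vac: "lact F a (vac F b) = vac F (a * b)"
    and lact_tens: "lact F a (tens F (\<xi> # \<xi>s)) = tens F (lact E a \<xi> # \<xi>s)"

inductive_set generated_algebra :: "('f::complex_banach \<Rightarrow> 'f) set \<Rightarrow> ('f \<Rightarrow> 'f) set"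
  for G :: "('f \<Rightarrow> 'f) set"
  where
    gen: "T \<in> G \<Longrightarrow> T \<in> generated_algebra G"
  | add: "S \<in> generated_algebra G \<Longrightarrow> T \<in> generated_algebra G
      \<Longrightarrow> (\<lambda>x. S x + T x) \<in> generated_algebra G"
  | scale: "T \<in> generated_algebra G \<Longrightarrow> (\<lambda>x. c *\<^sub>C T x) \<in> generated_algebra G"
  | mult: "S \<in> generated_algebra G \<Longrightarrow> T \<in> generated_algebra G \<Longrightarrow> S \<circ> T \<in> generated_algebra G"

definition hardy_algebra ::
    "('m::wstar_algebra, 'e, 'f::complex_banach, 'z) fock_module_scheme \<Rightarrow> ('f \<Rightarrow> 'f) set"
  where "hardy_algebra F =
    adjointable_ultraweak F closure_of generated_algebra (range (creation F) \<union> range (lact F))"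

section \<open>The induced representation\<close>

text \<open>The Hilbert space \<open>'k\<close> with the elementary tensors \<open>t \<xi> h\<close> is a realization of the
  completed tensor product of \<open>F\<close> and \<open>'h\<close> over \<open>\<pi>\<close>.\<close>

definition is_hilbert_tensor ::
    "('m, 'f, 'z) hilbert_module_scheme \<Rightarrow> ('m \<Rightarrow> 'h::complex_hilbert \<Rightarrow> 'h)
      \<Rightarrow> ('f \<Rightarrow> 'h \<Rightarrow> 'k::complex_hilbert) \<Rightarrow> bool"
  where "is_hilbert_tensor F \<pi> t \<longleftrightarrow>
    (\<forall>\<xi> \<eta> h k. cinner (t \<xi> h) (t \<eta> k) = cinner h (\<pi> (minner F \<xi> \<eta>) k)) \<and>
    closure (cspan {t \<xi> h | \<xi> h. True}) = UNIV"

text \<open>The operator $X \otimes I_H$.\<close>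

definition induced :: "('f \<Rightarrow> 'h \<Rightarrow> 'k::complex_hilbert) \<Rightarrow> ('f \<Rightarrow> 'f) \<Rightarrow> 'k \<Rightarrow> 'k"
  where "induced t X = (THE Z. Z \<in> bounded_operators \<and> (\<forall>\<xi> h. Z (t \<xi> h) = t (X \<xi>) h))"

end

theory Submission
  imports Defs
begin

text \<open>
  The Fock space of \<open>twisted \<alpha>\<close> has a basis \<open>e 0, e 1, \<dots>\<close>, so that the Hilbert space decomposes into
  the orthogonal ranges of the isometries \<open>V i h = t (e i) h\<close>, with adjoints \<open>W i\<close>. Let \<open>T\<close> leave all
  invariant subspaces of the Hardy algebra invariant. The spans of the ranges of \<open>V i\<close>, \<open>i \<ge> k\<close>, are
  invariant, hence \<open>T\<close> is lower triangular.

  For a factor, \<open>\<pi>\<close> is faithful and there are enough operators \<open>Z\<close> with \<open>Z (\<pi> a) = \<pi> (\<alpha>\<^sup>m a) Z\<close>: the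
  automorphism \<open>\<alpha>\<^sup>m\<close> is normal, so that \<open>\<pi>\<close> and \<open>\<pi> \<circ> \<alpha>\<^sup>m\<close> are quasi-equivalent. Each \<open>Z\<close> gives rise to
  invariant subspaces, and comparing the entries of \<open>T\<close> at \<open>(k + n, k)\<close> and \<open>(k + n + m, k + m)\<close> through
  all the \<open>Z\<close> shows that the entries commute with the commutant of \<open>\<pi> M\<close> and determine each other. By the
  double commutant theorem the entry at \<open>(k + n, k)\<close> is \<open>\<pi> (\<alpha>\<^sup>k a\<^sub>n)\<close> with \<open>a\<^sub>n\<close> independent of \<open>k\<close>. The
  Fejer means of the formal series with coefficients \<open>a\<^sub>n\<close> lie in the algebra of generators, are bounded by
  the norm of \<open>T\<close>, and converge to \<open>T\<close> ultraweakly.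
\<close>

text \<open>M is given only as a C*-algebra with a predual: no spatial model, order or functional
  calculus is at hand. This shapes much of the argument. Resolvents and squaring arguments with
  exponents 2^k replace functional calculus. Constants like 4 or 6 where 1 would be sharp are
  harmless: 2^k-th roots remove them, or only a uniform bound is wanted. The invariant subspaces
  built from an intertwiner relate entries on the n-th diagonal only for shifts m > n; for smaller
  shifts the leading slot of the test vector would itself be constrained. The one-step relation is
  recovered by comparing the shifts n + 1 and n + 2 and cancelling. Factoriality enters twice: in
  the faithfulness of \<pi>, and because M and its commutant together leave no proper nonzero closed
  subspace invariant, so that one nonzero intertwiner already yields a separating family. The limit
  of the Fejer means is a priori only an operator on the Hilbert space; self-duality of the Fock
  module turns it into an adjointable operator.\<close>

section \<open>Hilbert spaces\<close>

interpretation cvs: vector_space "scaleC :: complex \<Rightarrow> 'a \<Rightarrow> 'a::complex_banach"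
  by unfold_locales (simp_all add: scaleC_add_right scaleC_add_left scaleC_scaleC scaleC_one)

lemma bounded_linear_scaleC_right: "bounded_linear (\<lambda>x::'a::complex_banach. c *\<^sub>C x)"
  by (rule bounded_linear_intro[where K = "cmod c"])
    (simp_all add: scaleC_add_right scaleR_scaleC scaleC_scaleC norm_scaleC mult.commute)

lemmas tendsto_scaleC [tendsto_intros] =
  bounded_linear.tendsto[OF bounded_linear_scaleC_right]

lemma csubspace_imp_subspace: "csubspace L \<Longrightarrow> subspace L"
  by (auto simp: subspace_def cvs.subspace_def scaleR_scaleC)

lemma bounded_clinearI:
  assumes "\<And>x y. f (x + y) = f x + f y" "\<And>c x. f (c *\<^sub>C x) = c *\<^sub>C f x"
    "\<And>x. norm (f x) \<le> K * norm x"
  shows "bounded_clinear f"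
  unfolding bounded_clinear_def
  by (auto intro!: bounded_linear_intro[where K = K] simp: assms scaleR_scaleC mult.commute)

lemma bounded_clinear_bl: "bounded_clinear f \<Longrightarrow> bounded_linear f"
  by (simp add: bounded_clinear_def)

lemmas bcl_add = linear_add[OF bounded_linear.linear[OF bounded_clinear_bl]]
  and bcl_diff = linear_diff[OF bounded_linear.linear[OF bounded_clinear_bl]]
  and bcl_0 = linear_0[OF bounded_linear.linear[OF bounded_clinear_bl]]
  and bcl_sum = linear_sum[OF bounded_linear.linear[OF bounded_clinear_bl]]
  and bcl_scaleR = linear_scale[OF bounded_linear.linear[OF bounded_clinear_bl]]
  and bcl_tendsto = bounded_linear.tendsto[OF bounded_clinear_bl]
  and bcl_continuous_on = bounded_linear.continuous_on[OF bounded_clinear_bl]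
  and bcl_norm = onorm[OF bounded_clinear_bl]

lemma bcl_scaleC: "bounded_clinear f \<Longrightarrow> f (c *\<^sub>C x) = c *\<^sub>C f x"
  by (simp add: bounded_clinear_def)

lemma bcl_compose: "bounded_clinear f \<Longrightarrow> bounded_clinear g \<Longrightarrow> bounded_clinear (\<lambda>x. f (g x))"
  using bounded_linear_compose by (auto simp: bounded_clinear_def)

lemma bcl_plus: "bounded_clinear f \<Longrightarrow> bounded_clinear g \<Longrightarrow> bounded_clinear (\<lambda>x. f x + g x)"
  by (auto simp: bounded_clinear_def scaleC_add_right intro: bounded_linear_add)

lemma bcl_minus: "bounded_clinear f \<Longrightarrow> bounded_clinear g \<Longrightarrow> bounded_clinear (\<lambda>x. f x - g x)"
  by (auto simp: bounded_clinear_def cvs.scale_right_diff_distrib intro: bounded_linear_sub)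

lemma bcl_cmult: "bounded_clinear f \<Longrightarrow> bounded_clinear (\<lambda>x. c *\<^sub>C f x)"
  by (auto simp: bounded_clinear_def scaleC_scaleC mult.commute
      intro: bounded_linear_compose[OF bounded_linear_scaleC_right])

lemma bcl_setsum: "finite I \<Longrightarrow> (\<And>i. i \<in> I \<Longrightarrow> bounded_clinear (f i))
    \<Longrightarrow> bounded_clinear (\<lambda>x. \<Sum>i\<in>I. f i x)"
proof (induction rule: finite_induct)
  case empty
  then show ?case by (simp add: bounded_clinear_def)
next
  case (insert a I)
  then show ?case by (simp add: bcl_plus)
qed

lemma bcl_id: "bounded_clinear (\<lambda>x. x)"
  by (simp add: bounded_clinear_def)

lemma cinner_swap: "cinner x y = cinner u v \<Longrightarrow> cinner y x = cinner v (u :: 'a::complex_hilbert)"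
  by (subst (1 2) cinner_commute) simp

lemma cinner_eq_0_swap: "cinner x y = 0 \<Longrightarrow> cinner y (x :: 'a::complex_hilbert) = 0"
  by (subst cinner_commute) simp

lemma cinner_add_left: "cinner (x + y) z = cinner x z + cinner (y :: 'a::complex_hilbert) z"
  by (metis cinner_commute cinner_add_right complex_cnj_add)

lemma cinner_scaleC_left: "cinner (c *\<^sub>C x) (y :: 'a::complex_hilbert) = cnj c * cinner x y"
  by (metis cinner_commute cinner_scaleC_right complex_cnj_mult)

lemma cinner_zero_right [simp]: "cinner x (0 :: 'a::complex_hilbert) = 0"
  using cinner_scaleC_right[of x 0 x] by simp

lemma cinner_zero_left [simp]: "cinner (0 :: 'a::complex_hilbert) x = 0"
  using cinner_commute[of 0 x] by simp

lemma cinner_minus_right [simp]: "cinner x (- y :: 'a::complex_hilbert) = - cinner x y"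
  using cinner_add_right[of x y "-y"] by (simp add: eq_neg_iff_add_eq_0 add.commute)

lemma cinner_minus_left [simp]: "cinner (- y :: 'a::complex_hilbert) x = - cinner y x"
  using cinner_add_left[of y "-y" x] by (simp add: eq_neg_iff_add_eq_0 add.commute)

lemma cinner_diff_right: "cinner x (y - z :: 'a::complex_hilbert) = cinner x y - cinner x z"
  using cinner_add_right[of x y "- z"] by simp

lemma cinner_diff_left: "cinner (y - z :: 'a::complex_hilbert) x = cinner y x - cinner z x"
  using cinner_add_left[of y "- z" x] by simp

lemma cinner_sum_right: "cinner x (\<Sum>i\<in>I. f i :: 'a::complex_hilbert) = (\<Sum>i\<in>I. cinner x (f i))"
  by (induction I rule: infinite_finite_induct) (auto simp: cinner_add_right)

lemma cinner_sum_left: "cinner (\<Sum>i\<in>I. f i :: 'a::complex_hilbert) x = (\<Sum>i\<in>I. cinner (f i) x)"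
  by (induction I rule: infinite_finite_induct) (auto simp: cinner_add_left)

lemma cinner_scaleR_right: "cinner x (r *\<^sub>R y :: 'a::complex_hilbert) = of_real r * cinner x y"
  by (simp add: scaleR_scaleC cinner_scaleC_right)

lemma cinner_scaleR_left: "cinner (r *\<^sub>R y :: 'a::complex_hilbert) x = of_real r * cinner y x"
  by (simp add: scaleR_scaleC cinner_scaleC_left)

lemma Re_cinner_self: "Re (cinner x x) = (norm (x :: 'a::complex_hilbert))\<^sup>2"
  by (simp add: cinner_norm)

lemma Re_cinner_commute: "Re (cinner x y) = Re (cinner y (x :: 'a::complex_hilbert))"
  by (subst cinner_commute) simp

lemma norm_add_sq: "(norm (x + y :: 'a::complex_hilbert))\<^sup>2 = (norm x)\<^sup>2 + 2 * Re (cinner x y) + (norm y)\<^sup>2"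
  using Re_cinner_commute[of x y]
  by (simp add: Re_cinner_self[symmetric] cinner_add_left cinner_add_right)

lemma norm_diff_sq: "(norm (x - y :: 'a::complex_hilbert))\<^sup>2 = (norm x)\<^sup>2 - 2 * Re (cinner x y) + (norm y)\<^sup>2"
  using norm_add_sq[of x "- y"] by simp

text \<open>For degenerate forms, where one cannot divide by \<open>B y y\<close>, let the parameter tend to infinity.\<close>

lemma form_Cauchy_Schwarz:
  fixes B :: "'a::complex_banach \<Rightarrow> 'a \<Rightarrow> complex"
  assumes add: "\<And>x y z. B x (y + z) = B x y + B x z"
    and scale: "\<And>x y c. B x (c *\<^sub>C y) = c * B x y"
    and herm: "\<And>x y. B x y = cnj (B y x)"
    and pos: "\<And>x. 0 \<le> Re (B x x)"
  shows "(cmod (B x y))\<^sup>2 \<le> Re (B x x) * Re (B y y)"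
proof -
  define b where "b = B x y"
  have addl: "B (x + y) z = B x z + B y z" for x y z
    by (metis add complex_cnj_add herm)
  have scalel: "B (c *\<^sub>C x) y = cnj c * B x y" for c x y
    by (metis scale complex_cnj_mult herm)
  have *: "0 \<le> Re (B x x) - 2 * t * (cmod b)\<^sup>2 + t\<^sup>2 * (cmod b)\<^sup>2 * Re (B y y)" for t :: real
  proof -
    define c where "c = - (of_real t * cnj b)"
    have yx: "B y x = cnj b"
      by (simp add: b_def herm[of y x])
    have "B (x + c *\<^sub>C y) (x + c *\<^sub>C y) = B x x + c * b + cnj c * cnj b + cnj c * c * B y y"
      by (simp add: add addl scale scalel b_def[symmetric] yx algebra_simps)
    moreover have "b * cnj b = of_real ((cmod b)\<^sup>2)"
      by (rule complex_norm_square[symmetric])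
    then have "c * b = - of_real (t * (cmod b)\<^sup>2)" "cnj c * cnj b = - of_real (t * (cmod b)\<^sup>2)"
      "cnj c * c = of_real (t\<^sup>2 * (cmod b)\<^sup>2)"
      by (simp_all add: c_def power2_eq_square mult_ac)
    ultimately show ?thesis
      using pos[of "x + c *\<^sub>C y"] by simp
  qed
  consider "Re (B y y) = 0" | "Re (B y y) > 0"
    using pos[of y] by linarith
  then show ?thesis
  proof cases
    case 1
    have "cmod b = 0"
    proof (rule ccontr)
      assume "cmod b \<noteq> 0"
      then show False
        using *[of "(Re (B x x) + 1) / (2 * (cmod b)\<^sup>2)"] 1 by simp
    qed
    then show ?thesis using 1 by (simp add: b_def)
  next
    case 2
    then show ?thesis
      using *[of "1 / Re (B y y)"] by (simp add: b_def[symmetric] field_simps power2_eq_square)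
  qed
qed

lemma cinner_Cauchy_Schwarz: "cmod (cinner x y) \<le> norm x * norm (y :: 'a::complex_hilbert)"
proof -
  have "(cmod (cinner x y))\<^sup>2 \<le> Re (cinner x x) * Re (cinner y y)"
    by (rule form_Cauchy_Schwarz[OF cinner_add_right cinner_scaleC_right cinner_commute])
      (simp add: cinner_norm)
  then have "(cmod (cinner x y))\<^sup>2 \<le> (norm x * norm y)\<^sup>2"
    by (simp add: Re_cinner_self power_mult_distrib)
  then show ?thesis
    by (rule power2_le_imp_le) simp
qed

lemma bounded_bilinear_cinner: "bounded_bilinear (cinner :: 'a::complex_hilbert \<Rightarrow> _)"
  by (rule bounded_bilinear.intro)
    (auto simp: cinner_add_left cinner_add_right cinner_scaleR_left cinner_scaleR_right
      scaleR_conv_of_real intro!: exI[of _ 1] cinner_Cauchy_Schwarz)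

lemmas tendsto_cinner [tendsto_intros] = bounded_bilinear.tendsto[OF bounded_bilinear_cinner]
  and continuous_on_cinner [continuous_intros] =
    bounded_bilinear.continuous_on[OF bounded_bilinear_cinner]

lemma cinner_ext: "(\<And>x. cinner x y = cinner x z) \<Longrightarrow> y = (z :: 'a::complex_hilbert)"
proof -
  assume "\<And>x. cinner x y = cinner x z"
  then have "cinner (y - z) (y - z) = 0"
    by (simp add: cinner_diff_right)
  then show ?thesis by (simp add: cinner_norm)
qed

lemma norm_le_of_cinner:
  fixes y :: "'a::complex_hilbert"
  assumes "0 \<le> C" "\<And>x. cmod (cinner x y) \<le> C * norm x"
  shows "norm y \<le> C"
proof (cases "y = 0")
  case False
  have "norm y * norm y \<le> C * norm y"
    using assms(2)[of y] by (simp add: cinner_norm power2_eq_square norm_mult)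
  then show ?thesis using False by simp
qed (simp add: assms)

text \<open>A minimizing sequence is Cauchy by the parallelogram law, and the first variation at the
  limit gives orthogonality. Real subspaces and real parts are used because
  \<open>density_sa\<close> needs the statement for images of self-adjoint elements, which do not
  form a complex subspace.\<close>

lemma closest_point_subspace:
  fixes L :: "'a::complex_hilbert set"
  assumes L: "subspace L" "closed L"
  obtains p where "p \<in> L" "\<And>y. y \<in> L \<Longrightarrow> Re (cinner y (x - p)) = 0"
proof -
  define d where "d = Inf ((\<lambda>y. (norm (x - y))\<^sup>2) ` L)"
  have bdd: "bdd_below ((\<lambda>y. (norm (x - y))\<^sup>2) ` L)"
    by (rule bdd_belowI[of _ 0]) auto
  have ne: "L \<noteq> {}" using L subspace_0 by blast
  have d_le: "d \<le> (norm (x - y))\<^sup>2" if "y \<in> L" for y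
    unfolding d_def using that bdd by (intro cInf_lower) auto
  have "\<exists>y\<in>L. (norm (x - y))\<^sup>2 < d + 1 / real (Suc n)" for n
  proof -
    have "Inf ((\<lambda>y. (norm (x - y))\<^sup>2) ` L) < d + 1 / real (Suc n)"
      by (simp add: d_def)
    then show ?thesis
      using bdd ne by (subst (asm) cInf_less_iff) auto
  qed
  then obtain p where p: "\<And>n. p n \<in> L" "\<And>n. (norm (x - p n))\<^sup>2 < d + 1 / real (Suc n)"
    by metis
  have par: "(norm (p n - p m))\<^sup>2 \<le> 2 / real (Suc n) + 2 / real (Suc m)" for m n
  proof -
    have mid: "(1/2) *\<^sub>R (p n + p m) \<in> L"
      using L(1) p(1) by (simp add: subspace_add subspace_scale)
    have e1: "(x - p n) + (x - p m) = 2 *\<^sub>R (x - (1/2) *\<^sub>R (p n + p m))"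
      by (simp add: algebra_simps scaleR_2)
    have e2: "(x - p n) - (x - p m) = - (p n - p m)" by simp
    have "(norm (2 *\<^sub>R (x - (1/2) *\<^sub>R (p n + p m))))\<^sup>2 + (norm (p n - p m))\<^sup>2
        = 2 * (norm (x - p n))\<^sup>2 + 2 * (norm (x - p m))\<^sup>2"
      using norm_add_sq[of "x - p n" "x - p m"] norm_diff_sq[of "x - p n" "x - p m"]
      unfolding e1 e2 norm_minus_cancel by linarith
    moreover have "(norm (2 *\<^sub>R (x - (1/2) *\<^sub>R (p n + p m))))\<^sup>2 \<ge> 4 * d"
      using d_le[OF mid] by (simp add: power_mult_distrib)
    ultimately show ?thesis
      using p(2)[of n] p(2)[of m] by linarith
  qed
  have "Cauchy p"
  proof (rule metric_CauchyI)
    fix e :: real assume "e > 0"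
    then have "e\<^sup>2 / 4 > 0" by simp
    then obtain M where M: "1 / real (Suc M) < e\<^sup>2 / 4"
      using nat_approx_posE by blast
    have "dist (p m) (p n) < e" if "m \<ge> M" "n \<ge> M" for m n
    proof -
      have "2 / real (Suc n) \<le> 2 / real (Suc M)" "2 / real (Suc m) \<le> 2 / real (Suc M)"
        using that by (auto intro!: divide_left_mono)
      then have "(norm (p m - p n))\<^sup>2 < e\<^sup>2"
        using par[of m n] M by simp
      then show ?thesis
        using \<open>e > 0\<close> by (simp add: dist_norm power_less_imp_less_base)
    qed
    then show "\<exists>M. \<forall>m\<ge>M. \<forall>n\<ge>M. dist (p m) (p n) < e" by blast
  qed
  then obtain q where q: "p \<longlonglongrightarrow> q"
    using Cauchy_convergent convergent_def by blast
  have "q \<in> L"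
    using closed_sequentially[OF L(2) _ q] p(1) by blast
  have lim: "(\<lambda>n. (norm (x - p n))\<^sup>2) \<longlonglongrightarrow> (norm (x - q))\<^sup>2"
    by (intro tendsto_intros q)
  have "(\<lambda>n. d + 1 / real (Suc n)) \<longlonglongrightarrow> d + 0"
    by (intro tendsto_intros LIMSEQ_Suc[OF lim_1_over_n])
  then have qd: "(norm (x - q))\<^sup>2 \<le> d"
    using LIMSEQ_le[OF lim] p(2) by (metis (no_types, lifting) add.right_neutral less_imp_le)
  have "Re (cinner y (x - q)) = 0" if "y \<in> L" for y
  proof -
    define r where "r = Re (cinner (x - q) y)"
    have *: "2 * t * r \<le> t\<^sup>2 * (norm y)\<^sup>2" for t :: real
    proof -
      have "q + t *\<^sub>R y \<in> L"
        using L(1) \<open>q \<in> L\<close> that by (simp add: subspace_add subspace_scale)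
      then have "(norm (x - q))\<^sup>2 \<le> (norm ((x - q) - t *\<^sub>R y))\<^sup>2"
        using d_le qd by (metis diff_diff_eq dual_order.trans)
      then show ?thesis
        by (simp add: norm_diff_sq[of "x - q"] cinner_scaleR_right r_def power_mult_distrib)
    qed
    have "r = 0"
    proof (rule ccontr)
      assume "r \<noteq> 0"
      \<comment> \<open>The optimal parameter is r divided by the square of \<open>norm y\<close>;
        adding 1 keeps the quotient legitimate for y = 0.\<close>
      define s where "s = (norm y)\<^sup>2 + 1"
      have "s > 0" by (simp add: s_def add_nonneg_pos)
      have "2 * (r / s) * r \<le> (r / s)\<^sup>2 * (norm y)\<^sup>2" by (rule *)
      also have "\<dots> \<le> (r / s)\<^sup>2 * s" by (simp add: s_def algebra_simps)
      finally have "2 * r\<^sup>2 \<le> r\<^sup>2"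
        using \<open>s > 0\<close> by (simp add: field_simps power2_eq_square)
      then show False using \<open>r \<noteq> 0\<close> by simp
    qed
    then show ?thesis by (simp add: r_def Re_cinner_commute)
  qed
  then show ?thesis using that \<open>q \<in> L\<close> by blast
qed

lemma norm_le_of_orth: "cinner p q = 0 \<Longrightarrow> norm p \<le> norm (p + q :: 'a::complex_hilbert)"
  by (rule power2_le_imp_le) (simp_all add: norm_add_sq)

lemma orthogonal_decomposition:
  fixes L :: "'a::complex_hilbert set"
  assumes L: "csubspace L" "closed L"
  obtains p where "p \<in> L" "\<And>y. y \<in> L \<Longrightarrow> cinner y (x - p) = 0"
proof -
  obtain p where p: "p \<in> L" "\<And>y. y \<in> L \<Longrightarrow> Re (cinner y (x - p)) = 0"
    using closest_point_subspace[OF csubspace_imp_subspace[OF L(1)] L(2)] by metis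
  have "cinner y (x - p) = 0" if "y \<in> L" for y
  proof (rule complex_eqI)
    \<comment> \<open>Testing with \<open>\<i> *\<^sub>C y\<close> turns the real part into the
      imaginary part.\<close>
    have "\<i> *\<^sub>C y \<in> L" using L(1) that by (rule cvs.subspace_scale)
    from p(2)[OF this] show "Im (cinner y (x - p)) = Im 0"
      by (simp add: cinner_scaleC_left)
  qed (use p(2)[OF that] in simp)
  then show ?thesis using that p(1) by blast
qed

definition proj :: "'a::complex_hilbert set \<Rightarrow> 'a \<Rightarrow> 'a"
  where "proj L x = (SOME p. p \<in> L \<and> (\<forall>y\<in>L. cinner y (x - p) = 0))"

lemma
  assumes "csubspace L" "closed L"
  shows proj_in: "proj L x \<in> L"
    and proj_orth: "y \<in> L \<Longrightarrow> cinner y (x - proj L x) = 0"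
proof -
  have "\<exists>p. p \<in> L \<and> (\<forall>y\<in>L. cinner y (x - p) = 0)"
    by (rule orthogonal_decomposition[OF assms, of x]) blast
  from someI_ex[OF this] show "proj L x \<in> L" "y \<in> L \<Longrightarrow> cinner y (x - proj L x) = 0"
    unfolding proj_def by blast+
qed

lemma proj_unique:
  assumes L: "csubspace L" "closed L" and p: "p \<in> L" "\<And>y. y \<in> L \<Longrightarrow> cinner y (x - p) = 0"
  shows "proj L x = p"
proof -
  have d: "proj L x - p \<in> L"
    using L p(1) by (simp add: proj_in cvs.subspace_diff)
  have "cinner (proj L x - p) (proj L x - p) =
      cinner (proj L x - p) (x - p) - cinner (proj L x - p) (x - proj L x)"
    by (simp add: cinner_diff_right)
  also have "\<dots> = 0"
    using p(2)[OF d] proj_orth[OF L d] by simp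
  finally show ?thesis by (simp add: cinner_norm)
qed

lemma proj_fix: "csubspace L \<Longrightarrow> closed L \<Longrightarrow> x \<in> L \<Longrightarrow> proj L x = x"
  by (rule proj_unique) auto

lemma bcl_proj:
  assumes L: "csubspace L" "closed L"
  shows "bounded_clinear (proj L)"
proof (rule bounded_clinearI[where K = 1])
  show "proj L (x + y) = proj L x + proj L y" for x y
  proof (rule proj_unique[OF L])
    show "cinner z (x + y - (proj L x + proj L y)) = 0" if "z \<in> L" for z
      unfolding add_diff_add by (simp only: cinner_add_right proj_orth[OF L that] add_0)
  qed (rule cvs.subspace_add[OF L(1) proj_in[OF L] proj_in[OF L]])
  show "proj L (c *\<^sub>C x) = c *\<^sub>C proj L x" for c x
  proof (rule proj_unique[OF L])
    show "cinner z (c *\<^sub>C x - c *\<^sub>C proj L x) = 0" if "z \<in> L" for z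
      unfolding cvs.scale_right_diff_distrib[symmetric]
      by (simp only: cinner_scaleC_right proj_orth[OF L that] mult_zero_right)
  qed (rule cvs.subspace_scale[OF L(1) proj_in[OF L]])
  show "norm (proj L x) \<le> 1 * norm x" for x
    using norm_le_of_orth[OF proj_orth[OF L proj_in[OF L]], of x x] by simp
qed

text \<open>Since \<open>G'\<close> maps L into itself, \<open>G\<close> preserves orthogonality to
  L. The adjoint is passed as an explicit map, so that the lemma applies directly to
  representations, where it is the action of \<open>a\<^sup>\<star>\<close>, as well as to
  \<open>adj\<close>.\<close>

lemma proj_commute:
  assumes L: "csubspace L" "closed L"
    and adj: "\<And>x y. cinner (G x) y = cinner x (G' y)"
    and lin: "bounded_clinear G"
    and inv: "\<And>x. x \<in> L \<Longrightarrow> G x \<in> L" "\<And>x. x \<in> L \<Longrightarrow> G' x \<in> L"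
  shows "proj L (G x) = G (proj L x)"
proof (rule proj_unique[OF L])
  show "cinner y (G x - G (proj L x)) = 0" if "y \<in> L" for y
  proof -
    have "cinner y (G z) = cinner (G' y) z" for z
      by (rule cinner_swap[OF adj])
    then have "cinner y (G x - G (proj L x)) = cinner (G' y) (x - proj L x)"
      by (simp only: cinner_diff_right)
    then show ?thesis by (simp only: proj_orth[OF L inv(2)[OF that]])
  qed
qed (simp add: proj_in L inv)

lemma csubspace_closure: "csubspace L \<Longrightarrow> csubspace (closure L)"
  unfolding cvs.subspace_def
proof (intro conjI ballI allI; elim conjE)
  assume L: "0 \<in> L" "\<forall>x\<in>L. \<forall>y\<in>L. x + y \<in> L" "\<forall>c. \<forall>x\<in>L. c *\<^sub>C x \<in> L"
  show "0 \<in> closure L"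
    using L closure_subset by blast
  show "x + y \<in> closure L" if "x \<in> closure L" "y \<in> closure L" for x y
    using L that unfolding closure_sequential
    by (metis (no_types, lifting) tendsto_add)
  show "c *\<^sub>C x \<in> closure L" if "x \<in> closure L" for c x
    using L that unfolding closure_sequential
    by (metis (no_types, lifting) tendsto_scaleC)
qed

lemma closure_eq_UNIV_of_orth:
  fixes L :: "'a::complex_hilbert set"
  assumes L: "csubspace L" and orth: "\<And>x. (\<And>y. y \<in> L \<Longrightarrow> cinner y x = 0) \<Longrightarrow> x = 0"
  shows "closure L = UNIV"
proof -
  note cl = csubspace_closure[OF L]
  have "x \<in> closure L" for x
  proof -
    have "x - proj (closure L) x = 0"
      by (rule orth) (use closure_subset proj_orth[OF cl closed_closure] in blast)
    then show ?thesis
      using proj_in[OF cl closed_closure, of x] by simp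
  qed
  then show ?thesis by blast
qed

lemma Riesz:
  fixes f :: "'a::complex_hilbert \<Rightarrow> complex"
  assumes f: "bounded_clinear f"
  shows "\<exists>z. \<forall>x. f x = cinner z x"
proof (cases "\<forall>x. f x = 0")
  case True
  then show ?thesis by (intro exI[of _ 0]) simp
next
  case False
  define L where "L = {x. f x = 0}"
  have L: "csubspace L"
    by (auto simp: L_def cvs.subspace_def bcl_0[OF f] bcl_add[OF f] bcl_scaleC[OF f])
  have cL: "closed L"
    unfolding L_def
    by (rule closed_Collect_eq[OF bcl_continuous_on[OF f continuous_on_id] continuous_on_const])
  obtain x0 where x0: "f x0 \<noteq> 0" using False by blast
  define u where "u = x0 - proj L x0"
  have fu: "f u = f x0"
    using proj_in[OF L cL, of x0] by (simp add: u_def bcl_diff[OF f] L_def)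
  then have un: "u \<noteq> 0" using x0 bcl_0[OF f] by auto
  have "f x = cinner ((cnj (f u) / of_real ((norm u)\<^sup>2)) *\<^sub>C u) x" for x
  proof -
    have "x - (f x / f u) *\<^sub>C u \<in> L"
      using fu x0 by (simp add: L_def bcl_diff[OF f] bcl_scaleC[OF f] scaleC_complex_def)
    then have "cinner (x - (f x / f u) *\<^sub>C u) u = 0"
      unfolding u_def by (rule proj_orth[OF L cL])
    then have "cinner u (x - (f x / f u) *\<^sub>C u) = 0"
      by (rule cinner_eq_0_swap)
    then have "cinner u x = f x / f u * of_real ((norm u)\<^sup>2)"
      by (simp add: cinner_diff_right cinner_scaleC_right cinner_norm)
    then show ?thesis
      using fu x0 un by (simp add: cinner_scaleC_left)
  qed
  then show ?thesis by blast
qed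

definition adj :: "('a::complex_hilbert \<Rightarrow> 'b::complex_hilbert) \<Rightarrow> 'b \<Rightarrow> 'a"
  where "adj T y = (SOME z. \<forall>x. cinner y (T x) = cinner z x)"

lemma bcl_cinner: "bounded_clinear (\<lambda>x. cinner y x)"
  by (rule bounded_clinearI[where K = "norm y"])
    (simp_all add: cinner_add_right cinner_scaleC_right scaleC_complex_def cinner_Cauchy_Schwarz)

lemma adj_left: "bounded_clinear T \<Longrightarrow> cinner (adj T y) x = cinner y (T x)"
proof -
  assume T: "bounded_clinear T"
  have "\<exists>z. \<forall>x. cinner y (T x) = cinner z x"
    by (rule Riesz[OF bcl_compose[OF bcl_cinner T]])
  then have "\<forall>x. cinner y (T x) = cinner (adj T y) x"
    unfolding adj_def by (rule someI_ex)
  then show ?thesis by (simp only:)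
qed

lemma adj_right: "bounded_clinear T \<Longrightarrow> cinner x (adj T y) = cinner (T x) y"
  by (rule cinner_swap) (rule adj_left)

lemma adj_norm:
  assumes T: "bounded_clinear T" and K: "0 \<le> K" "\<And>x. norm (T x) \<le> K * norm x"
  shows "norm (adj T y) \<le> K * norm y"
proof (rule norm_le_of_cinner)
  show "cmod (cinner x (adj T y)) \<le> K * norm y * norm x" for x
    using cinner_Cauchy_Schwarz[of "T x" y] mult_right_mono[OF K(2)[of x] norm_ge_zero[of y]]
    by (simp add: adj_right[OF T] mult_ac)
qed (use K in simp)

lemma bcl_adj:
  assumes T: "bounded_clinear T"
  shows "bounded_clinear (adj T)"
proof (rule bounded_clinearI[where K = "onorm T"])
  show "adj T (x + y) = adj T x + adj T y" for x y
    by (rule cinner_ext) (simp add: adj_right[OF T] cinner_add_right)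
  show "adj T (c *\<^sub>C x) = c *\<^sub>C adj T x" for c x
    by (rule cinner_ext) (simp add: adj_right[OF T] cinner_scaleC_right)
  show "norm (adj T x) \<le> onorm T * norm x" for x
    using adj_norm[OF T onorm_pos_le[OF bounded_clinear_bl[OF T]] bcl_norm[OF T]] .
qed

section \<open>$C^*$-algebras\<close>

lemma star_zero [simp]: "(0::'a::cstar_algebra)\<^sup>\<star> = 0"
  using star_add[of "0::'a" 0] by simp

lemma star_one [simp]: "(1::'a::cstar_algebra)\<^sup>\<star> = 1"
  by (metis mult.right_neutral star_mult star_star)

lemma star_minus: "(- a)\<^sup>\<star> = - (a::'a::cstar_algebra)\<^sup>\<star>"
  using star_add[of a "- a"] by (simp add: eq_neg_iff_add_eq_0 add.commute)

lemma star_diff: "(a - b)\<^sup>\<star> = a\<^sup>\<star> - (b::'a::cstar_algebra)\<^sup>\<star>"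
  using star_add[of a "- b"] by (simp add: star_minus)

lemma star_scaleR: "(r *\<^sub>R a)\<^sup>\<star> = r *\<^sub>R (a::'a::cstar_algebra)\<^sup>\<star>"
  by (simp add: scaleR_scaleC star_scaleC)

lemma norm_star [simp]: "norm (a\<^sup>\<star>) = norm (a::'a::cstar_algebra)"
proof -
  have "norm a \<le> norm (a\<^sup>\<star>)" for a :: 'a
  proof (cases "a = 0")
    case False
    have "norm a * norm a \<le> norm (a\<^sup>\<star>) * norm a"
      using norm_mult_ineq[of "a\<^sup>\<star>" a] by (simp add: norm_star_mult power2_eq_square)
    then show ?thesis using False by simp
  qed simp
  from this[of a] this[of "a\<^sup>\<star>"] show ?thesis by (simp add: star_star)
qed

text \<open>The C*-identity doubles exponents, so only powers of two occur. This stands in for the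
  spectral radius formula: estimates of these powers up to a fixed factor give sharp estimates of
  \<open>norm a\<close>.\<close>

lemma norm_sa_power:
  fixes a :: "'a::cstar_algebra"
  assumes "a\<^sup>\<star> = a"
  shows "norm (a ^ 2 ^ k) = norm a ^ 2 ^ k"
proof (induction k)
  case (Suc k)
  have "(a ^ n)\<^sup>\<star> = a ^ n" for n
    by (induction n) (simp_all add: star_mult assms power_commutes)
  then have "norm (a ^ 2 ^ k * a ^ 2 ^ k) = (norm (a ^ 2 ^ k))\<^sup>2"
    using norm_star_mult[of "a ^ 2 ^ k"] by simp
  then show ?case
    using Suc by (simp add: power_add[symmetric] mult_2 power2_eq_square)
qed simp

section \<open>Invertibility, resolvents of self-adjoint elements and square roots\<close>

definition inv_pair :: "'a::monoid_mult \<Rightarrow> 'a \<Rightarrow> bool"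
  where "inv_pair a b \<longleftrightarrow> a * b = 1 \<and> b * a = 1"

lemma Neumann:
  fixes x :: "'a::{real_normed_algebra_1,banach}"
  assumes "norm x < 1"
  shows "\<exists>y. inv_pair (1 - x) y"
proof -
  define y where "y = (\<Sum>n. x ^ n)"
  have sum: "summable (\<lambda>n. x ^ n)"
    by (rule complete_algebra_summable_geometric) (rule assms)
  have e: "(\<Sum>n. x ^ Suc n) = y - 1"
    using suminf_split_head[OF sum] by (simp add: y_def)
  have "x * y = y - 1"
    using suminf_mult[OF sum, of x] e by (simp add: y_def)
  moreover have "y * x = y - 1"
    using suminf_mult2[OF sum, of x] e by (simp add: y_def power_commutes)
  ultimately show ?thesis
    by (intro exI[of _ y]) (simp add: inv_pair_def algebra_simps)
qed

text \<open>With \<open>x = (a - a') * b\<close> one has \<open>a' = (1 - x) * a\<close>, and the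
  first factor is invertible by the Neumann series.\<close>

lemma inv_pair_perturb:
  fixes a :: "'a::{real_normed_algebra_1,banach}"
  assumes ab: "inv_pair a b" and "norm ((a - a') * b) < 1"
  shows "\<exists>c. inv_pair a' c"
proof -
  define x where "x = (a - a') * b"
  obtain y where y: "inv_pair (1 - x) y"
    using Neumann assms(2) unfolding x_def by blast
  have a': "a' = (1 - x) * a"
    using ab by (simp add: x_def inv_pair_def algebra_simps)
  have "a' * (b * y) = (1 - x) * (a * b) * y" "b * y * a' = b * (y * (1 - x)) * a"
    unfolding a' by (simp_all add: mult.assoc)
  then show ?thesis
    using ab y by (intro exI[of _ "b * y"]) (simp add: inv_pair_def)
qed

lemma inv_pair_star: "inv_pair a b \<Longrightarrow> inv_pair (a\<^sup>\<star>) ((b::'a::cstar_algebra)\<^sup>\<star>)"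
  by (simp add: inv_pair_def star_mult[symmetric])

text \<open>The resolvent identity shows that \<open>c - c\<^sup>\<star>\<close> is -2 i t times
  \<open>c\<^sup>\<star> * c\<close>; by the C*-identity twice t times the square of
  \<open>norm c\<close> is at most \<open>2 * norm c\<close>.\<close>

lemma resolvent_norm:
  fixes b :: "'a::cstar_algebra"
  assumes b: "b\<^sup>\<star> = b" and t: "t > 0" and c: "inv_pair (b + (\<i> * of_real t) *\<^sub>C 1) c"
  shows "norm c \<le> 1 / t"
proof (cases "c = 0")
  case False
  define e :: 'a where "e = (\<i> * of_real t) *\<^sub>C 1"
  have es: "e\<^sup>\<star> = - e" by (simp add: e_def star_scaleC)
  have c1: "(b + e) * c = 1" and c2: "c\<^sup>\<star> * (b - e) = 1"
    using c inv_pair_star[OF c] b es by (simp_all add: inv_pair_def e_def[symmetric] star_add)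
  have "c - c\<^sup>\<star> = c\<^sup>\<star> * (b - e) * c - c\<^sup>\<star> * ((b + e) * c)"
    by (simp add: c1 c2)
  also have "\<dots> = - (2 *\<^sub>R (c\<^sup>\<star> * e * c))"
    by (simp add: algebra_simps scaleR_2)
  also have "c\<^sup>\<star> * e * c = (\<i> * of_real t) *\<^sub>C (c\<^sup>\<star> * c)"
    by (simp add: e_def scaleC_mult_left scaleC_mult_right)
  finally have "norm (c - c\<^sup>\<star>) = 2 * t * (norm c)\<^sup>2"
    using t by (simp add: norm_scaleC norm_mult norm_star_mult)
  moreover have "norm (c - c\<^sup>\<star>) \<le> 2 * norm c"
    using norm_triangle_ineq4[of c "c\<^sup>\<star>"] by simp
  ultimately have "t * norm c * norm c \<le> 1 * norm c"
    by (simp add: power2_eq_square)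
  then have "t * norm c \<le> 1"
    using False by (subst (asm) mult_le_cancel_right) simp
  then show ?thesis using t by (simp add: field_simps)
qed (use t in simp)

text \<open>For a large imaginary part s the element is a small perturbation of an invertible
  scalar. The resolvent bound 1 / s does not involve b and allows moving from s down to t in a
  single step, since (s - t) / s < 1.\<close>

lemma resolvent:
  fixes b :: "'a::cstar_algebra"
  assumes b: "b\<^sup>\<star> = b" and t: "t > 0"
  shows "\<exists>c. inv_pair (b + (\<i> * of_real t) *\<^sub>C 1) c \<and> inv_pair (b - (\<i> * of_real t) *\<^sub>C 1) (c\<^sup>\<star>) \<and>
    norm c \<le> 1 / t"
proof -
  define e :: "real \<Rightarrow> 'a" where "e t = (\<i> * of_real t) *\<^sub>C 1" for t
  define s where "s = max t (norm b + 1)"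
  have s: "s > 0" "t \<le> s" "norm b < s"
    using t by (auto simp: s_def)
  have "inv_pair (e s) ((1 / (\<i> * of_real s)) *\<^sub>C 1)"
    using s by (simp add: inv_pair_def e_def scaleC_mult_left scaleC_scaleC scaleC_one)
  moreover have "norm ((e s - (b + e s)) * ((1 / (\<i> * of_real s)) *\<^sub>C 1)) < 1"
    using s by (simp add: scaleC_mult_right norm_scaleC norm_divide norm_mult)
  ultimately obtain c where c: "inv_pair (b + e s) c"
    using inv_pair_perturb by blast
  have "norm c \<le> 1 / s"
    by (rule resolvent_norm[OF b s(1) c[unfolded e_def]])
  have "b + e s - (b + e t) = (\<i> * of_real (s - t)) *\<^sub>C 1"
    unfolding e_def add_diff_cancel_left cvs.scale_left_diff_distrib[symmetric]
    by (simp add: right_diff_distrib)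
  then have "norm ((b + e s - (b + e t)) * c) = cmod (\<i> * of_real (s - t)) * norm c"
    by (simp only: scaleC_mult_left norm_scaleC mult_1_left)
  also have "\<dots> = (s - t) * norm c"
    using s by (simp add: norm_mult del: of_real_diff)
  also have "\<dots> \<le> (s - t) * (1 / s)"
    using s(2) \<open>norm c \<le> 1 / s\<close> by (intro mult_left_mono) auto
  also have "\<dots> < 1" using s t by (simp add: field_simps)
  finally obtain d where d: "inv_pair (b + e t) d"
    using inv_pair_perturb[OF c] by blast
  have "(b + e t)\<^sup>\<star> = b - e t"
    by (simp add: star_add b e_def star_scaleC)
  then show ?thesis
    using d inv_pair_star[OF d] resolvent_norm[OF b t] by (auto simp: e_def)
qed

text \<open>Writing the root as 1 - r turns the equation into r = (x + r^2) / 2, whose right-hand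
  side is a contraction with constant \<open>norm x\<close> on the ball of that radius. Uniqueness
  of the fixed point makes r self-adjoint.\<close>

lemma sqrt_exists:
  fixes x :: "'a::cstar_algebra"
  assumes x: "x\<^sup>\<star> = x" and "norm x < 1"
  shows "\<exists>c. c\<^sup>\<star> = c \<and> c * c = 1 - x"
proof -
  define f where "f r = (1/2) *\<^sub>R (x + r * r)" for r
  have q: "norm (r * r) \<le> norm x" if "norm r \<le> norm x" for r :: 'a
  proof -
    have "norm (r * r) \<le> norm r * norm r" by (rule norm_mult_ineq)
    also have "\<dots> \<le> norm x * 1"
      using that assms(2) by (intro mult_mono) auto
    finally show ?thesis by simp
  qed
  have ex: "\<exists>!r. r \<in> cball 0 (norm x) \<and> f r = r"
  proof (rule Banach_fix)
    show "complete (cball 0 (norm x) :: 'a set)"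
      by (simp add: complete_eq_closed)
    show "f ` cball 0 (norm x) \<subseteq> cball 0 (norm x)"
    proof clarsimp
      fix r :: 'a assume "norm r \<le> norm x"
      then show "norm (f r) \<le> norm x"
        using norm_triangle_ineq[of x "r * r"] q[of r] by (simp add: f_def)
    qed
    show "dist (f r) (f s) \<le> norm x * dist r s"
      if "r \<in> cball 0 (norm x)" "s \<in> cball 0 (norm x)" for r s
    proof -
      have e: "f r - f s = (1/2) *\<^sub>R (r * (r - s) + (r - s) * s)"
        by (simp add: f_def algebra_simps)
      have "norm (r * (r - s) + (r - s) * s) \<le> norm r * norm (r - s) + norm (r - s) * norm s"
        by (intro order.trans[OF norm_triangle_ineq] add_mono norm_mult_ineq)
      also have "\<dots> \<le> norm x * norm (r - s) + norm (r - s) * norm x"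
        using that by (intro add_mono mult_mono) auto
      finally show ?thesis
        unfolding dist_norm e by (simp add: mult.commute)
    qed
  qed (use assms in auto)
  then obtain r where r: "norm r \<le> norm x" "f r = r" by auto
  have "f (r\<^sup>\<star>) = (f r)\<^sup>\<star>"
    by (simp add: f_def star_scaleR star_add star_mult x)
  then have rs: "r\<^sup>\<star> = r"
    using ex r by (metis dist_0_norm mem_cball norm_star)
  have "x + r * r = 2 *\<^sub>R f r" by (simp add: f_def)
  then have "x + r * r = r + r" using r by (simp add: scaleR_2)
  then have "(1 - r) * (1 - r) = 1 - x"
    by (simp add: algebra_simps)
  moreover have "(1 - r)\<^sup>\<star> = 1 - r" by (simp add: star_diff rs)
  ultimately show ?thesis by blast
qed

text \<open>Kept apart from \<open>normal_representation\<close> so as to cover also \<pi> composed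
  with an automorphism, whose normality is not known beforehand.\<close>

locale star_rep =
  fixes \<sigma> :: "'a::cstar_algebra \<Rightarrow> 'h::complex_hilbert \<Rightarrow> 'h"
  assumes bcl: "bounded_clinear (\<sigma> a)"
    and add: "\<sigma> (a + b) h = \<sigma> a h + \<sigma> b h"
    and scaleC: "\<sigma> (c *\<^sub>C a) h = c *\<^sub>C \<sigma> a h"
    and mult: "\<sigma> (a * b) h = \<sigma> a (\<sigma> b h)"
    and star: "cinner (\<sigma> a h) k = cinner h (\<sigma> (a\<^sup>\<star>) k)"
    and one: "\<sigma> 1 h = h"
begin

lemma zero: "\<sigma> 0 h = 0"
  using scaleC[of 0 0 h] by simp

lemma minus: "\<sigma> (- a) h = - \<sigma> a h"
  using scaleC[of "-1" a h] by simp

lemma diff: "\<sigma> (a - b) h = \<sigma> a h - \<sigma> b h"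
  using add[of a "- b" h] by (simp add: minus)

lemma scaleR: "\<sigma> (r *\<^sub>R a) h = r *\<^sub>R \<sigma> a h"
  by (simp add: scaleR_scaleC scaleC)

lemma star_sa: "a\<^sup>\<star> = a \<Longrightarrow> cinner (\<sigma> a h) k = cinner h (\<sigma> a k)"
  using star[of a] by simp

text \<open>For \<open>norm a < 1\<close> the element \<open>1 - a\<^sup>\<star> * a\<close> is
  \<open>c * c\<close> with c self-adjoint, so the square of \<open>norm (\<sigma> a h)\<close> is
  that of \<open>norm h\<close> diminished by that of \<open>norm (\<sigma> c h)\<close>. The
  general case follows by scaling.\<close>

lemma contractive: "norm (\<sigma> a h) \<le> norm a * norm h"
proof -
  have *: "norm (\<sigma> a h) \<le> norm h" if "norm a < 1" for a
  proof -
    have "norm (a\<^sup>\<star> * a) < 1"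
      using that by (simp add: norm_star_mult power_less_one_iff)
    then obtain c where c: "c\<^sup>\<star> = c" "c * c = 1 - a\<^sup>\<star> * a"
      using sqrt_exists[of "a\<^sup>\<star> * a"] by (auto simp: star_mult star_star)
    have "cinner (\<sigma> a h) (\<sigma> a h) = cinner h (\<sigma> (1 - c * c) h)"
      by (simp add: star mult[symmetric] c)
    also have "\<dots> = cinner h h - cinner (\<sigma> c h) (\<sigma> c h)"
      by (simp add: diff one mult star_sa[OF c(1)] cinner_diff_right)
    finally have "Re (cinner (\<sigma> a h) (\<sigma> a h)) = Re (cinner h h - cinner (\<sigma> c h) (\<sigma> c h))"
      by simp
    then have "(norm (\<sigma> a h))\<^sup>2 = (norm h)\<^sup>2 - (norm (\<sigma> c h))\<^sup>2"
      by (simp add: Re_cinner_self)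
    then have "(norm (\<sigma> a h))\<^sup>2 \<le> (norm h)\<^sup>2" by simp
    then show ?thesis by (rule power2_le_imp_le) simp
  qed
  have **: "norm (\<sigma> a h) \<le> r * norm h" if "norm a < r" for r
  proof -
    have r: "r > 0" using that norm_ge_zero[of a] by linarith
    have "norm (\<sigma> ((1 / r) *\<^sub>R a) h) \<le> norm h"
      using that r by (intro *) simp
    then show ?thesis using r by (simp add: scaleR field_simps)
  qed
  show ?thesis
  proof (cases "h = 0")
    case True
    then show ?thesis using bcl_0[OF bcl] by simp
  next
    case False
    have "norm (\<sigma> a h) / norm h \<le> norm a"
      by (rule dense_ge) (use ** False in \<open>simp add: field_simps\<close>)
    then show ?thesis using False by (simp add: field_simps)
  qed
qed

lemma tendsto_left: "(f \<longlongrightarrow> a) F \<Longrightarrow> ((\<lambda>x. \<sigma> (f x) h) \<longlongrightarrow> \<sigma> a h) F"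
proof -
  have "bounded_linear (\<lambda>a. \<sigma> a h)"
    by (rule bounded_linear_intro[where K = "norm h"]) (simp_all add: add scaleR contractive)
  then show "(f \<longlongrightarrow> a) F \<Longrightarrow> ?thesis" by (rule bounded_linear.tendsto)
qed

end

section \<open>Weak topologies and the predual\<close>

text \<open>Intersections enlarge the finite family and shrink the radius. This epsilon form is the
  one in which normality and membership in the Hardy algebra are unfolded.\<close>

lemma weak_topology_nbhd:
  assumes "openin (weak_topology D V) U" "x \<in> U"
  shows "\<exists>Fs e. finite Fs \<and> Fs \<subseteq> V \<and> e > 0 \<and>
    (\<forall>y\<in>D. (\<forall>f\<in>Fs. cmod (f y - f x) < e) \<longrightarrow> y \<in> U)"
proof -
  have "generate_topology_on {{x \<in> D. f x \<in> U} | f U. f \<in> V \<and> open U} U"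
    using assms(1) by (simp add: weak_topology_def openin_topology_generated_by_iff)
  then show ?thesis using assms(2)
  proof (induction arbitrary: x)
    case Empty
    then show ?case by simp
  next
    case (Int a b)
    have "x \<in> a" "x \<in> b" using Int.prems by simp_all
    from Int.IH(1)[OF this(1)] obtain Fs e where
      a: "finite Fs" "Fs \<subseteq> V" "e > 0" "\<And>y. y \<in> D \<Longrightarrow> \<forall>f\<in>Fs. cmod (f y - f x) < e \<Longrightarrow> y \<in> a"
      by blast
    from Int.IH(2)[OF \<open>x \<in> b\<close>] obtain Gs d where
      b: "finite Gs" "Gs \<subseteq> V" "d > 0" "\<And>y. y \<in> D \<Longrightarrow> \<forall>f\<in>Gs. cmod (f y - f x) < d \<Longrightarrow> y \<in> b"
      by blast
    show ?case
      by (rule exI[of _ "Fs \<union> Gs"], rule exI[of _ "min e d"]) (use a b in auto)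
  next
    case (UN K)
    then obtain k where k: "k \<in> K" "x \<in> k" by blast
    from UN.IH[OF this] obtain Fs e where "finite Fs" "Fs \<subseteq> V" "e > 0"
      "\<And>y. y \<in> D \<Longrightarrow> \<forall>f\<in>Fs. cmod (f y - f x) < e \<Longrightarrow> y \<in> k" by blast
    then show ?case using k by blast
  next
    case (Basis s)
    then obtain f U where s: "s = {x \<in> D. f x \<in> U}" "f \<in> V" "open U" by blast
    then have "f x \<in> U" using Basis by simp
    then obtain e where e: "e > 0" "\<And>z. dist z (f x) < e \<Longrightarrow> z \<in> U"
      using s(3) unfolding open_dist by blast
    show ?case
      by (rule exI[of _ "{f}"], rule exI[of _ e]) (use s e in \<open>auto simp: dist_norm\<close>)
  qed
qed

lemma weak_topology_open:
  "f \<in> V \<Longrightarrow> open U \<Longrightarrow> openin (weak_topology D V) {x \<in> D. f x \<in> U}"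
  unfolding weak_topology_def by (rule topology_generated_by_Basis) blast

lemma topspace_weak_topology: "V \<noteq> {} \<Longrightarrow> topspace (weak_topology D V) = D"
  unfolding weak_topology_def topology_generated_by_topspace by auto

text \<open>The set where f is nonzero is open. The lemma carries invariance of subspaces from the
  generators to the Hardy algebra, and vanishing from elementary tensors to the whole Fock
  module.\<close>

lemma weak_closure_annihilator:
  assumes "x \<in> weak_topology D V closure_of S" "f \<in> V" "\<And>y. y \<in> S \<Longrightarrow> f y = 0"
  shows "f x = 0"
proof (rule ccontr)
  assume "f x \<noteq> 0"
  have "topspace (weak_topology D V) = D"
    using assms(2) by (intro topspace_weak_topology) auto
  then have "x \<in> D" using assms(1) by (metis in_closure_of)
  have "openin (weak_topology D V) {x \<in> D. f x \<in> - {0}}"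
    using assms(2) by (intro weak_topology_open) auto
  moreover have "x \<in> {x \<in> D. f x \<in> - {0}}"
    using \<open>x \<in> D\<close> \<open>f x \<noteq> 0\<close> by simp
  ultimately obtain y where "y \<in> S" "y \<in> {x \<in> D. f x \<in> - {0}}"
    using conjunct2[OF assms(1)[unfolded in_closure_of], rule_format] by metis
  then show False using assms(3) by simp
qed

lemma closed_sumsI:
  assumes "g \<in> B" "\<And>x. x \<in> D \<Longrightarrow> 0 \<le> nrm x"
  shows "g \<in> closed_sums nrm D B"
  unfolding closed_sums_def mem_Collect_eq
proof (intro allI impI exI[of _ "[g]"] conjI ballI)
  fix e :: real and x assume "e > 0" "x \<in> D"
  then show "cmod (g x - (\<Sum>g\<leftarrow>[g]. g x)) \<le> e * nrm x"
    using assms(2) by simp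
qed (use assms in auto)

text \<open>The functional \<phi> is a linear combination of the members of \<open>Fs\<close>; only
  the resulting membership in P is recorded. The induction subtracts a multiple of one functional,
  determined at a point where the remaining ones vanish.\<close>

lemma functional_kernel:
  fixes \<phi> :: "'a::complex_banach \<Rightarrow> complex"
  assumes "finite Fs" "Fs \<subseteq> P"
    and P: "\<And>f g. f \<in> P \<Longrightarrow> g \<in> P \<Longrightarrow> (\<lambda>x. f x + g x) \<in> P"
      "\<And>f c. f \<in> P \<Longrightarrow> (\<lambda>x. c * f x) \<in> P" "(\<lambda>_. 0) \<in> P"
    and lin: "\<And>f x y. f \<in> P \<Longrightarrow> f (x + y) = f x + f y" "\<And>f c x. f \<in> P \<Longrightarrow> f (c *\<^sub>C x) = c * f x"
    and \<phi>: "\<And>x y. \<phi> (x + y) = \<phi> x + \<phi> y" "\<And>c x. \<phi> (c *\<^sub>C x) = c * \<phi> x"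
    and ker: "\<And>x. \<forall>f\<in>Fs. f x = 0 \<Longrightarrow> \<phi> x = 0"
  shows "\<phi> \<in> P"
  using assms(1,2) \<phi> ker
proof (induction Fs arbitrary: \<phi> rule: finite_induct)
  case empty
  then have "\<phi> = (\<lambda>_. 0)" by auto
  then show ?case using P(3) by simp
next
  case (insert f Fs)
  have fP: "f \<in> P" using insert.prems(1) by blast
  show ?case
  proof (cases "\<exists>x. (\<forall>g\<in>Fs. g x = 0) \<and> f x \<noteq> 0")
    case False
    show ?thesis
      by (rule insert.IH) (use insert.prems False in auto)
  next
    case True
    then obtain x where x: "\<forall>g\<in>Fs. g x = 0" "f x \<noteq> 0" by blast
    define c where "c = \<phi> x / f x"
    have "(\<lambda>y. \<phi> y + (- c) * f y) \<in> P"
    proof (rule insert.IH)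
      show "Fs \<subseteq> P" using insert.prems(1) by blast
      show "\<phi> (y + z) + - c * f (y + z) = \<phi> y + - c * f y + (\<phi> z + - c * f z)" for y z
        using lin(1)[OF fP] insert.prems(2) by (simp add: algebra_simps)
      show "\<phi> (a *\<^sub>C y) + - c * f (a *\<^sub>C y) = a * (\<phi> y + - c * f y)" for a y
        using lin(2)[OF fP] insert.prems(3) by (simp add: algebra_simps)
      show "\<phi> y + - c * f y = 0" if "\<forall>g\<in>Fs. g y = 0" for y
      proof -
        \<comment> \<open>Correcting y along x makes f vanish without changing the values of the
          functionals in \<open>Fs\<close>.\<close>
        define z where "z = y + (- (f y / f x)) *\<^sub>C x"
        have "\<forall>g\<in>insert f Fs. g z = 0"
        proof
          fix g assume g: "g \<in> insert f Fs"
          then have "g \<in> P" using insert.prems(1) by blast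
          then have "g z = g y + (- (f y / f x)) * g x"
            unfolding z_def by (simp only: lin)
          then show "g z = 0" using g that x by auto
        qed
        then have "\<phi> z = 0" by (rule insert.prems(4))
        moreover have "\<phi> z = \<phi> y + (- (f y / f x)) * \<phi> x"
          unfolding z_def by (simp only: insert.prems)
        ultimately show ?thesis by (simp add: c_def)
      qed
    qed
    from P(1)[OF this P(2)[OF fP, of c]] show ?thesis by simp
  qed
qed

section \<open>Consequences of the predual axioms and weak* compactness\<close>

lemma
  assumes f: "f \<in> (predual :: ('m::wstar_algebra \<Rightarrow> complex) set)"
  shows predual_add: "f (x + y) = f x + f y"
    and predual_scaleC: "f (c *\<^sub>C x) = c * f x"
    and predual_bounded: "\<exists>C. functional_le f C"
proof -
  show ex: "\<exists>C. functional_le f C"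
    using is_predual_predual f unfolding is_predual_def by blast
  then show "f (x + y) = f x + f y" "f (c *\<^sub>C x) = c * f x"
    unfolding functional_le_def by blast+
qed

lemma
  fixes f :: "'m::wstar_algebra \<Rightarrow> complex"
  shows predual_zero: "(\<lambda>_. 0) \<in> (predual :: ('m \<Rightarrow> complex) set)"
    and predual_plus: "f \<in> predual \<Longrightarrow> g \<in> predual \<Longrightarrow> (\<lambda>x. f x + g x) \<in> predual"
    and predual_cmult: "f \<in> predual \<Longrightarrow> (\<lambda>x. c * f x) \<in> predual"
  using is_predual_predual[where 'm='m] unfolding is_predual_def by blast+

lemma norm_predual:
  "norm (a :: 'm::wstar_algebra) = (SUP f\<in>{f \<in> predual. functional_le f 1}. cmod (f a))"
  using is_predual_predual[where 'm='m] unfolding is_predual_def by blast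

lemma predual_dual:
  fixes \<Phi> :: "('m::wstar_algebra \<Rightarrow> complex) \<Rightarrow> complex"
  assumes "\<And>f g. f \<in> predual \<Longrightarrow> g \<in> predual \<Longrightarrow> \<Phi> (\<lambda>x. f x + g x) = \<Phi> f + \<Phi> g"
    and "\<And>c f. f \<in> predual \<Longrightarrow> \<Phi> (\<lambda>x. c * f x) = c * \<Phi> f"
    and "\<And>f C. f \<in> predual \<Longrightarrow> functional_le f C \<Longrightarrow> cmod (\<Phi> f) \<le> K * C"
  shows "\<exists>a. \<forall>f\<in>predual. \<Phi> f = f a"
proof -
  have "\<forall>\<Phi>. (\<forall>f\<in>predual. \<forall>g\<in>predual. \<Phi> (\<lambda>x. f x + g x) = \<Phi> f + \<Phi> g) \<and>
         (\<forall>c. \<forall>f\<in>predual. \<Phi> (\<lambda>x. c * f x) = c * \<Phi> f) \<and>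
         (\<exists>K. \<forall>f\<in>predual. \<forall>C. functional_le f C \<longrightarrow> cmod (\<Phi> f) \<le> K * C)
       \<longrightarrow> (\<exists>a::'m. \<forall>f\<in>predual. \<Phi> f = f a)"
    using is_predual_predual[where 'm='m] unfolding is_predual_def by blast
  then show ?thesis using assms by blast
qed

lemma norm_le_of_predual:
  fixes a :: "'m::wstar_algebra"
  assumes "\<And>f. f \<in> predual \<Longrightarrow> functional_le f 1 \<Longrightarrow> cmod (f a) \<le> C"
  shows "norm a \<le> C"
  unfolding norm_predual
proof (rule cSUP_least)
  have "(\<lambda>_. 0) \<in> {f \<in> predual. functional_le f (1::real)}"
    by (simp add: predual_zero functional_le_def)
  then show "{f \<in> predual. functional_le (f :: 'm \<Rightarrow> complex) 1} \<noteq> {}" by blast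
qed (use assms in auto)

lemma norm_predual_limit:
  fixes a :: "'m::wstar_algebra"
  assumes "F \<noteq> bot" "\<And>f. f \<in> predual \<Longrightarrow> ((\<lambda>i. f (m i)) \<longlongrightarrow> f a) F"
    and "eventually (\<lambda>i. norm (m i) \<le> C) F"
  shows "norm a \<le> C"
proof (rule norm_le_of_predual)
  fix f :: "'m \<Rightarrow> complex" assume f: "f \<in> predual" "functional_le f 1"
  have "eventually (\<lambda>i. cmod (f (m i)) \<le> C) F"
    using assms(3)
  proof eventually_elim
    case (elim i)
    have "cmod (f (m i)) \<le> 1 * norm (m i)"
      using f(2) unfolding functional_le_def by blast
    then show ?case using elim by simp
  qed
  then show "cmod (f a) \<le> C"
    using tendsto_norm[OF assms(2)[OF f(1)]] assms(1) by (intro tendsto_upperbound)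
qed

text \<open>Bounded sets are relatively compact in the weak* topology: by Tychonoff's theorem the values
  at all predual functionals converge along a finer filter, and the limits form a functional on
  the predual.\<close>

lemma weakstar_cluster:
  fixes m :: "'i \<Rightarrow> 'm::wstar_algebra"
  assumes F: "F \<noteq> bot" and bd: "eventually (\<lambda>i. norm (m i) \<le> C) F"
  obtains F' a where "F' \<le> F" "F' \<noteq> bot" "norm a \<le> C"
    "\<And>f. f \<in> predual \<Longrightarrow> ((\<lambda>i. f (m i)) \<longlongrightarrow> f a) F'"
proof -
  define r where "r f = (SOME r. 0 \<le> r \<and> functional_le (f :: 'm \<Rightarrow> complex) r)" for f
  have r: "0 \<le> r f \<and> functional_le f (r f)" if "f \<in> predual" for f :: "'m \<Rightarrow> complex"
    unfolding r_def
  proof (rule someI_ex)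
    obtain c where c: "functional_le f c" using predual_bounded[OF \<open>f \<in> predual\<close>] by blast
    then have "cmod (f 1) \<le> c * norm (1::'m)" unfolding functional_le_def by blast
    then have "0 \<le> c" using order.trans[OF norm_ge_zero, of "f 1" c] by simp
    then show "\<exists>r. 0 \<le> r \<and> functional_le f r" using c by blast
  qed
  have C0: "0 \<le> C"
  proof -
    obtain i where "norm (m i) \<le> C" using eventually_happens'[OF F bd] by blast
    then show ?thesis using norm_ge_zero[of "m i"] by linarith
  qed
  \<comment> \<open>Coordinates are indexed by all functions on M; those outside the predual are
    pinned to 0, so that the product is compact.\<close>
  define T where "T = (PiE UNIV (\<lambda>f :: 'm \<Rightarrow> complex. cball (0::complex) (if f \<in> predual then r f * C else 0)))"
  define \<Phi> where "\<Phi> i f = (if f \<in> predual then f (m i) else 0)" for i and f :: "'m \<Rightarrow> complex"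
  have "compactin (product_topology (\<lambda>_. euclidean) UNIV) T"
    unfolding T_def by (subst compactin_PiE) auto
  then have "compact T"
    by (simp add: euclidean_product_topology)
  moreover have "filtermap \<Phi> F \<noteq> bot"
    using F by (simp add: filtermap_bot_iff)
  moreover have "eventually (\<lambda>x. x \<in> T) (filtermap \<Phi> F)"
    unfolding eventually_filtermap using bd
  proof eventually_elim
    case (elim i)
    have "cmod (f (m i)) \<le> r f * C" if "f \<in> predual" for f
    proof -
      have "cmod (f (m i)) \<le> r f * norm (m i)"
        using r[OF that] unfolding functional_le_def by blast
      also have "\<dots> \<le> r f * C"
        using r[OF that] elim by (intro mult_left_mono) auto
      finally show ?thesis .
    qed
    then show ?case by (auto simp: T_def \<Phi>_def)
  qed
  ultimately obtain \<Psi> where \<Psi>: "\<Psi> \<in> T" "inf (nhds \<Psi>) (filtermap \<Phi> F) \<noteq> bot"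
    unfolding compact_filter by blast
  \<comment> \<open>This filter plays the part of the subnet along which all coordinates converge to
    \<Psi>.\<close>
  define F' where "F' = inf F (filtercomap \<Phi> (nhds \<Psi>))"
  have F': "F' \<noteq> bot"
  proof
    assume "F' = bot"
    then have "eventually (\<lambda>_. False) (inf F (filtercomap \<Phi> (nhds \<Psi>)))"
      by (simp add: F'_def)
    then obtain P Q where PQ: "eventually P F" "eventually Q (filtercomap \<Phi> (nhds \<Psi>))"
      "\<And>i. P i \<Longrightarrow> Q i \<Longrightarrow> False"
      unfolding eventually_inf by blast
    then obtain R where R: "eventually R (nhds \<Psi>)" "\<And>i. R (\<Phi> i) \<Longrightarrow> Q i"
      unfolding eventually_filtercomap by blast
    have "eventually (\<lambda>x. \<not> R x) (filtermap \<Phi> F)"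
      unfolding eventually_filtermap using PQ(1)
      by (rule eventually_mono) (use PQ R in blast)
    then have "eventually (\<lambda>x. False) (inf (nhds \<Psi>) (filtermap \<Phi> F))"
      unfolding eventually_inf using R(1) by blast
    then show False using \<Psi>(2) by (simp add: trivial_limit_def)
  qed
  have lim: "((\<lambda>i. f (m i)) \<longlongrightarrow> \<Psi> f) F'" if f: "f \<in> predual" for f
  proof -
    have \<Phi>lim: "filterlim \<Phi> (nhds \<Psi>) F'"
      unfolding F'_def filterlim_def
      by (rule order.trans[OF filtermap_mono[OF inf_le2]]) (rule filtermap_filtercomap)
    have "((\<lambda>i. \<Phi> i f) \<longlongrightarrow> \<Psi> f) F'"
    proof (rule topological_tendstoI)
      fix S :: "complex set" assume S: "open S" "\<Psi> f \<in> S"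
      have "open ((\<lambda>x :: ('m \<Rightarrow> complex) \<Rightarrow> complex. x f) -` S)"
        by (rule open_vimage[OF S(1) continuous_on_product_coordinates])
      from topological_tendstoD[OF \<Phi>lim this] show "eventually (\<lambda>i. \<Phi> i f \<in> S) F'"
        using S(2) by simp
    qed
    then show ?thesis using f by (simp add: \<Phi>_def)
  qed
  have F'bd: "eventually (\<lambda>i. norm (m i) \<le> C) F'"
    using bd unfolding F'_def by (rule filter_leD[OF inf_le1])
  have "\<exists>a. \<forall>f\<in>predual. \<Psi> f = f a"
  proof (rule predual_dual[where K = C])
    fix f g :: "'m \<Rightarrow> complex" assume fg: "f \<in> predual" "g \<in> predual"
    show "\<Psi> (\<lambda>x. f x + g x) = \<Psi> f + \<Psi> g"
      by (rule tendsto_unique[OF F' lim[OF predual_plus[OF fg]] tendsto_add[OF lim[OF fg(1)] lim[OF fg(2)]]])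
  next
    fix f :: "'m \<Rightarrow> complex" and c assume f: "f \<in> predual"
    show "\<Psi> (\<lambda>x. c * f x) = c * \<Psi> f"
      by (rule tendsto_unique[OF F' lim[OF predual_cmult[OF f]] tendsto_mult_left[OF lim[OF f]]])
  next
    fix f :: "'m \<Rightarrow> complex" and D assume f: "f \<in> predual" "functional_le f D"
    have "cmod (f 1) \<le> D * norm (1::'m)" using f(2) unfolding functional_le_def by blast
    then have D: "0 \<le> D" using order.trans[OF norm_ge_zero, of "f 1" D] by simp
    have "eventually (\<lambda>i. cmod (f (m i)) \<le> C * D) F'"
      using F'bd
    proof eventually_elim
      case (elim i)
      have "cmod (f (m i)) \<le> D * norm (m i)"
        using f(2) unfolding functional_le_def by blast
      also have "\<dots> \<le> D * C" using D elim by (rule mult_left_mono[rotated])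
      finally show ?case by (simp add: mult.commute)
    qed
    then show "cmod (\<Psi> f) \<le> C * D"
      using tendsto_norm[OF lim[OF f(1)]] F' by (intro tendsto_upperbound)
  qed
  then obtain a where "\<And>f. f \<in> predual \<Longrightarrow> \<Psi> f = f a" by blast
  then have lima: "((\<lambda>i. f (m i)) \<longlongrightarrow> f a) F'" if "f \<in> predual" for f
    using lim[OF that] that by simp
  show ?thesis
    by (rule that[of F' a]) (use F' lima norm_predual_limit[OF F' lima F'bd] in \<open>auto simp: F'_def\<close>)
qed

lemma vector_functional_in_predual:
  "(\<lambda>T. cinner h (T k)) \<in> bounded_operators_predual"
  unfolding bounded_operators_predual_def
  by (rule closed_sumsI) (auto simp: bounded_operators_def bounded_clinear_def onorm_pos_le)

context normal_representation
begin

text \<open>The operator \<open>\<pi> 1\<close> fixes all vectors \<open>\<pi> a h\<close>, whose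
  span is dense by nondegeneracy.\<close>

lemma rep_one: "\<pi> 1 h = h"
proof -
  have bcl: "bounded_clinear (\<pi> a)" for a
    using rep_bounded by (simp add: bounded_operators_def)
  define L where "L = {h. \<pi> 1 h = h}"
  have "csubspace L"
    by (auto simp: L_def cvs.subspace_def bcl_0[OF bcl] bcl_add[OF bcl] bcl_scaleC[OF bcl])
  moreover have "{\<pi> a h | a h. True} \<subseteq> L"
    by (auto simp: L_def rep_mult[symmetric])
  ultimately have "cspan {\<pi> a h | a h. True} \<subseteq> L"
    by (metis cvs.span_minimal)
  moreover have "closed L"
    unfolding L_def
    by (rule closed_Collect_eq[OF bcl_continuous_on[OF bcl continuous_on_id] continuous_on_id])
  ultimately have "closure (cspan {\<pi> a h | a h. True}) \<subseteq> L"
    by (rule closure_minimal)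
  then show ?thesis using rep_nondegenerate by (auto simp: L_def)
qed

sublocale star_rep \<pi>
  by standard (use rep_bounded rep_add rep_scaleC rep_mult rep_star rep_one in
      \<open>auto simp: bounded_operators_def\<close>)

text \<open>Continuity at 0 bounds the functional by 1 where finitely many predual functionals are
  small. By homogeneity it vanishes on their common kernel, so it is a combination of them.
  Normality of \<pi> enters the proof through this lemma alone.\<close>

lemma vector_functional_predual: "(\<lambda>a. cinner h (\<pi> a k)) \<in> predual"
proof -
  let ?W = "weak_topology (bounded_operators :: ('h \<Rightarrow> 'h) set) bounded_operators_predual"
  let ?U = "{T \<in> bounded_operators. cinner h (T k) \<in> ball 0 1}"
  have "openin ?W ?U"
    by (rule weak_topology_open[OF vector_functional_in_predual]) simp
  then have "openin (weak_topology UNIV (predual :: ('m \<Rightarrow> complex) set))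
      {a \<in> topspace (weak_topology UNIV predual). \<pi> a \<in> ?U}"
    using rep_normal unfolding continuous_map_def by blast
  moreover have "topspace (weak_topology UNIV (predual :: ('m \<Rightarrow> complex) set)) = UNIV"
    using predual_zero by (intro topspace_weak_topology) blast
  ultimately obtain Fs :: "('m \<Rightarrow> complex) set" and e where
    Fs: "finite Fs" "Fs \<subseteq> predual" "e > 0" and
    U: "\<And>y. \<forall>f\<in>Fs. cmod (f y - f 0) < e \<Longrightarrow> cmod (cinner h (\<pi> y k)) < 1"
    using weak_topology_nbhd[of UNIV predual _ 0] rep_bounded by (force simp: zero)
  show ?thesis
  proof (rule functional_kernel[OF Fs(1,2)])
    fix x assume x: "\<forall>f\<in>Fs. f x = 0"
    have "cmod (cinner h (\<pi> ((of_nat n) *\<^sub>C x) k)) < 1" for n :: nat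
    proof (rule U, rule ballI)
      fix f assume "f \<in> Fs"
      then have f: "f \<in> predual" using Fs by blast
      have "f 0 = 0" using predual_scaleC[OF f, of 0 0] by simp
      then show "cmod (f (of_nat n *\<^sub>C x) - f 0) < e"
        using bspec[OF x \<open>f \<in> Fs\<close>] \<open>e > 0\<close> by (simp add: predual_scaleC[OF f])
    qed
    then have *: "real n * cmod (cinner h (\<pi> x k)) < 1" for n
      by (simp add: scaleC cinner_scaleC_right norm_mult)
    show "cinner h (\<pi> x k) = 0"
    proof (rule ccontr)
      assume "cinner h (\<pi> x k) \<noteq> 0"
      then obtain n where "1 < real n * cmod (cinner h (\<pi> x k))"
        using reals_Archimedean3[of "cmod (cinner h (\<pi> x k))"] by auto
      with * show False by (meson not_less_iff_gr_or_eq)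
    qed
  qed (auto simp: predual_plus predual_cmult predual_zero predual_add predual_scaleC
      add scaleC cinner_add_right cinner_scaleC_right)
qed

end

section \<open>Faithfulness of normal representations of factors\<close>

lemma norm_mult3: "norm (a * b * c) \<le> norm a * norm b * norm (c :: 'a::real_normed_algebra)"
  by (rule order.trans[OF norm_mult_ineq mult_right_mono[OF norm_mult_ineq norm_ge_zero]])

text \<open>Repeated squaring keeps the mixed products small, so that powers of a perturbed A + B
  split up to an error linear in \<delta>. The constant depends on k alone, which lets \<delta> be
  chosen after k in \<open>norm_add_almost_orthogonal\<close>.\<close>

lemma almost_orthogonal_powers:
  fixes A B P :: "'a::real_normed_algebra_1"
  shows "\<exists>c\<ge>0. \<forall>A B P :: 'a. \<forall>\<delta>. 0 \<le> \<delta> \<longrightarrow> \<delta> \<le> 1 \<longrightarrow> norm A \<le> 1 \<longrightarrow> norm B \<le> 1 \<longrightarrow> norm (A * B) \<le> \<delta> \<longrightarrow>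
    norm (B * A) \<le> \<delta> \<longrightarrow> norm (P - (A + B)) \<le> 2 * \<delta> \<longrightarrow>
    norm (P ^ 2 ^ k - (A ^ 2 ^ k + B ^ 2 ^ k)) \<le> c * \<delta>"
proof (induction k)
  case 0
  then show ?case by (intro exI[of _ 2]) simp
next
  case (Suc k)
  then obtain c where c: "c \<ge> 0" "\<And>A B P :: 'a. \<And>\<delta>. 0 \<le> \<delta> \<Longrightarrow> \<delta> \<le> 1 \<Longrightarrow> norm A \<le> 1 \<Longrightarrow> norm B \<le> 1
    \<Longrightarrow> norm (A * B) \<le> \<delta> \<Longrightarrow> norm (B * A) \<le> \<delta> \<Longrightarrow> norm (P - (A + B)) \<le> 2 * \<delta> \<Longrightarrow>
    norm (P ^ 2 ^ k - (A ^ 2 ^ k + B ^ 2 ^ k)) \<le> c * \<delta>"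
    by blast
  have pw: "norm (A ^ n * B ^ n) \<le> \<delta>"
    if "norm A \<le> 1" "norm B \<le> 1" "norm (A * B) \<le> \<delta>" "n > 0" for A B :: 'a and n \<delta>
  proof -
    obtain m where m: "n = Suc m" using \<open>n > 0\<close> by (cases n) auto
    have 1: "norm (A ^ m) \<le> 1" "norm (B ^ m) \<le> 1"
      using norm_power_ineq[of A m] norm_power_ineq[of B m] that(1,2)
      by (meson norm_ge_zero order.trans power_le_one)+
    have "A ^ n * B ^ n = A ^ m * (A * B) * B ^ m"
      unfolding m power_Suc2[of A] power_Suc[of B] by (simp only: mult.assoc)
    also have "norm \<dots> \<le> norm (A ^ m) * norm (A * B) * norm (B ^ m)"
      by (rule norm_mult3)
    also have "\<dots> \<le> 1 * norm (A * B) * 1"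
      by (intro mult_mono 1 mult_nonneg_nonneg order.refl) auto
    finally show ?thesis using that(3) by simp
  qed
  show ?case
  \<comment> \<open>The three terms come from ab and ba, from the products of the error E with a +
    b, and from E times E, where one factor \<delta> is bounded by 1.\<close>
  proof (intro exI[of _ "2 + 4 * c + c * c"] conjI allI impI)
    fix A B P :: 'a and \<delta> :: real
    assume d: "0 \<le> \<delta>" "\<delta> \<le> 1" and AB: "norm A \<le> 1" "norm B \<le> 1" "norm (A * B) \<le> \<delta>"
      "norm (B * A) \<le> \<delta>" "norm (P - (A + B)) \<le> 2 * \<delta>"
    define a b E where "a = A ^ 2 ^ k" "b = B ^ 2 ^ k" "E = P ^ 2 ^ k - (a + b)"
    have P: "P ^ 2 ^ k = a + b + E" by (simp add: a_b_E_def)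
    have ab: "norm a \<le> 1" "norm b \<le> 1" "norm E \<le> c * \<delta>" "norm (a * b) \<le> \<delta>" "norm (b * a) \<le> \<delta>"
      unfolding a_b_E_def
      using norm_power_ineq[of A "2 ^ k"] norm_power_ineq[of B "2 ^ k"] c(2)[OF d AB] pw[OF AB(1,2,3)]
        pw[OF AB(2,1,4)] AB(1,2)
      by (auto intro: order.trans[OF _ power_le_one])
    have "P ^ 2 ^ Suc k - (A ^ 2 ^ Suc k + B ^ 2 ^ Suc k) = (a + b + E) * (a + b + E) - (a * a + b * b)"
      by (simp only: power_Suc mult_2 power_add P a_b_E_def(1,2))
    also have "\<dots> = a * b + b * a + ((a + b) * E + E * (a + b) + E * E)"
      by (simp add: algebra_simps)
    also have "norm \<dots> \<le> norm (a * b) + norm (b * a) + (norm (a + b) * norm E + norm E * norm (a + b) + norm E * norm E)"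
      by (intro norm_triangle_le add_mono norm_mult_ineq order.refl)
    also have "\<dots> \<le> \<delta> + \<delta> + (2 * (c * \<delta>) + c * \<delta> * 2 + c * \<delta> * (c * 1))"
    proof (intro add_mono ab mult_mono)
      show "norm (a + b) \<le> 2" "norm (a + b) \<le> 2"
        using norm_triangle_ineq[of a b] ab(1,2) by linarith+
      show "norm E \<le> c * 1"
        using ab(3) mult_left_mono[OF d(2) c(1)] by linarith
    qed (use c d in auto)
    also have "\<dots> = (2 + 4 * c + c * c) * \<delta>" by (simp add: algebra_simps)
    finally show "norm (P ^ 2 ^ Suc k - (A ^ 2 ^ Suc k + B ^ 2 ^ Suc k)) \<le> (2 + 4 * c + c * c) * \<delta>" .
  qed (use c(1) in auto)
qed

text \<open>For orthogonal elements the norm of the sum is the maximum of the norms; this is a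
  quantitative version. With \<open>P = (x + y)\<^sup>\<star> * (x + y)\<close>, the norm of
  \<open>P ^ 2 ^ k\<close> is at most 3: one for each of the two split powers and one for the error.
  The root of 3 with exponent 2^(k+1) is below 1 + \<eta> for large k.\<close>

lemma norm_add_almost_orthogonal:
  assumes "\<eta> > 0"
  shows "\<exists>\<delta>>0. \<forall>x y :: 'a::cstar_algebra. x\<^sup>\<star> = x \<longrightarrow> norm x \<le> 1 \<longrightarrow> norm y \<le> 1 \<longrightarrow> norm (x * y) \<le> \<delta> \<longrightarrow>
    norm (x * y\<^sup>\<star>) \<le> \<delta> \<longrightarrow> norm (x + y) \<le> 1 + \<eta>"
proof -
  obtain k where k: "3 < (1 + \<eta>) ^ k"
    using real_arch_pow[of "1 + \<eta>" 3] assms by auto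
  have "(1 + \<eta>) ^ k \<le> (1 + \<eta>) ^ (2 ^ Suc k)"
    using assms trans_less_add1[OF less_exp[of k], of "2 ^ k"]
    by (intro power_increasing) (simp_all add: mult_2 less_imp_le)
  with k have k3: "3 < (1 + \<eta>) ^ (2 ^ Suc k)" by linarith
  obtain c where c: "c \<ge> 0" "\<And>A B P :: 'a. \<And>\<delta>. 0 \<le> \<delta> \<Longrightarrow> \<delta> \<le> 1 \<Longrightarrow> norm A \<le> 1 \<Longrightarrow> norm B \<le> 1
    \<Longrightarrow> norm (A * B) \<le> \<delta> \<Longrightarrow> norm (B * A) \<le> \<delta> \<Longrightarrow> norm (P - (A + B)) \<le> 2 * \<delta> \<Longrightarrow>
    norm (P ^ 2 ^ k - (A ^ 2 ^ k + B ^ 2 ^ k)) \<le> c * \<delta>"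
    using almost_orthogonal_powers[where 'a='a and k=k] by blast
  define \<delta> where "\<delta> = 1 / (c + 1)"
  have d: "0 \<le> \<delta>" "\<delta> \<le> 1" "\<delta> > 0" "c * \<delta> \<le> 1"
    using c(1) by (auto simp: \<delta>_def field_simps)
  show ?thesis
  proof (intro exI[of _ \<delta>] conjI allI impI)
    fix x y :: 'a
    assume x: "x\<^sup>\<star> = x" "norm x \<le> 1" and y: "norm y \<le> 1" and xy: "norm (x * y) \<le> \<delta>" "norm (x * y\<^sup>\<star>) \<le> \<delta>"
    define A B P where "A = x * x" "B = y\<^sup>\<star> * y" "P = (x + y)\<^sup>\<star> * (x + y)"
    have A: "norm A \<le> 1"
      using norm_star_mult[of x] x by (simp add: A_B_P_def power_le_one)
    have B: "norm B \<le> 1"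
      using norm_star_mult[of y] y by (simp add: A_B_P_def power_le_one)
    have yx_star: "y\<^sup>\<star> * x = (x * y)\<^sup>\<star>" "y * x = (x * y\<^sup>\<star>)\<^sup>\<star>"
      by (simp_all only: star_mult star_star x(1))
    have yx: "norm (y\<^sup>\<star> * x) \<le> \<delta>" "norm (y * x) \<le> \<delta>"
      unfolding yx_star norm_star by (rule xy)+
    have "norm (A * B) \<le> norm x * norm (x * y\<^sup>\<star>) * norm y"
      using norm_mult3[of x "x * y\<^sup>\<star>" y] by (simp add: A_B_P_def mult.assoc)
    also have "\<dots> \<le> 1 * \<delta> * 1"
      using x y xy d by (intro mult_mono) auto
    finally have AB: "norm (A * B) \<le> \<delta>" by simp
    have "norm (B * A) \<le> norm (y\<^sup>\<star>) * norm (y * x) * norm x"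
      using norm_mult3[of "y\<^sup>\<star>" "y * x" x] by (simp add: A_B_P_def mult.assoc)
    also have "\<dots> \<le> 1 * \<delta> * 1"
      using x y yx d by (intro mult_mono) auto
    finally have BA: "norm (B * A) \<le> \<delta>" by simp
    have "P - (A + B) = x * y + y\<^sup>\<star> * x"
      by (simp add: A_B_P_def star_add x algebra_simps)
    then have "norm (P - (A + B)) \<le> 2 * \<delta>"
      using norm_triangle_ineq[of "x * y" "y\<^sup>\<star> * x"] xy yx by simp
    from c(2)[OF d(1,2) A B AB BA this]
    have "norm (P ^ 2 ^ k - (A ^ 2 ^ k + B ^ 2 ^ k)) \<le> 1" using d(4) by linarith
    moreover have "norm (A ^ 2 ^ k) \<le> 1" "norm (B ^ 2 ^ k) \<le> 1"
      using norm_power_ineq[of A "2 ^ k"] norm_power_ineq[of B "2 ^ k"] A B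
      by (auto intro: order.trans[OF _ power_le_one])
    ultimately have "norm (P ^ 2 ^ k) \<le> 3"
      using norm_triangle_sub[of "P ^ 2 ^ k" "A ^ 2 ^ k + B ^ 2 ^ k"] norm_triangle_ineq[of "A ^ 2 ^ k" "B ^ 2 ^ k"]
      by linarith
    moreover have "P\<^sup>\<star> = P" by (simp add: A_B_P_def star_mult star_star)
    ultimately have "norm P ^ 2 ^ k \<le> 3" by (simp add: norm_sa_power)
    then have "norm (x + y) ^ 2 ^ Suc k \<le> 3"
      by (simp add: A_B_P_def norm_star_mult power_mult[symmetric])
    with k3 have "norm (x + y) ^ 2 ^ Suc k < (1 + \<eta>) ^ 2 ^ Suc k" by linarith
    then have "norm (x + y) < 1 + \<eta>"
      by (rule power_less_imp_less_base) (use assms in simp)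
    then show "norm (x + y) \<le> 1 + \<eta>" by simp
  qed (use d in auto)
qed

lemma cis_ne_1: "0 < t \<Longrightarrow> t < 2 * pi \<Longrightarrow> cis t \<noteq> 1"
proof
  assume t: "0 < t" "t < 2 * pi" "cis t = 1"
  then have "cos t = 1" by (metis Re_complex_of_real cis.simps(1) of_real_1)
  then obtain n where "t = real_of_int n * 2 * pi" using cos_one_2pi_int by auto
  then have "0 < real_of_int n" "real_of_int n < 1"
    using t by (simp_all add: zero_less_mult_iff)
  then show False by simp
qed

text \<open>Averaging \<open>(L + \<lambda>)\<^sup>n b\<close> over roots of unity isolates the linear term \<open>n L b\<close>, so that
  contractivity of all the \<open>L + \<lambda>\<close> forces \<open>L = 0\<close>.\<close>

lemma left_mult_eq_0:
  fixes z :: "'a::cstar_algebra"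
  assumes J: "\<And>b c. b \<in> J \<Longrightarrow> z * b + c *\<^sub>C b \<in> J"
    and le: "\<And>b c. b \<in> J \<Longrightarrow> cmod c = 1 \<Longrightarrow> norm (z * b + c *\<^sub>C b) \<le> norm b"
    and b: "b \<in> J"
  shows "z * b = 0"
proof -
  define T where "T c x = z * x + c *\<^sub>C x" for c x
  have T_app: "T c x = z * x + c *\<^sub>C x" for c x
    by (simp add: T_def)
  have T: "(T c ^^ n) b \<in> J \<and> norm ((T c ^^ n) b) \<le> norm b" if "cmod c = 1" for c n
  proof (induction n)
    case (Suc n)
    have e: "(T c ^^ Suc n) b = z * (T c ^^ n) b + c *\<^sub>C (T c ^^ n) b"
      by (simp only: funpow.simps o_apply T_app[of c "(T c ^^ n) b"])
    show ?case
      unfolding e using Suc J[of "(T c ^^ n) b" c] le[of "(T c ^^ n) b" c] that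
      by (auto intro: order.trans)
  qed (use b in simp)
  \<comment> \<open>\<open>v n j\<close> is the binomial coefficient n over j times
    \<open>z ^ j * b\<close>, introduced through Pascal's rule.\<close>
  define v where "v n = rec_nat (\<lambda>j::nat. if j = 0 then b else 0)
    (\<lambda>_ w j. w j + (if j = 0 then 0 else z * w (j - 1))) n" for n :: nat
  have v0: "v 0 j = (if j = 0 then b else 0)" and
    vS: "v (Suc n) j = v n j + (if j = 0 then 0 else z * v n (j - 1))" for n j :: nat
    by (simp_all add: v_def)
  have v_gt: "v n j = 0" if "j > n" for n j
    using that by (induction n arbitrary: j) (auto simp: v0 vS)
  have v00: "v n 0 = b" for n by (induction n) (simp_all add: v0 vS)
  have v1: "v n (Suc 0) = real n *\<^sub>R (z * b)" for n
    by (induction n) (simp_all add: v0 vS v00 algebra_simps)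
  have expand: "(T c ^^ n) b = (\<Sum>j\<le>n. c ^ (n - j) *\<^sub>C v n j)" for c n
  proof (induction n)
    case 0
    then show ?case by (simp add: v0 scaleC_one)
  next
    case (Suc n)
    have "(\<Sum>j\<le>Suc n. c ^ (Suc n - j) *\<^sub>C v (Suc n) j)
      = (\<Sum>j\<le>Suc n. c ^ (Suc n - j) *\<^sub>C v n j)
        + (\<Sum>j\<le>Suc n. c ^ (Suc n - j) *\<^sub>C (if j = 0 then 0 else z * v n (j - 1)))"
      by (simp only: vS scaleC_add_right sum.distrib)
    also have "(\<Sum>j\<le>Suc n. c ^ (Suc n - j) *\<^sub>C v n j) = c *\<^sub>C (T c ^^ n) b"
      by (simp add: v_gt Suc cvs.scale_sum_right scaleC_scaleC Suc_diff_le)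
    also have "(\<Sum>j\<le>Suc n. c ^ (Suc n - j) *\<^sub>C (if j = 0 then 0 else z * v n (j - 1))) = z * (T c ^^ n) b"
      by (simp add: sum.atMost_Suc_shift Suc sum_distrib_left scaleC_mult_right del: sum.atMost_Suc)
    finally show ?case
      by (simp only: funpow.simps o_apply T_app[of c "(T c ^^ n) b"] add.commute)
  qed
  have key: "real n * norm (z * b) \<le> norm b" if n: "n \<ge> 1" for n
  proof -
    define N where "N = Suc n"
    have "N > 0" by (simp add: N_def)
    define w where "w = cis (2 * pi / real N)"
    have wp: "w ^ e = cis (2 * pi * real e / real N)" for e
      by (simp add: w_def Complex.DeMoivre mult_ac)
    have wN: "w ^ N = 1"
      unfolding wp using \<open>N > 0\<close> by simp
    \<comment> \<open>With the extra factor \<open>(w ^ r)\<^sup>2\<close> the exponents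
      \<open>n + 2 - j\<close> run through 2, ..., n + 2. The only multiple of N = n + 1 among them
      is N itself, which belongs to j = 1.\<close>
    have gs: "(\<Sum>r<N. (w ^ r) ^ e) = (if e = N then of_nat N else 0)" if e: "2 \<le> e" "e \<le> n + 2" for e
    proof (cases "e = N")
      case True
      have "(w ^ r) ^ N = 1" for r
        by (metis power_mult power_one mult.commute wN)
      with True show ?thesis by simp
    next
      case False
      have "w ^ e \<noteq> 1"
      proof (cases "e < N")
        case True
        then show ?thesis unfolding wp using e
          by (intro cis_ne_1) (auto simp: field_simps)
      next
        case False
        with \<open>e \<noteq> N\<close> e have "e = Suc N" by (simp add: N_def)
        then have "w ^ e = w" using wN by simp
        also have "w \<noteq> 1" unfolding w_def using n
          by (intro cis_ne_1) (auto simp: N_def field_simps)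
        finally show ?thesis .
      qed
      moreover have "(w ^ e) ^ N = 1" by (metis power_mult power_one mult.commute wN)
      moreover have "(\<Sum>r<N. (w ^ r) ^ e) = (\<Sum>r<N. (w ^ e) ^ r)"
        by (simp add: power_mult[symmetric] mult.commute)
      ultimately show ?thesis using False by (simp add: sum_gp_strict)
    qed
    have "(\<Sum>r<N. (w ^ r)\<^sup>2 *\<^sub>C (T (w ^ r) ^^ n) b)
        = (\<Sum>j\<le>n. (\<Sum>r<N. (w ^ r) ^ (n + 2 - j)) *\<^sub>C v n j)"
      unfolding expand cvs.scale_sum_right scaleC_scaleC cvs.scale_sum_left
      by (subst sum.swap) (intro sum.cong refl, simp add: Suc_diff_le power2_eq_square)
    also have "\<dots> = (\<Sum>j\<le>n. (if j = 1 then of_nat N *\<^sub>C v n 1 else 0))"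
      by (intro sum.cong refl) (subst gs, auto simp: N_def)
    also have "\<dots> = of_nat N *\<^sub>C (real n *\<^sub>R (z * b))"
      using n by (simp add: v1)
    finally have "norm (of_nat N *\<^sub>C (real n *\<^sub>R (z * b))) = norm (\<Sum>r<N. (w ^ r)\<^sup>2 *\<^sub>C (T (w ^ r) ^^ n) b)"
      by simp
    also have "\<dots> \<le> (\<Sum>r<N. norm b)"
    proof (intro sum_norm_le)
      fix r
      have "cmod (w ^ r) = 1" by (simp add: w_def norm_power)
      then show "norm ((w ^ r)\<^sup>2 *\<^sub>C (T (w ^ r) ^^ n) b) \<le> norm b"
        using T by (simp add: norm_scaleC norm_power)
    qed
    finally show ?thesis
      using \<open>N > 0\<close> by (simp add: norm_scaleC)
  qed
  show ?thesis
  proof (rule ccontr)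
    assume "z * b \<noteq> 0"
    then obtain n where "norm b < real n * norm (z * b)"
      using reals_Archimedean3[of "norm (z * b)"] by auto
    moreover from this have "n \<ge> 1" by (cases n) auto
    ultimately show False using key[of n] by simp
  qed
qed


text \<open>Here z is t^2 / (d^2 + t^2), expressed through c = 1 / (d + it) and its adjoint. It is
  close to 1 where d is small, and its product with d is small. The product form of 1 - z, which is
  d^2 / (d^2 + t^2), places it in every ideal that contains d.\<close>

lemma sa_cutoff:
  fixes d :: "'a::cstar_algebra"
  assumes d: "d\<^sup>\<star> = d" and t: "t > 0"
  obtains z c where "norm z \<le> 1" "norm (1 - z) \<le> 1" "norm (z * d) \<le> 2 * t" "1 - z = d * c * (d * c\<^sup>\<star>)"
proof -
  define e :: 'a where "e = (\<i> * of_real t) *\<^sub>C 1"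
  obtain c where c: "inv_pair (d + e) c" "inv_pair (d - e) (c\<^sup>\<star>)" "norm c \<le> 1 / t"
    using resolvent[OF d t] unfolding e_def by blast
  have es: "e\<^sup>\<star> = - e" by (simp add: e_def star_scaleC)
  have ecomm: "e * x = x * e" for x by (simp add: e_def scaleC_mult_left scaleC_mult_right)
  have e2: "e * e = - (of_real (t\<^sup>2) *\<^sub>C 1)"
  proof -
    have "\<i> * of_real t * (\<i> * of_real t) = - complex_of_real (t\<^sup>2)"
      by (simp add: power2_eq_square[symmetric] power_mult_distrib)
    then show ?thesis
      by (simp only: e_def scaleC_mult_left mult_1_left scaleC_scaleC cvs.scale_minus_left)
  qed
  define z where "z = of_real (t\<^sup>2) *\<^sub>C (c * c\<^sup>\<star>)"
  have c1: "d * c + e * c = 1" "c * d + c * e = 1" "d * c\<^sup>\<star> - e * c\<^sup>\<star> = 1" "c\<^sup>\<star> * d - c\<^sup>\<star> * e = 1"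
    using c by (simp_all add: inv_pair_def algebra_simps)
  have dc: "d * c = c * d"
    using c1(1,2) ecomm[of c] by (metis add_right_cancel)
  have nzd: "z = - (e * c * (e * c\<^sup>\<star>))"
  proof -
    have "e * c * (e * c\<^sup>\<star>) = e * (c * e) * c\<^sup>\<star>" by (simp only: mult.assoc)
    also have "c * e = e * c" by (rule ecomm[symmetric])
    also have "e * (e * c) * c\<^sup>\<star> = e * e * (c * c\<^sup>\<star>)" by (simp only: mult.assoc)
    finally show ?thesis by (simp add: z_def e2 scaleC_mult_left)
  qed
  have n1: "norm z \<le> 1"
  proof -
    have "norm z = t\<^sup>2 * norm (c * c\<^sup>\<star>)" by (simp add: z_def norm_scaleC norm_power)
    also have "\<dots> \<le> t\<^sup>2 * (norm c * norm (c\<^sup>\<star>))" by (intro mult_left_mono norm_mult_ineq) simp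
    also have "\<dots> \<le> t\<^sup>2 * (1 / t * (1 / t))"
      using c(3) t by (intro mult_left_mono mult_mono) auto
    also have "\<dots> = 1" using t by (simp add: power2_eq_square)
    finally show ?thesis .
  qed
  have n2: "norm (z * d) \<le> 2 * t"
  proof -
    have cd: "c\<^sup>\<star> * d = 1 + c\<^sup>\<star> * e" using c1(4) by (simp add: algebra_simps)
    have nc: "norm (1 + c\<^sup>\<star> * e) \<le> 2"
    proof -
      have "norm (c\<^sup>\<star> * e) \<le> norm (c\<^sup>\<star>) * norm e" by (rule norm_mult_ineq)
      also have "\<dots> \<le> 1 / t * t"
        using c(3) t by (intro mult_mono) (auto simp: e_def norm_scaleC norm_mult)
      finally have "norm (c\<^sup>\<star> * e) \<le> 1" using t by simp
      then show ?thesis using norm_triangle_ineq[of 1 "c\<^sup>\<star> * e"] by simp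
    qed
    have "z * d = of_real (t\<^sup>2) *\<^sub>C (c * (1 + c\<^sup>\<star> * e))"
      by (simp only: z_def scaleC_mult_left mult.assoc cd)
    then have "norm (z * d) = t\<^sup>2 * norm (c * (1 + c\<^sup>\<star> * e))" by (simp add: norm_scaleC norm_power)
    also have "\<dots> \<le> t\<^sup>2 * (norm c * norm (1 + c\<^sup>\<star> * e))" by (intro mult_left_mono norm_mult_ineq) simp
    also have "\<dots> \<le> t\<^sup>2 * (1 / t * 2)"
      using c(3) nc t by (intro mult_left_mono mult_mono) auto
    finally show ?thesis using t by (simp add: power2_eq_square)
  qed
  \<comment> \<open>The Cayley transform \<open>u = (d - e) * c\<close> satisfies
    \<open>u\<^sup>\<star> * u = 1\<close>, and 2 d c = 1 + u.\<close>
  have ndc: "norm (d * c) \<le> 1"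
  proof -
    define u where "u = (d - e) * c"
    have us: "u\<^sup>\<star> = c\<^sup>\<star> * (d + e)" by (simp add: u_def star_mult star_diff d es)
    have "u\<^sup>\<star> * u = c\<^sup>\<star> * ((d + e) * (d - e)) * c"
      unfolding us by (simp only: u_def mult.assoc)
    also have "(d + e) * (d - e) = (d - e) * (d + e)"
      by (simp add: algebra_simps ecomm[of d])
    also have "c\<^sup>\<star> * ((d - e) * (d + e)) * c = c\<^sup>\<star> * (d - e) * ((d + e) * c)"
      by (simp only: mult.assoc)
    also have "\<dots> = 1" using c(1,2) by (simp add: inv_pair_def)
    finally have "(norm u)\<^sup>2 = 1" using norm_star_mult[of u] by simp
    then have "norm u = 1" using norm_ge_zero[of u] by (simp add: power2_eq_1_iff)
    have "2 *\<^sub>R (d * c) = (d * c + e * c) + u"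
      by (simp add: u_def algebra_simps scaleR_2)
    then have "norm (2 *\<^sub>R (d * c)) \<le> 2"
      using norm_triangle_ineq[of 1 u] \<open>norm u = 1\<close> c1(1) by simp
    then show ?thesis by simp
  qed
  have "d * c = 1 - e * c" "d * c\<^sup>\<star> = 1 + e * c\<^sup>\<star>" using c1(1,3) by (simp_all add: algebra_simps)
  have "d * c * (d * c\<^sup>\<star>) = 1 - z"
  proof -
    have "(d * c) * (d * c\<^sup>\<star>) = (1 - e * c) * (1 + e * c\<^sup>\<star>)"
      by (simp only: \<open>d * c = 1 - e * c\<close> \<open>d * c\<^sup>\<star> = 1 + e * c\<^sup>\<star>\<close>)
    also have "\<dots> = 1 - e * c + e * c\<^sup>\<star> + z"
      unfolding nzd by (simp add: algebra_simps)
    also have "e * c\<^sup>\<star> - e * c = - 2 *\<^sub>R z"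
    proof -
      have "c - c\<^sup>\<star> = c * ((d - e) * c\<^sup>\<star>) - c * (d + e) * c\<^sup>\<star>"
        using c(1,2) by (simp add: inv_pair_def)
      also have "\<dots> = - 2 *\<^sub>R (c * (e * c\<^sup>\<star>))" by (simp add: algebra_simps scaleR_2)
      finally have "e * (c - c\<^sup>\<star>) = - 2 *\<^sub>R (e * c * (e * c\<^sup>\<star>))"
        by (simp add: mult.assoc)
      then show ?thesis unfolding nzd by (simp add: algebra_simps)
    qed
    then have "1 - e * c + e * c\<^sup>\<star> + z = 1 - z"
      by (simp add: algebra_simps scaleR_2)
    finally show ?thesis .
  qed
  moreover have "norm (1 - z) \<le> 1"
  proof -
    have "norm (d * c * (d * c\<^sup>\<star>)) \<le> norm (d * c) * norm (d * c\<^sup>\<star>)" by (rule norm_mult_ineq)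
    also have "norm (d * c\<^sup>\<star>) = norm (d * c)"
      using norm_star[of "c * d"] by (simp add: star_mult d dc)
    also have "norm (d * c) * norm (d * c) \<le> 1 * 1" using ndc by (intro mult_mono) auto
    finally show ?thesis using \<open>d * c * (d * c\<^sup>\<star>) = 1 - z\<close> by simp
  qed
  ultimately show ?thesis using that[OF n1 _ n2] by metis
qed

section \<open>The kernel of a normal representation and its unit\<close>

context normal_representation
begin

definition vanishing :: "'m set"
  where "vanishing = {a. \<forall>h. \<pi> a h = 0}"

text \<open>The coset of 1 modulo the kernel of \<pi>, in which the complement of the unit of the
  kernel is sought.\<close>

definition unit_lift :: "'m \<Rightarrow> bool"
  where "unit_lift z \<longleftrightarrow> (\<forall>h. \<pi> z h = h)"

lemma unit_lift_iff: "unit_lift z \<longleftrightarrow> 1 - z \<in> vanishing"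
  by (auto simp: unit_lift_def vanishing_def diff one)

lemma vanishing_add: "a \<in> vanishing \<Longrightarrow> b \<in> vanishing \<Longrightarrow> a + b \<in> vanishing"
  by (simp add: vanishing_def add)

lemma vanishing_scaleC: "a \<in> vanishing \<Longrightarrow> c *\<^sub>C a \<in> vanishing"
  by (simp add: vanishing_def scaleC)

lemma vanishing_left: "a \<in> vanishing \<Longrightarrow> b * a \<in> vanishing"
  by (simp add: vanishing_def mult bcl_0[OF bcl])

lemma vanishing_right: "a \<in> vanishing \<Longrightarrow> a * b \<in> vanishing"
  by (simp add: vanishing_def mult)

lemma vanishing_star: "a \<in> vanishing \<Longrightarrow> a\<^sup>\<star> \<in> vanishing"
  unfolding vanishing_def
proof (clarify)
  fix h assume a: "\<forall>h. \<pi> a h = 0"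
  have "cinner k (\<pi> (a\<^sup>\<star>) h) = cinner k 0" for k
    unfolding star[symmetric] using a by simp
  then show "\<pi> (a\<^sup>\<star>) h = 0" by (rule cinner_ext)
qed

lemma unit_lift_star: "unit_lift z \<Longrightarrow> unit_lift (z\<^sup>\<star>)"
  using vanishing_star[of "1 - z"] by (simp add: unit_lift_iff star_diff)

lemma unit_lift_mult: "unit_lift z \<Longrightarrow> unit_lift w \<Longrightarrow> unit_lift (z * w)"
  by (simp add: unit_lift_def mult)

text \<open>Apply \<open>sa_cutoff\<close> to \<open>c * c\<^sup>\<star>\<close> with t = e^2 / 2
  and use the C*-identity for z c. The elements 1 - z act as an approximate unit of the
  kernel.\<close>

lemma cutoff:
  assumes c: "c \<in> vanishing" and e: "e > 0"
  obtains z where "norm z \<le> 1" "norm (1 - z) \<le> 1" "norm (z * c) \<le> e" "unit_lift z"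
proof -
  have "(c * c\<^sup>\<star>)\<^sup>\<star> = c * c\<^sup>\<star>" by (simp add: star_mult star_star)
  then obtain z w where z: "norm z \<le> 1" "norm (1 - z) \<le> 1" "norm (z * (c * c\<^sup>\<star>)) \<le> 2 * (e\<^sup>2 / 2)"
    "1 - z = c * c\<^sup>\<star> * w * (c * c\<^sup>\<star> * w\<^sup>\<star>)"
    using sa_cutoff[of "c * c\<^sup>\<star>" "e\<^sup>2 / 2"] e by (metis half_gt_zero zero_less_power)
  have "(norm (z * c))\<^sup>2 = norm (z * (c * c\<^sup>\<star>) * z\<^sup>\<star>)"
  proof -
    have "((z * c)\<^sup>\<star>)\<^sup>\<star> * (z * c)\<^sup>\<star> = z * (c * c\<^sup>\<star>) * z\<^sup>\<star>"
      by (simp add: star_star) (simp add: star_mult mult.assoc)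
    with norm_star_mult[of "(z * c)\<^sup>\<star>"] show ?thesis by (simp only: norm_star)
  qed
  also have "\<dots> \<le> norm (z * (c * c\<^sup>\<star>)) * norm (z\<^sup>\<star>)" by (rule norm_mult_ineq)
  also have "\<dots> \<le> e\<^sup>2 * 1" using z by (intro mult_mono) auto
  finally have "(norm (z * c))\<^sup>2 \<le> e\<^sup>2" by simp
  then have "norm (z * c) \<le> e"
    by (rule power2_le_imp_le) (use e in simp)
  moreover have "unit_lift z"
    unfolding unit_lift_iff z(4) by (intro vanishing_right c)
  ultimately show ?thesis using that z by blast
qed

text \<open>A cutoff for the next element multiplies from the left; being a contraction, it
  preserves the estimates already obtained.\<close>

lemma cutoff_finite:
  assumes "finite S" "S \<subseteq> vanishing" and e: "e > 0"
  shows "\<exists>z. norm z \<le> 1 \<and> unit_lift z \<and> (\<forall>c\<in>S. norm (z * c) \<le> e)"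
  using assms(1,2)
proof (induction S rule: finite_induct)
  case empty
  show ?case by (intro exI[of _ 1]) (simp add: unit_lift_def one)
next
  case (insert c S)
  then obtain z where z: "norm z \<le> 1" "unit_lift z" "\<And>c. c \<in> S \<Longrightarrow> norm (z * c) \<le> e" by auto
  have "z * c \<in> vanishing" using insert.prems by (intro vanishing_left) auto
  then obtain w where w: "norm w \<le> 1" "unit_lift w" "norm (w * (z * c)) \<le> e"
    using cutoff[OF _ e] by metis
  have *: "norm (w * x) \<le> norm x" for x
    using order.trans[OF norm_mult_ineq mult_right_mono[OF w(1) norm_ge_zero]] by simp
  show ?case
  proof (intro exI[of _ "w * z"] conjI ballI)
    show "norm (w * z) \<le> 1" using *[of z] z(1) by linarith
    show "unit_lift (w * z)" by (rule unit_lift_mult[OF w(2) z(2)])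
    show "norm (w * z * x) \<le> e" if "x \<in> insert c S" for x
      using that w(3) order.trans[OF *[of "z * x"] z(3)[of x]] by (auto simp: mult.assoc)
  qed
qed

text \<open>The element is a weak* limit of cutoffs. That it annihilates the kernel cannot be read
  off directly, multiplication not being known to be weak* continuous. Orthogonality to the kernel
  is therefore expressed by norm inequalities, which survive weak* limits;
  \<open>left_mult_eq_0\<close> translates them back.\<close>

lemma unit_lift_orthogonal:
  obtains z where "unit_lift z" "\<And>a. a \<in> vanishing \<Longrightarrow> norm a \<le> 1 \<Longrightarrow> norm (z + a) \<le> 1"
proof -
  define I where "I = {a \<in> vanishing. norm a \<le> 1} \<times> {\<eta>::real. \<eta> > 0}"
  define G where "G = (\<lambda>(a, \<eta>). {z. norm z \<le> 1 \<and> unit_lift z \<and> norm (z + a) \<le> 1 + \<eta>})"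
  \<comment> \<open>The filter generated by all the conditions; it is proper because finitely many
    of them can be met together.\<close>
  define F where "F = (INF p\<in>I. principal (G p))"
  have Fne: "F \<noteq> bot"
    unfolding F_def
  proof (rule INF_filter_not_bot)
    fix X assume X: "X \<subseteq> I" "finite X"
    have "\<forall>p\<in>X. \<exists>\<delta>>0. \<forall>x y :: 'm. x\<^sup>\<star> = x \<longrightarrow> norm x \<le> 1 \<longrightarrow> norm y \<le> 1 \<longrightarrow> norm (x * y) \<le> \<delta> \<longrightarrow>
        norm (x * y\<^sup>\<star>) \<le> \<delta> \<longrightarrow> norm (x + y) \<le> 1 + snd p"
    proof
      fix p assume "p \<in> X"
      then have "snd p > 0" using X by (auto simp: I_def)
      then show "\<exists>\<delta>>0. \<forall>x y :: 'm. x\<^sup>\<star> = x \<longrightarrow> norm x \<le> 1 \<longrightarrow> norm y \<le> 1 \<longrightarrow> norm (x * y) \<le> \<delta> \<longrightarrow>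
        norm (x * y\<^sup>\<star>) \<le> \<delta> \<longrightarrow> norm (x + y) \<le> 1 + snd p"
        by (rule norm_add_almost_orthogonal)
    qed
    then obtain \<delta> where \<delta>: "\<And>p. p \<in> X \<Longrightarrow> \<delta> p > 0" "\<And>p x y. p \<in> X \<Longrightarrow> (x::'m)\<^sup>\<star> = x \<Longrightarrow> norm x \<le> 1 \<Longrightarrow>
      norm y \<le> 1 \<Longrightarrow> norm (x * y) \<le> \<delta> p \<Longrightarrow> norm (x * y\<^sup>\<star>) \<le> \<delta> p \<Longrightarrow> norm (x + y) \<le> 1 + snd p"
      by (metis (no_types, lifting) bchoice)
    define d where "d = Min (insert 1 (\<delta> ` X))"
    have d: "d > 0" "\<And>p. p \<in> X \<Longrightarrow> d \<le> \<delta> p"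
      using X \<delta>(1) by (auto simp: d_def)
    have fin: "finite (fst ` X \<union> (\<lambda>p. (fst p)\<^sup>\<star>) ` X)" using X by simp
    have sub: "fst ` X \<union> (\<lambda>p. (fst p)\<^sup>\<star>) ` X \<subseteq> vanishing"
    proof -
      have "fst p \<in> vanishing" if "p \<in> X" for p using that X by (auto simp: I_def)
      then show ?thesis by (auto intro: vanishing_star)
    qed
    obtain z where z: "norm z \<le> 1" "unit_lift z"
      "\<And>c. c \<in> fst ` X \<union> (\<lambda>p. (fst p)\<^sup>\<star>) ` X \<Longrightarrow> norm (z * c) \<le> d"
      using cutoff_finite[OF fin sub d(1)] by blast
    \<comment> \<open>\<open>norm_add_almost_orthogonal\<close> asks for a self-adjoint element with
      small products with both a and its adjoint; hence also the adjoints in the finite set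
      above.\<close>
    define x where "x = z\<^sup>\<star> * z"
    have xs: "x\<^sup>\<star> = x" by (simp add: x_def star_mult star_star)
    have nx: "norm x \<le> 1" using z(1) by (simp add: x_def norm_star_mult power_le_one)
    have xc: "norm (x * c) \<le> norm (z * c)" for c
    proof -
      have "norm (x * c) \<le> norm (z\<^sup>\<star>) * norm (z * c)"
        unfolding x_def mult.assoc by (rule norm_mult_ineq)
      also have "\<dots> \<le> 1 * norm (z * c)" using z(1) by (intro mult_right_mono) auto
      finally show ?thesis by simp
    qed
    have "x \<in> G p" if p: "p \<in> X" for p
    proof -
      have "norm (x * fst p) \<le> \<delta> p" "norm (x * (fst p)\<^sup>\<star>) \<le> \<delta> p"
        using xc[of "fst p"] z(3)[of "fst p"] xc[of "(fst p)\<^sup>\<star>"] z(3)[of "(fst p)\<^sup>\<star>"] d(2)[OF p] p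
        by (auto intro: order.trans)
      moreover have "norm (fst p) \<le> 1" using p X by (auto simp: I_def)
      ultimately have "norm (x + fst p) \<le> 1 + snd p"
        by (intro \<delta>(2)[OF p xs nx])
      moreover have "unit_lift x"
        unfolding x_def by (rule unit_lift_mult[OF unit_lift_star[OF z(2)] z(2)])
      ultimately show ?thesis using nx by (simp add: G_def case_prod_unfold)
    qed
    then have "x \<in> (\<Inter>p\<in>X. G p)" by blast
    then show "(INF p\<in>X. principal (G p)) \<noteq> bot"
      unfolding INF_principal_finite[OF X(2)] principal_eq_bot_iff by blast
  qed
  have evG: "eventually (\<lambda>z. z \<in> G p) F" if "p \<in> I" for p
    unfolding F_def using that by (intro eventually_INF1) (auto simp: eventually_principal)
  have I0: "(0, 1) \<in> I" by (auto simp: I_def vanishing_def zero)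
  have ev1: "eventually (\<lambda>z. norm z \<le> 1) F"
    using evG[OF I0] by (rule eventually_mono) (simp add: G_def)
  obtain F' z where z: "F' \<le> F" "F' \<noteq> bot" "norm z \<le> 1"
    "\<And>f. f \<in> predual \<Longrightarrow> ((\<lambda>i. f i) \<longlongrightarrow> f z) F'"
    using weakstar_cluster[OF Fne ev1] by blast
  have evG': "eventually (\<lambda>z. z \<in> G p) F'" if "p \<in> I" for p
    using evG[OF that] z(1) filter_leD by blast
  have "unit_lift z"
    unfolding unit_lift_def
  proof
    fix k
    have "cinner h (\<pi> z k) = cinner h k" for h
    proof (rule tendsto_unique[OF z(2) z(4)[OF vector_functional_predual]])
      have "eventually (\<lambda>z. cinner h k = cinner h (\<pi> z k)) F'"
        using evG'[OF I0] by (rule eventually_mono) (simp add: G_def unit_lift_def)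
      then show "((\<lambda>z. cinner h (\<pi> z k)) \<longlongrightarrow> cinner h k) F'"
        by (rule tendsto_eventually[OF eventually_mono]) simp
    qed
    then show "\<pi> z k = k" by (rule cinner_ext)
  qed
  moreover have "norm (z + a) \<le> 1" if a: "a \<in> vanishing" "norm a \<le> 1" for a
  proof (rule field_le_epsilon)
    fix \<eta> :: real assume "\<eta> > 0"
    then have p: "(a, \<eta>) \<in> I" using a by (simp add: I_def)
    show "norm (z + a) \<le> 1 + \<eta>"
    proof (rule norm_predual_limit[OF z(2), of "\<lambda>i. i + a"])
      show "eventually (\<lambda>i. norm (i + a) \<le> 1 + \<eta>) F'"
        using evG'[OF p] by (rule eventually_mono) (simp add: G_def)
      show "((\<lambda>i. f (i + a)) \<longlongrightarrow> f (z + a)) F'" if "f \<in> predual" for f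
        unfolding predual_add[OF that] by (intro tendsto_add z(4) that tendsto_const)
    qed
  qed
  ultimately show ?thesis using that by blast
qed

text \<open>For |c| = 1 and a cutoff w of b, the product of z + c (1 - w) with b equals z b + c b up
  to c w b, and z + c (1 - w) is a contraction. So z + c acts contractively on the kernel for every
  such c, as \<open>left_mult_eq_0\<close> requires.\<close>

lemma unit_lift_annihilates:
  assumes z: "unit_lift z" "\<And>a. a \<in> vanishing \<Longrightarrow> norm a \<le> 1 \<Longrightarrow> norm (z + a) \<le> 1"
    and b: "b \<in> vanishing"
  shows "z * b = 0"
proof (rule left_mult_eq_0[where J = vanishing])
  fix b :: 'm and c :: complex assume b: "b \<in> vanishing"
  then show "z * b + c *\<^sub>C b \<in> vanishing"
    by (intro vanishing_add vanishing_left vanishing_scaleC)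
  assume c: "cmod c = 1"
  show "norm (z * b + c *\<^sub>C b) \<le> norm b"
  proof (rule field_le_epsilon)
    fix e :: real assume "e > 0"
    then obtain w where w: "norm (1 - w) \<le> 1" "norm (w * b) \<le> e" "unit_lift w"
      using cutoff[OF b] by metis
    define a where "a = c *\<^sub>C (1 - w)"
    have "norm (z + a) \<le> 1"
      using w(1,3) c by (intro z(2)) (simp_all add: a_def vanishing_scaleC unit_lift_iff norm_scaleC)
    have "z * b + c *\<^sub>C b = (z + a) * b + c *\<^sub>C (w * b)"
      by (simp add: a_def algebra_simps scaleC_mult_left cvs.scale_right_diff_distrib)
    also have "norm \<dots> \<le> norm (z + a) * norm b + norm (w * b)"
      using norm_mult_ineq[of "z + a" b] c
      by (intro order.trans[OF norm_triangle_ineq] add_mono) (simp_all add: norm_scaleC)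
    also have "\<dots> \<le> 1 * norm b + e"
      using \<open>norm (z + a) \<le> 1\<close> w(2) by (intro add_mono mult_right_mono) auto
    finally show "norm (z * b + c *\<^sub>C b) \<le> norm b + e" by simp
  qed
qed (rule b)

text \<open>The kernel of a normal representation is an ideal with a unit, which is central.\<close>

lemma faithful:
  assumes factor: "(center :: 'm set) = range (\<lambda>c. c *\<^sub>C 1)"
    and nontrivial: "\<exists>h::'h. h \<noteq> 0" and a: "\<And>h. \<pi> a h = 0"
  shows "a = 0"
proof -
  obtain z where z: "unit_lift z" "\<And>a. a \<in> vanishing \<Longrightarrow> norm a \<le> 1 \<Longrightarrow> norm (z + a) \<le> 1"
    using unit_lift_orthogonal by blast
  have zb: "z * b = 0" if "b \<in> vanishing" for b
    by (rule unit_lift_annihilates[OF z that])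
  have zs: "norm (z\<^sup>\<star> + b) \<le> 1" if "b \<in> vanishing" "norm b \<le> 1" for b
    using z(2)[OF vanishing_star[OF that(1)]] that(2) norm_star[of "z + b\<^sup>\<star>"]
    by (simp add: star_add star_star)
  have bz: "b * z = 0" if "b \<in> vanishing" for b
  proof -
    have "z\<^sup>\<star> * b\<^sup>\<star> = 0"
      by (rule unit_lift_annihilates[OF unit_lift_star[OF z(1)] zs vanishing_star[OF that]])
    then have "(b * z)\<^sup>\<star> = 0" by (simp add: star_mult)
    then have "((b * z)\<^sup>\<star>)\<^sup>\<star> = 0\<^sup>\<star>" by simp
    then show ?thesis by (simp only: star_star star_zero)
  qed
  define e where "e = 1 - z"
  have eJ: "e \<in> vanishing" using z(1) by (simp add: e_def unit_lift_iff)
  have eb: "e * b = b" "b * e = b" if "b \<in> vanishing" for b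
    using zb[OF that] bz[OF that] by (simp_all add: e_def algebra_simps)
  have "e * x = x * e" for x
    using eb(2)[OF vanishing_right[OF eJ, of x]] eb(1)[OF vanishing_left[OF eJ, of x]]
    by (simp add: mult.assoc)
  then have "e \<in> center" by (simp add: center_def)
  then obtain c where c: "e = c *\<^sub>C 1" using factor by blast
  obtain h :: 'h where "h \<noteq> 0" using nontrivial by blast
  have "\<pi> e h = 0" using eJ by (simp add: vanishing_def)
  then have "c *\<^sub>C h = 0" by (simp add: c scaleC one)
  then have "e = 0" using \<open>h \<noteq> 0\<close> c by simp
  then show ?thesis
    using eb(1)[of a] a by (simp add: vanishing_def)
qed

end

section \<open>Density theorems\<close>

lemma subspace_closure:
  fixes L :: "'a::real_normed_vector set"
  shows "subspace L \<Longrightarrow> subspace (closure L)"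
  unfolding subspace_def
proof (intro conjI ballI allI; elim conjE)
  assume L: "0 \<in> L" "\<forall>x\<in>L. \<forall>y\<in>L. x + y \<in> L" "\<forall>c. \<forall>x\<in>L. c *\<^sub>R x \<in> L"
  show "0 \<in> closure L"
    using L closure_subset by blast
  show "x + y \<in> closure L" if "x \<in> closure L" "y \<in> closure L" for x y
    using L that unfolding closure_sequential
    by (metis (no_types, lifting) tendsto_add)
  show "c *\<^sub>R x \<in> closure L" if "x \<in> closure L" for c x
    using L that unfolding closure_sequential
    by (metis (no_types, lifting) tendsto_scaleR tendsto_const)
qed

text \<open>Serves two purposes: the decomposition of the induced Hilbert space along the basis of
  the Fock space, and a supply of finite direct sums of copies of H for the density
  theorems.\<close>

locale amplification =
  fixes V :: "nat \<Rightarrow> 'h::complex_hilbert \<Rightarrow> 'k::complex_hilbert"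
  assumes V_bcl: "bounded_clinear (V i)"
    and V_orth: "cinner (V i h) (V j k) = (if i = j then cinner h k else 0)"
begin

definition W :: "nat \<Rightarrow> 'k \<Rightarrow> 'h" where "W i = adj (V i)"

lemma W_bcl: "bounded_clinear (W i)"
  by (simp add: W_def bcl_adj V_bcl)

lemma W_left: "cinner (W i x) h = cinner x (V i h)"
  by (simp add: W_def adj_left V_bcl)

lemma W_right: "cinner h (W i x) = cinner (V i h) x"
  by (simp add: W_def adj_right V_bcl)

lemma W_V: "W i (V j h) = (if i = j then h else 0)"
  by (rule cinner_ext) (simp add: W_right V_orth)

lemma norm_V: "norm (V i h) = norm h"
proof -
  have "(norm (V i h))\<^sup>2 = (norm h)\<^sup>2"
    unfolding Re_cinner_self[symmetric] V_orth by simp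
  then show ?thesis by simp
qed

lemma norm_W: "norm (W i x) \<le> norm x"
  using adj_norm[OF V_bcl, of 1 i x] by (simp add: W_def norm_V)

lemma W_sum: "j < n \<Longrightarrow> W j (\<Sum>i<n. V i (f i)) = f j"
  unfolding bcl_sum[OF W_bcl] by (simp add: W_V)

lemma norm_component_le:
  assumes "j < n"
  shows "norm (f j) \<le> norm (\<Sum>i<n. V i (f i))"
  using norm_W[of j "\<Sum>i<n. V i (f i)"] by (simp add: W_sum[OF assms])

lemma closure_span_V:
  assumes "x \<in> closure L" "\<And>y. y \<in> L \<Longrightarrow> y = (\<Sum>i<n. V i (W i y))"
  shows "x = (\<Sum>i<n. V i (W i x))"
proof -
  have bcl: "bounded_clinear (\<lambda>y. \<Sum>i<n. V i (W i y))"
    by (rule bcl_setsum[OF finite_lessThan bcl_compose[OF V_bcl W_bcl]])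
  have "closed {y. y = (\<Sum>i<n. V i (W i y))}"
    by (rule closed_Collect_eq[OF continuous_on_id bcl_continuous_on[OF bcl continuous_on_id]])
  then have "closure L \<subseteq> {y. y = (\<Sum>i<n. V i (W i y))}"
    by (intro closure_minimal subsetI CollectI assms(2))
  then show ?thesis using assms(1) by blast
qed

text \<open>The double commutant theorem for a family of representations, with the commutant replaced by
  the intertwiners between the members of the family: these are the matrix entries of the
  projections commuting with the direct sum.\<close>

lemma density:
  fixes \<sigma> :: "nat \<Rightarrow> 'm::cstar_algebra \<Rightarrow> 'h \<Rightarrow> 'h"
  assumes \<sigma>: "\<And>i. i < n \<Longrightarrow> star_rep (\<sigma> i)"
    and T: "\<And>i. i < n \<Longrightarrow> bounded_clinear (T i)"
    and comm: "\<And>i j y h. i < n \<Longrightarrow> j < n \<Longrightarrow> bounded_clinear y \<Longrightarrow>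
      (\<And>a h. y (\<sigma> j a h) = \<sigma> i a (y h)) \<Longrightarrow> y (T j h) = T i (y h)"
    and e: "e > 0"
  shows "\<exists>a. \<forall>i<n. norm (\<sigma> i a (v i) - T i (v i)) < e"
proof -
  define x where "x a = (\<Sum>i<n. V i (\<sigma> i a (v i)))" for a
  define L0 where "L0 = range x"
  define L where "L = closure L0"
  define G where "G a y = (\<Sum>i<n. V i (\<sigma> i a (W i y)))" for a y
  have G_bcl: "bounded_clinear (G a)" for a
    unfolding G_def
    by (rule bcl_setsum[OF finite_lessThan bcl_compose[OF V_bcl bcl_compose[OF star_rep.bcl[OF \<sigma>] W_bcl]]])
      simp
  have G_adj: "cinner (G a y) z = cinner y (G (a\<^sup>\<star>) z)" for a y z
    unfolding G_def cinner_sum_left cinner_sum_right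
  proof (rule sum.cong[OF refl])
    fix i assume "i \<in> {..<n}"
    then have i: "i < n" by simp
    have "cinner (V i (\<sigma> i a (W i y))) z = cinner (\<sigma> i a (W i y)) (W i z)"
      by (rule W_right[symmetric])
    also have "\<dots> = cinner (W i y) (\<sigma> i (a\<^sup>\<star>) (W i z))"
      by (rule star_rep.star[OF \<sigma>[OF i]])
    also have "\<dots> = cinner y (V i (\<sigma> i (a\<^sup>\<star>) (W i z)))"
      by (rule W_left)
    finally show "cinner (V i (\<sigma> i a (W i y))) z = cinner y (V i (\<sigma> i (a\<^sup>\<star>) (W i z)))" .
  qed
  have G_x: "G a (x b) = x (a * b)" for a b
    unfolding G_def x_def
    by (rule sum.cong[OF refl]) (simp add: W_sum star_rep.mult[OF \<sigma>])
  have x_add: "x (a + b) = x a + x b" for a b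
    unfolding x_def sum.distrib[symmetric]
    by (rule sum.cong[OF refl]) (simp add: star_rep.add[OF \<sigma>] bcl_add[OF V_bcl])
  have x_scale: "x (c *\<^sub>C a) = c *\<^sub>C x a" for c a
    unfolding x_def cvs.scale_sum_right
    by (rule sum.cong[OF refl]) (simp add: star_rep.scaleC[OF \<sigma>] bcl_scaleC[OF V_bcl])
  have "csubspace L0"
    unfolding cvs.subspace_def L0_def
  proof (intro conjI ballI allI)
    have "x (0 *\<^sub>C 0) = 0" unfolding x_scale by simp
    then show "0 \<in> range x" by (metis rangeI)
    show "y + z \<in> range x" if "y \<in> range x" "z \<in> range x" for y z
      using that x_add[symmetric] by auto
    show "c *\<^sub>C y \<in> range x" if "y \<in> range x" for c y
      using that x_scale[symmetric] by auto
  qed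
  then have sL: "csubspace L" unfolding L_def by (rule csubspace_closure)
  have cL: "closed L" by (simp add: L_def)
  have G_L: "G a y \<in> L" if "y \<in> L" for a y
  proof -
    have "G a ` closure L0 \<subseteq> closure (G a ` L0)"
      by (rule continuous_image_closure_subset[OF bcl_continuous_on[OF G_bcl continuous_on_id] subset_UNIV])
    also have "\<dots> \<subseteq> closure L0"
      by (rule closure_mono) (auto simp: L0_def G_x)
    finally show ?thesis using that by (auto simp: L_def)
  qed
  have QG: "proj L (G a y) = G a (proj L y)" for a y
    by (rule proj_commute[OF sL cL G_adj G_bcl G_L G_L])
  note Q_bcl = bcl_proj[OF sL cL]
  define Q where "Q i j h = W i (proj L (V j h))" for i j h
  have Q_T: "Q i j (T j h) = T i (Q i j h)" if ij: "i < n" "j < n" for i j h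
  proof (rule comm[OF ij])
    show "bounded_clinear (Q i j)"
      unfolding Q_def by (rule bcl_compose[OF W_bcl bcl_compose[OF Q_bcl V_bcl]])
    fix a h
    have GV: "G a (V j h) = V j (\<sigma> j a h)"
    proof -
      have "G a (V j h) = (\<Sum>i<n. if i = j then V j (\<sigma> j a h) else 0)"
        unfolding G_def
        by (rule sum.cong[OF refl])
          (auto simp: W_V bcl_0[OF star_rep.bcl[OF \<sigma>]] bcl_0[OF V_bcl])
      then show ?thesis using ij by simp
    qed
    have "Q i j (\<sigma> j a h) = W i (G a (proj L (V j h)))"
      unfolding Q_def GV[symmetric] QG ..
    also have "\<dots> = \<sigma> i a (Q i j h)"
      unfolding G_def W_sum[OF ij(1)] Q_def ..
    finally show "Q i j (\<sigma> j a h) = \<sigma> i a (Q i j h)" .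
  qed
  have span: "y = (\<Sum>i<n. V i (W i y))" if "y \<in> L" for y
  proof (rule closure_span_V)
    show "y \<in> closure L0" using that by (simp add: L_def)
    show "z = (\<Sum>i<n. V i (W i z))" if "z \<in> L0" for z
      using that by (auto simp: L0_def x_def W_sum intro!: sum.cong)
  qed
  define X where "X = (\<Sum>i<n. V i (v i))"
  define TX where "TX = (\<Sum>i<n. V i (T i (v i)))"
  have "x 1 = X"
    unfolding x_def X_def by (rule sum.cong[OF refl]) (simp add: star_rep.one[OF \<sigma>])
  then have "X \<in> L0"
    unfolding L0_def by (rule range_eqI[OF sym])
  then have "X \<in> L"
    unfolding L_def by (rule subsetD[OF closure_subset])
  \<comment> \<open>The entries of the projection intertwine the \<sigma> i, so it commutes with the
    diagonal operator of the T i. As it fixes X, it fixes the image TX of X.\<close>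
  have "W i (proj L TX) = T i (v i)" if i: "i < n" for i
  proof -
    have "W i (proj L TX) = (\<Sum>j<n. Q i j (T j (v j)))"
      unfolding TX_def Q_def bcl_sum[OF Q_bcl] bcl_sum[OF W_bcl] ..
    also have "\<dots> = (\<Sum>j<n. T i (Q i j (v j)))"
      by (rule sum.cong[OF refl]) (simp add: Q_T i)
    also have "\<dots> = T i (W i (proj L X))"
      unfolding bcl_sum[OF T[OF i], symmetric] X_def Q_def bcl_sum[OF Q_bcl] bcl_sum[OF W_bcl] ..
    also have "\<dots> = T i (v i)"
      unfolding proj_fix[OF sL cL \<open>X \<in> L\<close>] by (simp add: X_def W_sum i)
    finally show ?thesis .
  qed
  then have "proj L TX = TX"
    unfolding TX_def by (subst span[OF proj_in[OF sL cL]]) (simp add: TX_def)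
  then have "TX \<in> closure L0"
    using proj_in[OF sL cL, of TX] by (simp add: L_def)
  then obtain a where a: "dist (x a) TX < e"
    using e unfolding closure_approachable L0_def by blast
  have "norm (\<sigma> i a (v i) - T i (v i)) < e" if "i < n" for i
  proof -
    have "x a - TX = (\<Sum>i<n. V i (\<sigma> i a (v i) - T i (v i)))"
      by (simp add: x_def TX_def sum_subtractf bcl_diff[OF V_bcl])
    then show ?thesis
      using norm_component_le[OF that, of "\<lambda>i. \<sigma> i a (v i) - T i (v i)"] a by (simp add: dist_norm)
  qed
  then show ?thesis by blast
qed

text \<open>Symmetrizing an approximant from \<open>density\<close> does not suffice, as taking
  adjoints is not strongly continuous. Instead the residual r at the closest point is tested: a
  symmetrized functional \<psi> vanishes on self-adjoint elements, hence everywhere, and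
  \<open>density\<close> for the vectors \<open>v i\<close> and \<open>W i r\<close> together
  carries this over to T.\<close>

lemma density_sa:
  fixes \<sigma> :: "nat \<Rightarrow> 'm::cstar_algebra \<Rightarrow> 'h \<Rightarrow> 'h"
  assumes \<sigma>: "\<And>i. i < n \<Longrightarrow> star_rep (\<sigma> i)"
    and T: "\<And>i. i < n \<Longrightarrow> bounded_clinear (T i)"
    and T_sa: "\<And>i h k. i < n \<Longrightarrow> cinner (T i h) k = cinner h (T i k)"
    and comm: "\<And>i j y h. i < n \<Longrightarrow> j < n \<Longrightarrow> bounded_clinear y \<Longrightarrow>
      (\<And>a h. y (\<sigma> j a h) = \<sigma> i a (y h)) \<Longrightarrow> y (T j h) = T i (y h)"
    and e: "e > 0"
  shows "\<exists>a. a\<^sup>\<star> = a \<and> (\<forall>i<n. norm (\<sigma> i a (v i) - T i (v i)) < e)"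
proof -
  define x where "x a = (\<Sum>i<n. V i (\<sigma> i a (v i)))" for a
  define S where "S = {a::'m. a\<^sup>\<star> = a}"
  define L0 where "L0 = x ` S"
  define TX where "TX = (\<Sum>i<n. V i (T i (v i)))"
  have x_add: "x (a + b) = x a + x b" for a b
    unfolding x_def sum.distrib[symmetric]
    by (rule sum.cong[OF refl]) (simp add: star_rep.add[OF \<sigma>] bcl_add[OF V_bcl])
  have x_scale: "x (c *\<^sub>R a) = c *\<^sub>R x a" for c a
    unfolding x_def scaleR_sum_right
    by (rule sum.cong[OF refl]) (simp add: star_rep.scaleR[OF \<sigma>] bcl_scaleR[OF V_bcl])
  have "subspace L0"
    unfolding subspace_def L0_def
  proof (intro conjI ballI allI)
    have "x (0 *\<^sub>R 0) = 0" unfolding x_scale by simp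
    then show "0 \<in> x ` S" by (auto simp: S_def image_iff intro!: exI[of _ 0])
    show "y + z \<in> x ` S" if "y \<in> x ` S" "z \<in> x ` S" for y z
      using that by (auto simp: S_def x_add[symmetric] star_add)
    show "c *\<^sub>R y \<in> x ` S" if "y \<in> x ` S" for c y
      using that by (auto simp: S_def x_scale[symmetric] star_scaleR)
  qed
  then have "subspace (closure L0)" by (rule subspace_closure)
  then obtain p where p: "p \<in> closure L0" "\<And>y. y \<in> closure L0 \<Longrightarrow> Re (cinner y (TX - p)) = 0"
    using closest_point_subspace[of "closure L0"] by blast
  define r where "r = TX - p"
  have orth: "Re (cinner (x b) r) = 0" if "b\<^sup>\<star> = b" for b
    unfolding r_def by (rule p(2)) (use that closure_subset[of L0] in \<open>auto simp: L0_def S_def\<close>)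
  \<comment> \<open>For self-adjoint a this is twice the real part of \<open>cinner (x a) r\<close>;
    in this form it is conjugate linear in a.\<close>
  define \<psi> where "\<psi> a = (\<Sum>i<n. cinner (\<sigma> i a (v i)) (W i r) + cinner (\<sigma> i a (W i r)) (v i))" for a
  have xr: "cinner (x a) r = (\<Sum>i<n. cinner (\<sigma> i a (v i)) (W i r))" for a
    unfolding x_def cinner_sum_left W_right ..
  have \<psi>_sa: "\<psi> b = 0" if b: "b\<^sup>\<star> = b" for b
  proof -
    have "\<psi> b = (\<Sum>i<n. cinner (\<sigma> i b (v i)) (W i r)) + (\<Sum>i<n. cnj (cinner (\<sigma> i b (v i)) (W i r)))"
      unfolding \<psi>_def sum.distrib[symmetric]
    proof (rule sum.cong[OF refl])
      fix i assume "i \<in> {..<n}"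
      then have "cinner (\<sigma> i b (W i r)) (v i) = cinner (W i r) (\<sigma> i b (v i))"
        using star_rep.star_sa[OF \<sigma> b] by simp
      then show "cinner (\<sigma> i b (v i)) (W i r) + cinner (\<sigma> i b (W i r)) (v i) =
          cinner (\<sigma> i b (v i)) (W i r) + cnj (cinner (\<sigma> i b (v i)) (W i r))"
        using cinner_commute[of "W i r" "\<sigma> i b (v i)"] by simp
    qed
    also have "\<dots> = cinner (x b) r + cnj (cinner (x b) r)"
      by (simp add: xr)
    also have "\<dots> = 0"
      using orth[OF b] by (simp add: complex_eq_iff)
    finally show ?thesis .
  qed
  have \<psi>_add: "\<psi> (a + b) = \<psi> a + \<psi> b" for a b
    unfolding \<psi>_def sum.distrib[symmetric]
    by (rule sum.cong[OF refl]) (simp add: star_rep.add[OF \<sigma>] cinner_add_left)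
  have \<psi>_scale: "\<psi> (c *\<^sub>C a) = cnj c * \<psi> a" for c a
    unfolding \<psi>_def sum_distrib_left
    by (rule sum.cong[OF refl]) (simp add: star_rep.scaleC[OF \<sigma>] cinner_scaleC_left algebra_simps)
  have \<psi>0: "\<psi> a = 0" for a
  proof -
    define b c where "b = a + a\<^sup>\<star>" "c = \<i> *\<^sub>C (a - a\<^sup>\<star>)"
    have "b\<^sup>\<star> = b" "c\<^sup>\<star> = c"
      by (simp_all add: b_c_def star_add star_star star_scaleC star_diff add.commute
          cvs.scale_right_diff_distrib)
    then have "\<psi> b = 0" "\<psi> c = 0" by (simp_all add: \<psi>_sa)
    have "2 *\<^sub>C a = b + (- \<i>) *\<^sub>C c"
      by (simp only: b_c_def scaleC_scaleC)
        (simp add: cvs.scale_right_diff_distrib scaleC_add_left[of 1 1, simplified] scaleC_one)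
    then have "\<psi> (2 *\<^sub>C a) = 0"
      by (simp only: \<psi>_add \<psi>_scale \<open>\<psi> b = 0\<close> \<open>\<psi> c = 0\<close>) simp
    then show ?thesis by (simp add: \<psi>_scale)
  qed
  define \<psi>T where "\<psi>T = (\<Sum>i<n. cinner (T i (v i)) (W i r) + cinner (T i (W i r)) (v i))"
  have "cmod \<psi>T \<le> \<epsilon> * (\<Sum>i<n. norm (W i r) + norm (v i))" if "\<epsilon> > 0" for \<epsilon>
  proof -
    \<comment> \<open>Each representation occurs twice, once for \<open>v i\<close> and once for
      \<open>W i r\<close>.\<close>
    define v' where "v' i = (if even i then v (i div 2) else W (i div 2) r)" for i
    have half: "i div 2 < n" if "i < 2 * n" for i using that by simp
    have "\<exists>a. \<forall>i<2 * n. norm (\<sigma> (i div 2) a (v' i) - T (i div 2) (v' i)) < \<epsilon>"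
    proof (rule density[where \<sigma> = "\<lambda>i. \<sigma> (i div 2)" and T = "\<lambda>i. T (i div 2)"])
      show "y (T (j div 2) h) = T (i div 2) (y h)"
        if "i < 2 * n" "j < 2 * n" "bounded_clinear y" "\<And>a h. y (\<sigma> (j div 2) a h) = \<sigma> (i div 2) a (y h)"
        for i j y h
        by (rule comm[OF half[OF that(1)] half[OF that(2)] that(3) that(4)])
    qed (rule \<sigma>[OF half], assumption, rule T[OF half], assumption, rule \<open>\<epsilon> > 0\<close>)
    then obtain a where a: "\<And>i. i < 2 * n \<Longrightarrow> norm (\<sigma> (i div 2) a (v' i) - T (i div 2) (v' i)) < \<epsilon>"
      by blast
    have a1: "norm (\<sigma> i a (v i) - T i (v i)) < \<epsilon>" "norm (\<sigma> i a (W i r) - T i (W i r)) < \<epsilon>" if "i < n" for i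
      using a[of "2 * i"] a[of "2 * i + 1"] that by (simp_all add: v'_def)
    have "\<psi>T = \<psi>T - \<psi> a" by (simp add: \<psi>0)
    also have "\<dots> = (\<Sum>i<n. cinner (T i (v i) - \<sigma> i a (v i)) (W i r) + cinner (T i (W i r) - \<sigma> i a (W i r)) (v i))"
      by (simp add: \<psi>T_def \<psi>_def sum_subtractf[symmetric] cinner_diff_left algebra_simps)
    also have "cmod \<dots> \<le> (\<Sum>i<n. \<epsilon> * (norm (W i r) + norm (v i)))"
    proof (rule sum_norm_le)
      fix i assume "i \<in> {..<n}"
      then have i: "i < n" by simp
      have "cmod (cinner (T i (v i) - \<sigma> i a (v i)) (W i r)) \<le> norm (T i (v i) - \<sigma> i a (v i)) * norm (W i r)"
        by (rule cinner_Cauchy_Schwarz)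
      also have "\<dots> \<le> \<epsilon> * norm (W i r)"
        using a1(1)[OF i] by (intro mult_right_mono) (simp_all add: norm_minus_commute)
      finally have 1: "cmod (cinner (T i (v i) - \<sigma> i a (v i)) (W i r)) \<le> \<epsilon> * norm (W i r)" .
      have "cmod (cinner (T i (W i r) - \<sigma> i a (W i r)) (v i)) \<le> norm (T i (W i r) - \<sigma> i a (W i r)) * norm (v i)"
        by (rule cinner_Cauchy_Schwarz)
      also have "\<dots> \<le> \<epsilon> * norm (v i)"
        using a1(2)[OF i] by (intro mult_right_mono) (simp_all add: norm_minus_commute)
      finally have 2: "cmod (cinner (T i (W i r) - \<sigma> i a (W i r)) (v i)) \<le> \<epsilon> * norm (v i)" .
      show "cmod (cinner (T i (v i) - \<sigma> i a (v i)) (W i r) + cinner (T i (W i r) - \<sigma> i a (W i r)) (v i))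
          \<le> \<epsilon> * (norm (W i r) + norm (v i))"
        using norm_triangle_ineq[of "cinner (T i (v i) - \<sigma> i a (v i)) (W i r)"
            "cinner (T i (W i r) - \<sigma> i a (W i r)) (v i)"] 1 2
        unfolding distrib_left by linarith
    qed
    finally show ?thesis by (simp add: sum_distrib_left)
  qed
  then have "\<psi>T = 0"
  proof -
    assume *: "\<And>\<epsilon>. \<epsilon> > 0 \<Longrightarrow> cmod \<psi>T \<le> \<epsilon> * (\<Sum>i<n. norm (W i r) + norm (v i))"
    define s where "s = (\<Sum>i<n. norm (W i r) + norm (v i))"
    have s0: "s \<ge> 0" unfolding s_def by (intro sum_nonneg) simp
    show ?thesis
    proof (rule ccontr)
      assume n0: "\<psi>T \<noteq> 0"
      have "cmod \<psi>T / (2 * (s + 1)) > 0" using n0 s0 by simp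
      from *[OF this] have "cmod \<psi>T \<le> cmod \<psi>T / (2 * (s + 1)) * s" by (simp add: s_def)
      also have "\<dots> \<le> cmod \<psi>T / (2 * (s + 1)) * (s + 1)" using s0 by (intro mult_left_mono) auto
      also have "\<dots> = cmod \<psi>T / 2" using s0 by (simp add: field_simps)
      finally show False using n0 by simp
    qed
  qed
  moreover have "\<psi>T = cinner TX r + cnj (cinner TX r)"
  proof -
    have "cinner TX r = (\<Sum>i<n. cinner (T i (v i)) (W i r))"
      unfolding TX_def cinner_sum_left W_right ..
    moreover have "cinner (T i (W i r)) (v i) = cnj (cinner (T i (v i)) (W i r))" if "i < n" for i
      using T_sa[OF that, of "W i r" "v i"] cinner_commute[of "W i r" "T i (v i)"] by simp
    ultimately show ?thesis by (simp add: \<psi>T_def sum.distrib)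
  qed
  ultimately have "Re (cinner TX r) = 0"
    by (simp add: complex_eq_iff)
  moreover have "Re (cinner p r) = 0" using p by (simp add: r_def)
  ultimately have "Re (cinner r r) = 0"
    by (metis (no_types) cinner_diff_left diff_zero minus_complex.sel(1) r_def)
  then have "TX = p" by (simp add: Re_cinner_self r_def)
  then have "TX \<in> closure L0" using p(1) by simp
  then obtain a where a: "a\<^sup>\<star> = a" "dist (x a) TX < e"
    using e unfolding closure_approachable L0_def S_def by blast
  have "norm (\<sigma> i a (v i) - T i (v i)) < e" if "i < n" for i
  proof -
    have "x a - TX = (\<Sum>i<n. V i (\<sigma> i a (v i) - T i (v i)))"
      by (simp add: x_def TX_def sum_subtractf bcl_diff[OF V_bcl])
    then show ?thesis
      using norm_component_le[OF that, of "\<lambda>i. \<sigma> i a (v i) - T i (v i)"] a by (simp add: dist_norm)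
  qed
  then show ?thesis using a(1) by blast
qed

end

text \<open>A version of Kaplansky's density theorem. The function \<open>4 t / (4 + t\<^sup>2)\<close> is a sum of resolvents,
  hence strongly continuous on self-adjoint operators, and it is bounded.\<close>

context amplification
begin

lemma Kaplansky:
  fixes \<sigma> :: "nat \<Rightarrow> 'm::cstar_algebra \<Rightarrow> 'h \<Rightarrow> 'h"
  assumes \<sigma>: "\<And>i. i < n \<Longrightarrow> star_rep (\<sigma> i)"
    and T: "\<And>i. i < n \<Longrightarrow> bounded_clinear (T i)"
    and T_sa: "\<And>i h k. i < n \<Longrightarrow> cinner (T i h) k = cinner h (T i k)"
    and comm: "\<And>i j y h. i < n \<Longrightarrow> j < n \<Longrightarrow> bounded_clinear y \<Longrightarrow>
      (\<And>a h. y (\<sigma> j a h) = \<sigma> i a (y h)) \<Longrightarrow> y (T j h) = T i (y h)"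
    and e: "e > 0"
    and u: "\<And>i. i < n \<Longrightarrow> T i (T i (u i)) + 4 *\<^sub>C u i = v i"
  shows "\<exists>a. a\<^sup>\<star> = a \<and> norm a \<le> 2 \<and> (\<forall>i<n. norm (\<sigma> i a (v i) - 4 *\<^sub>C T i (u i)) < e)"
proof -
  \<comment> \<open>\<open>w s i\<close> is the inverse of T i + 2 s \<i> applied to
    \<open>v i\<close>, because \<open>u i\<close> is the inverse of the square of T i plus 4
    applied to \<open>v i\<close>.\<close>
  define w where "w s i = T i (u i) - (s * (2 * \<i>)) *\<^sub>C u i" for s :: complex and i
  define v' where "v' i = (if even i then w 1 (i div 2) else w (-1) (i div 2))" for i
  have half: "i div 2 < n" if "i < 2 * n" for i using that by simp
  have "\<exists>b. b\<^sup>\<star> = b \<and> (\<forall>i<2 * n. norm (\<sigma> (i div 2) b (v' i) - T (i div 2) (v' i)) < e / 3)"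
  proof (rule density_sa[where \<sigma> = "\<lambda>i. \<sigma> (i div 2)" and T = "\<lambda>i. T (i div 2)"])
    show "y (T (j div 2) h) = T (i div 2) (y h)"
      if "i < 2 * n" "j < 2 * n" "bounded_clinear y" "\<And>a h. y (\<sigma> (j div 2) a h) = \<sigma> (i div 2) a (y h)"
      for i j y h
      by (rule comm[OF half[OF that(1)] half[OF that(2)] that(3) that(4)])
    show "e / 3 > 0" using e by simp
  qed (rule \<sigma>[OF half], assumption, rule T[OF half], assumption, rule T_sa[OF half], assumption)
  then obtain b where b: "b\<^sup>\<star> = b"
    and bv: "\<And>i. i < 2 * n \<Longrightarrow> norm (\<sigma> (i div 2) b (v' i) - T (i div 2) (v' i)) < e / 3"
    by blast
  have bw: "norm (\<sigma> i b (w 1 i) - T i (w 1 i)) < e / 3" "norm (\<sigma> i b (w (-1) i) - T i (w (-1) i)) < e / 3"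
    if "i < n" for i
    using bv[of "2 * i"] bv[of "2 * i + 1"] that by (simp_all add: v'_def)
  define x where "x = (\<i> * of_real 2) *\<^sub>C (1::'m)"
  obtain c where c: "inv_pair (b + x) c" "inv_pair (b - x) (c\<^sup>\<star>)" "norm c \<le> 1 / 2"
    using resolvent[OF b, of 2] unfolding x_def by auto
  \<comment> \<open>This is 4 b / (4 + b^2), of norm at most 2 by the resolvent bound 1 / 2.\<close>
  define a where "a = 2 *\<^sub>C (c + c\<^sup>\<star>)"
  have "a\<^sup>\<star> = a" by (simp add: a_def star_scaleC star_add star_star add.commute)
  moreover have "norm a \<le> 2"
    using norm_triangle_ineq[of c "c\<^sup>\<star>"] c(3) by (simp add: a_def norm_scaleC)
  moreover have "norm (\<sigma> i a (v i) - 4 *\<^sub>C T i (u i)) < e" if i: "i < n" for i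
  proof -
    interpret \<sigma>: star_rep "\<sigma> i" by (rule \<sigma>[OF i])
    note Tl = bcl_diff[OF T[OF i]] bcl_scaleC[OF T[OF i]]
    have v1: "v i = T i (w s i) + (s * (2 * \<i>)) *\<^sub>C w s i" if "s = 1 \<or> s = -1" for s
    proof -
      have "(s * (2 * \<i>)) *\<^sub>C (s * (2 * \<i>)) *\<^sub>C u i = - (4 *\<^sub>C u i)"
        using that by (auto simp: scaleC_scaleC)
      then show ?thesis
        by (simp add: u[OF i, symmetric] w_def Tl cvs.scale_right_diff_distrib)
    qed
    \<comment> \<open>By the resolvent identity the error is d applied to (T i - b) w, so it
      suffices that b approximates T i at the vectors \<open>w s i\<close>.\<close>
    have step: "norm (\<sigma> i d (v i) - w s i) \<le> norm (\<sigma> i b (w s i) - T i (w s i)) / 2"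
      if s: "s = 1 \<or> s = -1" and d: "d * (b + s *\<^sub>C x) = 1" "norm d \<le> 1 / 2" for s d
    proof -
      have "w s i = \<sigma> i d (\<sigma> i (b + s *\<^sub>C x) (w s i))"
        by (simp add: \<sigma>.mult[symmetric] d \<sigma>.one)
      also have "\<sigma> i (b + s *\<^sub>C x) (w s i) = \<sigma> i b (w s i) + (s * (2 * \<i>)) *\<^sub>C w s i"
        by (simp add: x_def \<sigma>.add \<sigma>.scaleC \<sigma>.one scaleC_scaleC mult.commute)
      finally have "\<sigma> i d (v i) - w s i = \<sigma> i d (v i) - \<sigma> i d (\<sigma> i b (w s i) + (s * (2 * \<i>)) *\<^sub>C w s i)"
        by simp
      also have "\<dots> = \<sigma> i d (T i (w s i) - \<sigma> i b (w s i))"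
        unfolding v1[OF s] bcl_diff[OF \<sigma>.bcl, symmetric] by simp
      finally have "norm (\<sigma> i d (v i) - w s i) \<le> norm d * norm (T i (w s i) - \<sigma> i b (w s i))"
        using \<sigma>.contractive by metis
      also have "\<dots> \<le> 1 / 2 * norm (T i (w s i) - \<sigma> i b (w s i))"
        using d(2) by (rule mult_right_mono) simp
      finally show ?thesis by (simp add: norm_minus_commute)
    qed
    have s1: "norm (\<sigma> i c (v i) - w 1 i) \<le> norm (\<sigma> i b (w 1 i) - T i (w 1 i)) / 2"
      by (rule step) (use c in \<open>auto simp: inv_pair_def scaleC_one\<close>)
    have s2: "norm (\<sigma> i (c\<^sup>\<star>) (v i) - w (-1) i) \<le> norm (\<sigma> i b (w (-1) i) - T i (w (-1) i)) / 2"
      by (rule step) (use c in \<open>auto simp: inv_pair_def\<close>)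
    have "\<sigma> i a (v i) - 4 *\<^sub>C T i (u i) = 2 *\<^sub>C ((\<sigma> i c (v i) - w 1 i) + (\<sigma> i (c\<^sup>\<star>) (v i) - w (-1) i))"
    proof -
      have "w 1 i + w (-1) i = 2 *\<^sub>C T i (u i)"
        using scaleC_add_left[of 1 1 "T i (u i)"] by (simp add: w_def scaleC_one)
      then have "4 *\<^sub>C T i (u i) = 2 *\<^sub>C (w 1 i + w (-1) i)"
        by (simp add: scaleC_scaleC)
      then show ?thesis
        by (simp add: a_def \<sigma>.scaleC \<sigma>.add scaleC_add_right cvs.scale_right_diff_distrib algebra_simps)
    qed
    then have "norm (\<sigma> i a (v i) - 4 *\<^sub>C T i (u i)) \<le> 2 * (norm (\<sigma> i c (v i) - w 1 i) + norm (\<sigma> i (c\<^sup>\<star>) (v i) - w (-1) i))"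
      using norm_triangle_ineq[of "\<sigma> i c (v i) - w 1 i" "\<sigma> i (c\<^sup>\<star>) (v i) - w (-1) i"]
      by (simp add: norm_scaleC)
    also have "norm (\<sigma> i c (v i) - w 1 i) < e / 6"
      using s1 bw(1)[OF i] by linarith
    also have "norm (\<sigma> i (c\<^sup>\<star>) (v i) - w (-1) i) < e / 6"
      using s2 bw(2)[OF i] by linarith
    finally show ?thesis
      using e by simp
  qed
  ultimately show ?thesis by blast
qed

end

section \<open>The double commutant theorem for representations of factors\<close>

locale factor_rep = normal_representation \<pi> + amplification V
  for \<pi> :: "'m::wstar_algebra \<Rightarrow> 'h::complex_hilbert \<Rightarrow> 'h"
    and V :: "nat \<Rightarrow> 'h \<Rightarrow> 'k::complex_hilbert" +
  assumes factor: "(center :: 'm set) = range (\<lambda>c. c *\<^sub>C 1)"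
    and nontrivial: "\<exists>h::'h. h \<noteq> 0"
begin

lemma rep_inj: "(\<And>h. \<pi> a h = \<pi> b h) \<Longrightarrow> a = b"
  using faithful[OF factor nontrivial, of "a - b"] by (simp add: diff)

definition commutant :: "('h \<Rightarrow> 'h) set"
  where "commutant = {y. bounded_clinear y \<and> (\<forall>a h. y (\<pi> a h) = \<pi> a (y h))}"

text \<open>A weak* cluster point b of Kaplansky approximants satisfies \<pi> b = 4 T / (4 + T^2).
  The remainder T^3 / (4 + T^2) has norm at most 1 / 4 for a contraction T.\<close>

lemma bicommutant_approx:
  assumes T: "bounded_clinear T" and T_sa: "\<And>h k. cinner (T h) k = cinner h (T k)"
    and T_norm: "\<And>h. norm (T h) \<le> norm h"
    and comm: "\<And>y h. y \<in> commutant \<Longrightarrow> y (T h) = T (y h)"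
  shows "\<exists>b. b\<^sup>\<star> = b \<and> norm b \<le> 2 \<and> (\<forall>h. norm (T h - \<pi> b h) \<le> norm h / 4)"
proof -
  \<comment> \<open>Surjectivity of T^2 + 4, from a fixed point with contraction constant 1 /
    4.\<close>
  have "\<exists>u. T (T u) + 4 *\<^sub>C u = v" for v
  proof -
    define f where "f u = (1/4) *\<^sub>C (v - T (T u))" for u
    have "\<exists>!u. f u = u"
    proof (rule banach_fix_type[of "1/4"], simp, simp, intro allI)
      fix x y
      have "f x - f y = (1/4) *\<^sub>C T (T (y - x))"
        by (simp add: f_def bcl_diff[OF T] cvs.scale_right_diff_distrib)
      then have "norm (f x - f y) = 1/4 * norm (T (T (y - x)))"
        by (simp add: norm_scaleC)
      also have "\<dots> \<le> 1/4 * norm (y - x)"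
        using order.trans[OF T_norm T_norm] by (intro mult_left_mono) auto
      finally show "dist (f x) (f y) \<le> 1/4 * dist x y"
        by (simp add: dist_norm norm_minus_commute)
    qed
    then obtain u where "f u = u" by blast
    then have "4 *\<^sub>C f u = 4 *\<^sub>C u" by simp
    then have "v - T (T u) = 4 *\<^sub>C u" by (simp add: f_def scaleC_scaleC scaleC_one)
    then have "v = 4 *\<^sub>C u + T (T u)" by (simp only: diff_eq_eq)
    then show ?thesis by (intro exI[of _ u]) (simp only: add.commute)
  qed
  then obtain U where U: "\<And>v. T (T (U v)) + 4 *\<^sub>C U v = v" by metis
  define I where "I = (UNIV :: 'h set) \<times> {e::real. e > 0}"
  define G where "G = (\<lambda>(v, e). {a. a\<^sup>\<star> = a \<and> norm a \<le> 2 \<and> norm (\<pi> a v - 4 *\<^sub>C T (U v)) < e})"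
  define F where "F = (INF p\<in>I. principal (G p))"
  have Fne: "F \<noteq> bot"
    unfolding F_def
  proof (rule INF_filter_not_bot)
    fix X assume X: "X \<subseteq> I" "finite X"
    then obtain ps where ps: "set ps = X" using finite_list by blast
    define e where "e = Min (insert 1 (snd ` X))"
    have e: "e > 0" "\<And>p. p \<in> X \<Longrightarrow> e \<le> snd p"
      using X by (auto simp: e_def I_def)
    have "\<exists>a. a\<^sup>\<star> = a \<and> norm a \<le> 2 \<and> (\<forall>i<length ps. norm (\<pi> a (fst (ps ! i)) - 4 *\<^sub>C T (U (fst (ps ! i)))) < e)"
    proof (rule Kaplansky[where \<sigma> = "\<lambda>_. \<pi>" and T = "\<lambda>_. T"])
      show "star_rep \<pi>" by (rule star_rep_axioms)
      show "y (T h) = T (y h)" if "bounded_clinear y" "\<And>a h. y (\<pi> a h) = \<pi> a (y h)" for y h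
        using that by (intro comm) (simp add: commutant_def)
    qed (rule T T_sa e U)+
    then obtain a where a: "a\<^sup>\<star> = a" "norm a \<le> 2"
      "\<And>i. i < length ps \<Longrightarrow> norm (\<pi> a (fst (ps ! i)) - 4 *\<^sub>C T (U (fst (ps ! i)))) < e" by blast
    have "a \<in> G p" if "p \<in> X" for p
    proof -
      have "p \<in> set ps" using that ps by simp
      then obtain i where i: "i < length ps" "ps ! i = p" unfolding in_set_conv_nth by blast
      have "norm (\<pi> a (fst p) - 4 *\<^sub>C T (U (fst p))) < snd p"
        using a(3)[OF i(1)] e(2)[OF that] unfolding i(2) by linarith
      then show ?thesis
        unfolding G_def case_prod_unfold mem_Collect_eq using a(1,2) by (intro conjI)
    qed
    then have "a \<in> (\<Inter>p\<in>X. G p)" by blast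
    then show "(INF p\<in>X. principal (G p)) \<noteq> bot"
      unfolding INF_principal_finite[OF X(2)] principal_eq_bot_iff by blast
  qed
  have evG: "eventually (\<lambda>z. z \<in> G p) F" if "p \<in> I" for p
    unfolding F_def using that by (intro eventually_INF1) (auto simp: eventually_principal)
  have I0: "(0, 1) \<in> I" by (simp add: I_def)
  have ev2: "eventually (\<lambda>z. norm z \<le> 2) F"
    using evG[OF I0] by (rule eventually_mono) (simp add: G_def)
  obtain F' b where F': "F' \<le> F" "F' \<noteq> bot" "norm b \<le> 2"
    and lim: "\<And>f. f \<in> predual \<Longrightarrow> ((\<lambda>i. f i) \<longlongrightarrow> f b) F'"
    using weakstar_cluster[OF Fne ev2] by blast
  have evG': "eventually (\<lambda>z. z \<in> G p) F'" if "p \<in> I" for p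
    using evG[OF that] F'(1) filter_leD by blast
  note limb = lim[OF vector_functional_predual]
  have \<pi>b: "\<pi> b v = 4 *\<^sub>C T (U v)" for v
  proof -
    have "((\<lambda>a. \<pi> a v) \<longlongrightarrow> 4 *\<^sub>C T (U v)) F'"
    proof (rule tendstoI)
      fix e :: real assume "e > 0"
      then have "(v, e) \<in> I" by (simp add: I_def)
      from evG'[OF this] show "eventually (\<lambda>a. dist (\<pi> a v) (4 *\<^sub>C T (U v)) < e) F'"
        by (rule eventually_mono) (simp add: G_def dist_norm)
    qed
    then have "((\<lambda>a. cinner h (\<pi> a v)) \<longlongrightarrow> cinner h (4 *\<^sub>C T (U v))) F'" for h
      by (intro tendsto_cinner tendsto_const)
    then have "cinner h (\<pi> b v) = cinner h (4 *\<^sub>C T (U v))" for h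
      by (rule tendsto_unique[OF F'(2) limb])
    then show ?thesis by (rule cinner_ext)
  qed
  have "b\<^sup>\<star> = b"
  proof (rule rep_inj, rule cinner_ext)
    fix h k
    have "((\<lambda>a. cnj (cinner k (\<pi> a h))) \<longlongrightarrow> cnj (cinner k (\<pi> b h))) F'"
      by (intro tendsto_cnj limb)
    moreover have "eventually (\<lambda>a. cnj (cinner k (\<pi> a h)) = cinner h (\<pi> a k)) F'"
      using evG'[OF I0]
    proof (rule eventually_mono)
      fix a assume "a \<in> G (0, 1)"
      then have "cinner (\<pi> a h) k = cinner h (\<pi> a k)" by (intro star_sa) (simp add: G_def)
      then show "cnj (cinner k (\<pi> a h)) = cinner h (\<pi> a k)" by (simp only: cinner_commute[symmetric])
    qed
    ultimately have "((\<lambda>a. cinner h (\<pi> a k)) \<longlongrightarrow> cnj (cinner k (\<pi> b h))) F'"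
      by (rule Lim_transform_eventually)
    then have "cnj (cinner k (\<pi> b h)) = cinner h (\<pi> b k)"
      by (rule tendsto_unique[OF F'(2) _ limb])
    then show "cinner h (\<pi> (b\<^sup>\<star>) k) = cinner h (\<pi> b k)"
      unfolding star[symmetric] by (simp only: cinner_commute[symmetric])
  qed
  moreover have "norm (T v - \<pi> b v) \<le> norm v / 4" for v
  proof -
    define u where "u = U v"
    have "v = T (T u) + 4 *\<^sub>C u" by (simp add: u_def U)
    then have "T v = T (T (T u)) + 4 *\<^sub>C T u" by (simp add: bcl_add[OF T] bcl_scaleC[OF T])
    then have e: "T v - \<pi> b v = T (T (T u))" by (simp add: \<pi>b u_def)
    have n: "norm (T (T (T u))) \<le> norm u"
      using T_norm[of u] T_norm[of "T u"] T_norm[of "T (T u)"] by linarith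
    have "cinner u v = cinner (T u) (T u) + 4 * cinner u u"
      unfolding \<open>v = T (T u) + 4 *\<^sub>C u\<close> by (simp only: cinner_add_right cinner_scaleC_right T_sa)
    then have "Re (cinner u v) = (norm (T u))\<^sup>2 + 4 * (norm u)\<^sup>2"
      by (simp add: Re_cinner_self cinner_norm)
    moreover have "Re (cinner u v) \<le> norm u * norm v"
      using complex_Re_le_cmod cinner_Cauchy_Schwarz order.trans by blast
    ultimately have "4 * (norm u)\<^sup>2 \<le> norm u * norm v"
      using zero_le_power2[of "norm (T u)"] by linarith
    then have "norm u \<le> norm v / 4"
      by (cases "u = 0") (simp_all add: power2_eq_square)
    then show ?thesis unfolding e using n by linarith
  qed
  ultimately show ?thesis using F'(3) by blast
qed

text \<open>Four times the remainder in \<open>bicommutant_approx\<close> again satisfies the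
  hypotheses, so the approximation can be iterated. The series of corrections has norm at most 2 /
  (1 - 1/4), which is below 3.\<close>

lemma bicommutant_sa:
  assumes T: "bounded_clinear T" and T_sa: "\<And>h k. cinner (T h) k = cinner h (T k)"
    and T_norm: "\<And>h. norm (T h) \<le> norm h"
    and comm: "\<And>y h. y \<in> commutant \<Longrightarrow> y (T h) = T (y h)"
  shows "\<exists>b. norm b \<le> 3 \<and> (\<forall>h. \<pi> b h = T h)"
proof -
  define P where "P T \<longleftrightarrow> bounded_clinear T \<and> (\<forall>h k. cinner (T h) k = cinner h (T k)) \<and>
    (\<forall>h. norm (T h) \<le> norm h) \<and> (\<forall>y\<in>commutant. \<forall>h. y (T h) = T (y h))" for T
  have step: "\<exists>S'. P S' \<and> (\<exists>b. norm b \<le> 2 \<and> (\<forall>h. S' h = 4 *\<^sub>C (S h - \<pi> b h)))" if S: "P S" for S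
  proof -
    obtain b where b: "b\<^sup>\<star> = b" "norm b \<le> 2" "\<And>h. norm (S h - \<pi> b h) \<le> norm h / 4"
      using bicommutant_approx[of S] S unfolding P_def by blast
    have "P (\<lambda>h. 4 *\<^sub>C (S h - \<pi> b h))"
      unfolding P_def
    proof (intro conjI allI ballI)
      show "bounded_clinear (\<lambda>h. 4 *\<^sub>C (S h - \<pi> b h))"
        using S by (intro bcl_cmult bcl_minus bcl) (simp add: P_def)
      show "cinner (4 *\<^sub>C (S h - \<pi> b h)) k = cinner h (4 *\<^sub>C (S k - \<pi> b k))" for h k
        using S by (simp add: cinner_scaleC_left cinner_scaleC_right cinner_diff_left
            cinner_diff_right star_sa[OF b(1)] P_def)
      show "norm (4 *\<^sub>C (S h - \<pi> b h)) \<le> norm h" for h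
        using b(3)[of h] by (simp add: norm_scaleC)
      show "y (4 *\<^sub>C (S h - \<pi> b h)) = 4 *\<^sub>C (S (y h) - \<pi> b (y h))" if "y \<in> commutant" for y h
      proof -
        have y: "bounded_clinear y" "y (S h) = S (y h)" "y (\<pi> b h) = \<pi> b (y h)"
          using that S by (auto simp: P_def commutant_def)
        show ?thesis
          by (simp add: bcl_scaleC[OF y(1)] bcl_diff[OF y(1)] y)
      qed
    qed
    then show ?thesis using b(2) by blast
  qed
  have "P T" using assms by (auto simp: P_def)
  have "\<exists>S. \<forall>n. (P (S n) \<and> (n = 0 \<longrightarrow> S n = T)) \<and>
      (\<exists>b. norm b \<le> 2 \<and> (\<forall>h. S (Suc n) h = 4 *\<^sub>C (S n h - \<pi> b h)))"
  proof (rule dependent_nat_choice)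
    show "\<exists>x. P x \<and> (0 = (0::nat) \<longrightarrow> x = T)" using \<open>P T\<close> by blast
    show "\<exists>y. (P y \<and> (Suc n = 0 \<longrightarrow> y = T)) \<and> (\<exists>b. norm b \<le> 2 \<and> (\<forall>h. y h = 4 *\<^sub>C (x h - \<pi> b h)))"
      if "P x \<and> (n = 0 \<longrightarrow> x = T)" for x n
      using step[of x] that by blast
  qed
  then obtain S where S: "\<And>n. P (S n)" "S 0 = T"
    and "\<And>n. \<exists>b. norm b \<le> 2 \<and> (\<forall>h. S (Suc n) h = 4 *\<^sub>C (S n h - \<pi> b h))"
    by blast
  then obtain b where b: "\<And>n. norm (b n) \<le> 2" "\<And>n h. S (Suc n) h = 4 *\<^sub>C (S n h - \<pi> (b n) h)"
    by metis
  define c where "c n = (1/4) ^ n *\<^sub>R b n" for n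
  have nc: "norm (c n) \<le> 2 * (1/4) ^ n" for n
    using mult_left_mono[OF b(1)[of n], of "(1/4) ^ n"] by (simp add: c_def)
  have sg: "(\<lambda>n. 2 * (1/4) ^ n) sums (2 * (1 / (1 - 1/4::real)))"
    by (intro sums_mult geometric_sums) simp
  have "summable (\<lambda>n. norm (c n))"
    by (rule summable_comparison_test'[OF sums_summable[OF sg]]) (use nc in simp)
  then have "summable c" by (rule summable_norm_cancel)
  define B where "B = suminf c"
  have "norm B \<le> suminf (\<lambda>n. norm (c n))"
    unfolding B_def by (rule summable_norm) fact
  also have "\<dots> \<le> 2 * (1 / (1 - 1/4))"
    unfolding sums_unique[OF sg] by (rule suminf_le[OF nc]) (fact | rule sums_summable[OF sg])+
  finally have "norm B \<le> 3" by simp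
  have rep_sum: "\<pi> (sum c {..<n}) h = T h - (1/4) ^ n *\<^sub>R S n h" for n h
  proof (induction n)
    case 0
    then show ?case by (simp add: zero S)
  next
    case (Suc n)
    have eq: "(1/4) ^ Suc n *\<^sub>R S (Suc n) h = (1/4) ^ n *\<^sub>R (S n h - \<pi> (b n) h)"
    proof -
      have "4 *\<^sub>C x = (4::real) *\<^sub>R x" for x :: 'h by (simp add: scaleR_scaleC)
      then show ?thesis by (simp add: b(2))
    qed
    have sum: "\<pi> (sum c {..<Suc n}) h = \<pi> (sum c {..<n}) h + (1/4) ^ n *\<^sub>R \<pi> (b n) h"
      by (simp add: add c_def scaleR)
    show ?case
      unfolding sum Suc eq scaleR_diff_right by simp
  qed
  have "\<pi> B h = T h" for h
  proof -
    have "(\<lambda>n. \<pi> (sum c {..<n}) h) \<longlonglongrightarrow> \<pi> B h"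
      unfolding B_def by (intro tendsto_left summable_LIMSEQ) fact
    moreover have "(\<lambda>n. T h - (1/4) ^ n *\<^sub>R S n h) \<longlonglongrightarrow> T h - 0"
    proof (intro tendsto_diff tendsto_const)
      show "(\<lambda>n. (1/4) ^ n *\<^sub>R S n h) \<longlonglongrightarrow> 0"
      proof (rule Lim_null_comparison)
        show "eventually (\<lambda>n. norm ((1/4) ^ n *\<^sub>R S n h) \<le> (1/4) ^ n * norm h) sequentially"
          using S(1) by (intro always_eventually allI) (simp add: P_def mult_left_mono)
        show "(\<lambda>n. (1/4) ^ n * norm h) \<longlonglongrightarrow> 0"
          by (intro tendsto_mult_left_zero LIMSEQ_power_zero) simp
      qed
    qed
    ultimately show ?thesis
      unfolding rep_sum using LIMSEQ_unique by fastforce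
  qed
  then show ?thesis using \<open>norm B \<le> 3\<close> by blast
qed

lemma adj_commutant:
  assumes y: "y \<in> commutant"
  shows "adj y \<in> commutant"
proof -
  have yb: "bounded_clinear y" and yc: "\<And>a h. y (\<pi> a h) = \<pi> a (y h)"
    using y by (auto simp: commutant_def)
  have "adj y (\<pi> a h) = \<pi> a (adj y h)" for a h
  proof (rule cinner_ext)
    fix k
    have "cinner k (adj y (\<pi> a h)) = cinner (\<pi> (a\<^sup>\<star>) (y k)) h"
      by (simp add: adj_right[OF yb] star star_star)
    also have "\<dots> = cinner (\<pi> (a\<^sup>\<star>) k) (adj y h)"
      by (simp add: adj_right[OF yb] yc)
    finally show "cinner k (adj y (\<pi> a h)) = cinner k (\<pi> a (adj y h))"
      by (simp add: star star_star)
  qed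
  then show ?thesis by (simp add: commutant_def bcl_adj yb)
qed

lemma bicommutant:
  assumes T: "bounded_clinear T" and r: "r \<ge> 0" "\<And>h. norm (T h) \<le> r * norm h"
    and comm: "\<And>y h. y \<in> commutant \<Longrightarrow> y (T h) = T (y h)"
  shows "\<exists>b. norm b \<le> 6 * r \<and> (\<forall>h. \<pi> b h = T h)"
proof (cases "r = 0")
  case True
  then show ?thesis using r(2) by (intro exI[of _ 0]) (simp add: zero)
next
  case False
  with r have r0: "r > 0" by simp
  have ac: "y (adj T h) = adj T (y h)" if y: "y \<in> commutant" for y h
  proof (rule cinner_ext)
    fix k
    have yb: "bounded_clinear y" using y by (simp add: commutant_def)
    have "cinner k (y (adj T h)) = cinner (T (adj y k)) h"
      by (simp add: adj_left[OF yb, symmetric] adj_right[OF T])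
    also have "T (adj y k) = adj y (T k)" by (rule comm[OF adj_commutant[OF y], symmetric])
    finally show "cinner k (y (adj T h)) = cinner k (adj T (y h))"
      by (simp add: adj_left[OF yb] adj_right[OF T])
  qed
  have na: "norm (adj T h) \<le> r * norm h" for h by (rule adj_norm[OF T r])
  \<comment> \<open>S 1 and S \<i> are the real part and minus the imaginary part of T, divided by
    r; both are self-adjoint contractions. The bounds 3 for their preimages add up to 6 r.\<close>
  define S where "S s h = ((1 / (2 * of_real r)) * s) *\<^sub>C (T h + (s * s) *\<^sub>C adj T h)" for s :: complex and h
  have S: "\<exists>b. norm b \<le> 3 \<and> (\<forall>h. \<pi> b h = S s h)" if s: "s = 1 \<or> s = \<i>" for s
  proof (rule bicommutant_sa)
    show "bounded_clinear (S s)"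
      unfolding S_def by (intro bcl_cmult bcl_plus T bcl_adj)
    show "cinner (S s h) k = cinner h (S s k)" for h k
      using s by (auto simp: S_def cinner_scaleC_left cinner_scaleC_right cinner_add_left
          cinner_add_right adj_left[OF T] adj_right[OF T] algebra_simps)
    show "norm (S s h) \<le> norm h" for h
    proof -
      have "norm (T h + (s * s) *\<^sub>C adj T h) \<le> r * norm h + r * norm h"
        using s r(2)[of h] na[of h] by (intro norm_triangle_le add_mono) (auto simp: norm_scaleC)
      then have "(1 / (2 * r)) * norm (T h + (s * s) *\<^sub>C adj T h) \<le> (1 / (2 * r)) * (2 * r * norm h)"
        using r0 by (intro mult_left_mono) auto
      moreover have "norm (S s h) = (1 / (2 * r)) * norm (T h + (s * s) *\<^sub>C adj T h)"
        using s r0 by (auto simp: S_def norm_scaleC norm_mult norm_divide)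
      ultimately show ?thesis using r0 by simp
    qed
    show "y (S s h) = S s (y h)" if y: "y \<in> commutant" for y h
    proof -
      have yb: "bounded_clinear y" using y by (simp add: commutant_def)
      show ?thesis by (simp add: S_def bcl_scaleC[OF yb] bcl_add[OF yb] ac[OF y] comm[OF y])
    qed
  qed
  obtain b c where b: "norm b \<le> 3" "\<And>h. \<pi> b h = S 1 h" and c: "norm c \<le> 3" "\<And>h. \<pi> c h = S \<i> h"
    using S[of 1] S[of \<i>] by blast
  define a where "a = of_real r *\<^sub>C (b + (- \<i>) *\<^sub>C c)"
  have "norm (b + (- \<i>) *\<^sub>C c) \<le> 6"
    using norm_triangle_ineq[of b "(- \<i>) *\<^sub>C c"] b c by (simp only: norm_scaleC) simp
  then have "norm a \<le> 6 * r"
    using r0 mult_left_mono[of "norm (b + (- \<i>) *\<^sub>C c)" 6 r] by (simp add: a_def norm_scaleC)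
  moreover have "\<pi> a h = T h" for h
  proof -
    have "\<pi> a h = of_real r *\<^sub>C (S 1 h + (- \<i>) *\<^sub>C S \<i> h)"
      by (simp only: a_def scaleC add b c)
    also have "\<dots> = (of_real r * (1 / (2 * of_real r))) *\<^sub>C (T h + adj T h)
        + (of_real r * (1 / (2 * of_real r))) *\<^sub>C (T h - adj T h)"
      by (simp add: S_def scaleC_scaleC scaleC_add_right scaleC_one)
    also have "\<dots> = (1/2) *\<^sub>C (2 *\<^sub>C T h)"
      using r0 scaleC_add_left[of 1 1 "T h"]
      by (simp add: scaleC_add_right[symmetric] scaleC_one del: cvs.scale_scale)
    finally show ?thesis by (simp add: scaleC_scaleC scaleC_one)
  qed
  ultimately show ?thesis by blast
qed

text \<open>The preimage delivered by \<open>bicommutant\<close> is a itself by injectivity, so its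
  norm bound applies to a. This weak form of isometry of \<pi> suffices for estimates of powers and
  for uniform bounds.\<close>

lemma rep_norm_lower:
  assumes "r \<ge> 0" "\<And>h. norm (\<pi> a h) \<le> r * norm h"
  shows "norm a \<le> 6 * r"
proof -
  have "\<exists>b. norm b \<le> 6 * r \<and> (\<forall>h. \<pi> b h = \<pi> a h)"
    by (rule bicommutant[OF bcl assms]) (simp add: commutant_def)
  then show ?thesis using rep_inj by metis
qed

text \<open>The projection onto L commutes with the commutant, hence is \<pi> q for some q; as it
  also commutes with \<pi> M, the element q is central and so a scalar.\<close>

lemma trivial_reducing:
  assumes L: "csubspace L" "closed L"
    and \<pi>L: "\<And>a h. h \<in> L \<Longrightarrow> \<pi> a h \<in> L"
    and cL: "\<And>y h. y \<in> commutant \<Longrightarrow> h \<in> L \<Longrightarrow> y h \<in> L"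
  shows "L = {0} \<or> L = UNIV"
proof -
  have p\<pi>: "proj L (\<pi> a h) = \<pi> a (proj L h)" for a h
    by (rule proj_commute[OF L star bcl \<pi>L \<pi>L])
  have pc: "proj L (y h) = y (proj L h)" if y: "y \<in> commutant" for y h
  proof (rule proj_commute[OF L])
    have yb: "bounded_clinear y" using y by (simp add: commutant_def)
    then show "bounded_clinear y" .
    show "cinner (y h) k = cinner h (adj y k)" for h k by (rule adj_right[OF yb, symmetric])
  qed (use cL y adj_commutant in auto)
  note pb = bcl_proj[OF L]
  have "\<exists>b. norm b \<le> 6 * onorm (proj L) \<and> (\<forall>h. \<pi> b h = proj L h)"
    by (rule bicommutant[OF pb onorm_pos_le[OF bounded_clinear_bl[OF pb]] bcl_norm[OF pb]])
      (simp add: pc)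
  then obtain q where q: "\<And>h. \<pi> q h = proj L h" by blast
  have "q * a = a * q" for a
    by (rule rep_inj) (simp add: mult q p\<pi>)
  then have "q \<in> center" by (simp add: center_def)
  then obtain c where c: "q = c *\<^sub>C 1" using factor by blast
  have pl: "proj L h = c *\<^sub>C h" for h
    using q[of h] by (simp add: c scaleC one)
  show ?thesis
  proof (cases "c = 0")
    case True
    have "h = 0" if "h \<in> L" for h
      using proj_fix[OF L that] pl[of h] True by simp
    then show ?thesis using L(1) cvs.subspace_0 by blast
  next
    case False
    have "h \<in> L" for h
    proof -
      have "c *\<^sub>C h \<in> L" using proj_in[OF L, of h] by (simp add: pl)
      then have "(1 / c) *\<^sub>C c *\<^sub>C h \<in> L" by (rule cvs.subspace_scale[OF L(1)])
      then show ?thesis using False by (simp add: scaleC_scaleC scaleC_one)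
    qed
    then show ?thesis by blast
  qed
qed

end

section \<open>Positivity and intertwiners\<close>

lemma positive_form_Cauchy_Schwarz:
  assumes S: "bounded_clinear S" and S_sa: "\<And>h k. cinner (S h) k = cinner h (S (k::'h::complex_hilbert))"
    and pos: "\<And>h. 0 \<le> Re (cinner h (S h))"
  shows "((norm (S h))\<^sup>2)\<^sup>2 \<le> Re (cinner (S h) (S (S h))) * Re (cinner h (S h))"
proof -
  have "(cmod (cinner (S h) (S h)))\<^sup>2 \<le> Re (cinner (S h) (S (S h))) * Re (cinner h (S h))"
  proof (rule form_Cauchy_Schwarz[where B = "\<lambda>x y. cinner x (S y)"])
    show "cinner x (S y) = cnj (cinner y (S x))" for x y
      unfolding S_sa[of y x, symmetric] by (rule cinner_commute)
  qed (simp_all only: bcl_add[OF S] bcl_scaleC[OF S] cinner_add_right cinner_scaleC_right pos)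
  then show ?thesis by (simp add: cinner_norm norm_power)
qed

lemma positive_vanishes:
  assumes S: "bounded_clinear S" and S_sa: "\<And>h k. cinner (S h) k = cinner h (S (k::'h::complex_hilbert))"
    and pos: "\<And>h. 0 \<le> Re (cinner h (S h))" and "Re (cinner h (S h)) = 0"
  shows "S h = 0"
  using positive_form_Cauchy_Schwarz[OF S S_sa pos, of h] assms(4) by simp

text \<open>Cauchy-Schwarz for the form of S at the vectors S h and h, divided by the square of
  \<open>norm (S h)\<close>. In operator terms this is S^2 \<le> q S, obtained without a square root
  of S.\<close>

lemma positive_norm_sq_le:
  assumes S: "bounded_clinear S" and S_sa: "\<And>h k. cinner (S h) k = cinner h (S (k::'h::complex_hilbert))"
    and pos: "\<And>h. 0 \<le> Re (cinner h (S h))" and le: "\<And>h. Re (cinner h (S h)) \<le> q * (norm h)\<^sup>2"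
  shows "(norm (S h))\<^sup>2 \<le> q * Re (cinner h (S h))"
proof (cases "S h = 0")
  case False
  have "(norm (S h))\<^sup>2 * (norm (S h))\<^sup>2 \<le> Re (cinner (S h) (S (S h))) * Re (cinner h (S h))"
    using positive_form_Cauchy_Schwarz[OF S S_sa pos, of h] by (simp add: power2_eq_square)
  also have "\<dots> \<le> q * (norm (S h))\<^sup>2 * Re (cinner h (S h))"
    by (rule mult_right_mono[OF le pos])
  finally have "(norm (S h))\<^sup>2 * (norm (S h))\<^sup>2 \<le> (norm (S h))\<^sup>2 * (q * Re (cinner h (S h)))"
    by (simp add: mult_ac)
  then show ?thesis using False by (subst (asm) mult_le_cancel_left_pos) auto
qed simp

lemma positive_norm_le:
  assumes S: "bounded_clinear S" and S_sa: "\<And>h k. cinner (S h) k = cinner h (S (k::'h::complex_hilbert))"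
    and pos: "\<And>h. 0 \<le> Re (cinner h (S h))" and le: "\<And>h. Re (cinner h (S h)) \<le> q * (norm h)\<^sup>2"
    and q: "0 \<le> q"
  shows "norm (S h) \<le> q * norm h"
proof -
  have "(norm (S h))\<^sup>2 \<le> q * Re (cinner h (S h))"
    by (rule positive_norm_sq_le[OF S S_sa pos le])
  also have "\<dots> \<le> q * (q * (norm h)\<^sup>2)" by (rule mult_left_mono[OF le q])
  also have "\<dots> = (q * norm h)\<^sup>2" by (simp add: power2_eq_square)
  finally show ?thesis by (rule power2_le_imp_le) (use q in simp)
qed

section \<open>Automorphisms, order and the existence of intertwiners\<close>

locale automorphism =
  fixes \<beta> :: "'m::cstar_algebra \<Rightarrow> 'm"
  assumes \<beta>: "star_automorphism \<beta>"
begin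

lemma \<beta>_bij: "bij \<beta>"
  and \<beta>_add: "\<beta> (a + b) = \<beta> a + \<beta> b"
  and \<beta>_scaleC: "\<beta> (c *\<^sub>C a) = c *\<^sub>C \<beta> a"
  and \<beta>_mult: "\<beta> (a * b) = \<beta> a * \<beta> b"
  and \<beta>_star: "\<beta> (a\<^sup>\<star>) = (\<beta> a)\<^sup>\<star>"
  using \<beta> by (auto simp: star_automorphism_def)

lemma \<beta>_inj: "\<beta> a = \<beta> b \<Longrightarrow> a = b"
  using \<beta>_bij by (meson bij_is_inj injD)

lemma \<beta>_zero [simp]: "\<beta> 0 = 0"
  using \<beta>_scaleC[of 0 0] by simp

lemma \<beta>_diff: "\<beta> (a - b) = \<beta> a - \<beta> b"
  using \<beta>_add[of a "(- 1) *\<^sub>C b"] \<beta>_scaleC[of "- 1" b] by simp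

lemma \<beta>_one [simp]: "\<beta> 1 = 1"
proof -
  obtain e where "\<beta> e = 1" using \<beta>_bij by (metis bij_pointE)
  then show ?thesis using \<beta>_mult[of e 1] by simp
qed

lemma inv_\<beta>: "\<beta> (inv \<beta> a) = a" "inv \<beta> (\<beta> a) = a"
  using \<beta>_bij by (simp_all add: bij_is_surj surj_f_inv_f bij_is_inj)

lemma star_automorphism_inv: "star_automorphism (inv \<beta>)"
  unfolding star_automorphism_def
proof (intro conjI allI)
  show "bij (inv \<beta>)" using \<beta>_bij by (rule bij_imp_bij_inv)
qed (rule \<beta>_inj, simp only: \<beta>_add \<beta>_scaleC \<beta>_mult \<beta>_star inv_\<beta>)+

lemma star_rep_compose:
  assumes "star_rep \<sigma>"
  shows "star_rep (\<lambda>a. \<sigma> (\<beta> a))"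
proof -
  interpret star_rep \<sigma> by (rule assms)
  show ?thesis
    by standard (simp_all add: bcl \<beta>_add add \<beta>_scaleC scaleC \<beta>_mult mult star \<beta>_star one)
qed

end

lemma star_automorphism_compose:
  assumes "star_automorphism \<alpha>" "star_automorphism \<beta>"
  shows "star_automorphism (\<lambda>a. \<alpha> (\<beta> a))"
  using assms bij_comp[of \<beta> \<alpha>] by (simp add: star_automorphism_def comp_def)

lemma star_automorphism_funpow:
  assumes "star_automorphism \<alpha>"
  shows "star_automorphism (\<alpha> ^^ n)"
proof (induction n)
  case 0
  then show ?case by (simp add: star_automorphism_def bij_def)
next
  case (Suc n)
  then show ?case
    using star_automorphism_compose[OF assms Suc] by (simp add: comp_def)
qed

context factor_rep
begin

text \<open>The order determined by a faithful representation is determined by the algebra.\<close>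

lemma positive_transport:
  assumes x: "x\<^sup>\<star> = x" and pos: "\<And>h. 0 \<le> Re (cinner h (\<pi> x h))" and \<tau>: "star_rep \<tau>"
  shows "0 \<le> Re (cinner h (\<tau> x h))"
proof -
  interpret \<tau>: star_rep \<tau> by (rule \<tau>)
  have *: "0 \<le> Re (cinner h (\<tau> x h)) + \<delta> * (norm h)\<^sup>2" if \<delta>: "0 < \<delta>" "\<delta> \<le> 1" for \<delta>
  proof -
    define l where "l = norm x + 2"
    have l: "l > 0" "norm x + \<delta> \<le> l" using \<delta> by (auto simp: l_def intro: add_nonneg_pos)
    \<comment> \<open>After scaling, the form of z = 1 - y lies between 0 and q < 1. The factor 6 of
      \<open>rep_norm_lower\<close> is absorbed by the power 2^k, so \<open>norm z < 1\<close>; then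
      y is the square of a self-adjoint element, hence positive in every representation.\<close>
    define y where "y = (1 / l) *\<^sub>R (x + \<delta> *\<^sub>R 1)"
    define z where "z = 1 - y"
    define q where "q = 1 - \<delta> / l"
    have "\<delta> \<le> l" using l(2) norm_ge_zero[of x] by linarith
    then have q: "0 \<le> q" "q < 1"
      using l(1) \<delta> by (simp_all add: q_def)
    have zs: "z\<^sup>\<star> = z" by (simp add: z_def y_def star_diff star_scaleR star_add x)
    have form: "Re (cinner g (\<pi> z g)) = (norm g)\<^sup>2 - (Re (cinner g (\<pi> x g)) + \<delta> * (norm g)\<^sup>2) / l" for g
      by (simp add: z_def y_def diff one scaleR add cinner_diff_right cinner_scaleR_right
          cinner_add_right Re_cinner_self)
    have nz: "norm (\<pi> z g) \<le> q * norm g" for g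
    proof (rule positive_norm_le[OF bcl star_sa[OF zs] _ _ q(1)])
      fix g
      have "Re (cinner g (\<pi> x g)) \<le> norm g * norm (\<pi> x g)"
        using complex_Re_le_cmod cinner_Cauchy_Schwarz order.trans by blast
      also have "\<dots> \<le> norm g * (norm x * norm g)" by (rule mult_left_mono[OF contractive]) simp
      finally have "Re (cinner g (\<pi> x g)) + \<delta> * (norm g)\<^sup>2 \<le> (norm x + \<delta>) * (norm g)\<^sup>2"
        by (simp add: power2_eq_square algebra_simps)
      also have "\<dots> \<le> l * (norm g)\<^sup>2" using l(2) by (rule mult_right_mono) simp
      finally show "0 \<le> Re (cinner g (\<pi> z g))"
        using l(1) by (simp add: form divide_le_eq mult.commute)
      have "0 \<le> Re (cinner g (\<pi> x g)) / l" using pos l(1) by simp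
      then show "Re (cinner g (\<pi> z g)) \<le> q * (norm g)\<^sup>2"
        by (simp add: form q_def add_divide_distrib algebra_simps)
    qed
    have nzn: "norm (\<pi> (z ^ n) g) \<le> q ^ n * norm g" for n g
    proof (induction n arbitrary: g)
      case 0
      then show ?case by (simp add: one)
    next
      case (Suc n)
      have "norm (\<pi> (z ^ Suc n) g) \<le> q * norm (\<pi> (z ^ n) g)"
        by (simp add: mult nz)
      also have "\<dots> \<le> q * (q ^ n * norm g)" by (rule mult_left_mono[OF Suc q(1)])
      finally show ?case by (simp add: mult.assoc)
    qed
    obtain k where k: "q ^ k < 1 / 6"
      using real_arch_pow_inv[of "1/6" q] q by auto
    have "q ^ (2 ^ k) \<le> q ^ k"
      using q less_imp_le[OF less_exp[of k]] by (intro power_decreasing) auto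
    then have "6 * q ^ (2 ^ k) < 1" using k by simp
    moreover have "norm (z ^ 2 ^ k) \<le> 6 * q ^ (2 ^ k)"
      by (rule rep_norm_lower[OF _ nzn]) (use q in simp)
    ultimately have "norm z ^ 2 ^ k < 1 ^ 2 ^ k"
      by (simp add: norm_sa_power[OF zs])
    then have "norm z < 1" by (rule power_less_imp_less_base) simp
    from sqrt_exists[OF zs this] obtain c where c: "c\<^sup>\<star> = c" "c * c = y"
      by (auto simp: z_def)
    have "cinner h (\<tau> y h) = cinner (\<tau> c h) (\<tau> c h)"
      unfolding c(2)[symmetric] \<tau>.mult by (rule \<tau>.star_sa[OF c(1), symmetric])
    then have "Re (cinner h (\<tau> y h)) = (norm (\<tau> c h))\<^sup>2"
      by (simp add: Re_cinner_self)
    then have "0 \<le> Re (cinner h (\<tau> y h))" by simp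
    also have "Re (cinner h (\<tau> y h)) = (Re (cinner h (\<tau> x h)) + \<delta> * (norm h)\<^sup>2) / l"
      by (simp add: y_def \<tau>.one \<tau>.scaleR \<tau>.add cinner_scaleR_right cinner_add_right Re_cinner_self)
    finally show ?thesis using l(1) by (simp add: zero_le_divide_iff)
  qed
  show ?thesis
  proof (rule ccontr)
    assume n: "\<not> ?thesis"
    define r where "r = - Re (cinner h (\<tau> x h))"
    define s where "s = (norm h)\<^sup>2 + r"
    have "r > 0" using n by (simp add: r_def)
    then have r: "r > 0" "s > 0" "r \<le> s" "(norm h)\<^sup>2 < s"
      by (simp_all add: s_def add_nonneg_pos)
    have "0 \<le> Re (cinner h (\<tau> x h)) + r / s * (norm h)\<^sup>2"
      by (rule *) (use r in simp_all)
    then have "r \<le> r / s * (norm h)\<^sup>2" unfolding r_def by linarith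
    also have "\<dots> < r / s * s" using r by (intro mult_strict_left_mono) auto
    finally show False using r by simp
  qed
qed

definition intertwiners :: "('m \<Rightarrow> 'm) \<Rightarrow> ('h \<Rightarrow> 'h) set"
  where "intertwiners \<beta> = {Z. bounded_clinear Z \<and> (\<forall>a h. Z (\<pi> a h) = \<pi> (\<beta> a) (Z h))}"

text \<open>Without nonzero intertwiners the commutation condition of \<open>Kaplansky\<close> for
  the pair \<pi>, \<pi> \<circ> \<beta> concerns only the diagonal, so that two different scalars
  can be approximated simultaneously.\<close>

lemma separating_elements:
  assumes \<beta>: "star_automorphism \<beta>" and triv: "\<And>Z h. Z \<in> intertwiners \<beta> \<Longrightarrow> Z h = 0" and e: "e > 0"
  shows "\<exists>a. a\<^sup>\<star> = a \<and> norm a \<le> 2 \<and> norm (\<pi> a u - u) < e \<and> norm (\<pi> (\<beta> a) w) < e"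
proof -
  interpret \<beta>: automorphism \<beta> by standard (rule \<beta>)
  define \<sigma> where "\<sigma> i = (if i = 0 then \<pi> else (\<lambda>a. \<pi> (\<beta> a)))" for i :: nat
  \<comment> \<open>The function 4 t / (4 + t^2) is 1 at t = 2 and 0 at t = 0. The factors 1/8 and
    1/4 in \<open>v'\<close> are the values of 1 / (4 + t^2) there.\<close>
  define T where "T i h = (if i = 0 then 2 *\<^sub>C h else 0)" for i :: nat and h :: 'h
  define v where "v i = (if i = 0 then u else w)" for i :: nat
  define v' where "v' i = (if i = 0 then (1/8) *\<^sub>C u else (1/4) *\<^sub>C w)" for i :: nat
  have ex: "\<exists>a. a\<^sup>\<star> = a \<and> norm a \<le> 2 \<and> (\<forall>i<2. norm (\<sigma> i a (v i) - 4 *\<^sub>C T i (v' i)) < e)"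
  proof (rule Kaplansky[where \<sigma> = \<sigma> and T = T and u = v'])
    show "star_rep (\<sigma> i)" for i
      by (simp add: \<sigma>_def star_rep_axioms \<beta>.star_rep_compose)
    show "bounded_clinear (T i)" for i
    proof -
      have "T i = (if i = 0 then (\<lambda>h. 2 *\<^sub>C h) else (\<lambda>h. 0))" by (auto simp: T_def)
      then show ?thesis by (simp add: bcl_cmult[OF bcl_id]) (simp add: bounded_clinear_def)
    qed
    show "cinner (T i h) k = cinner h (T i k)" for i h k
      by (simp add: T_def cinner_scaleC_left cinner_scaleC_right)
    show "T i (T i (v' i)) + 4 *\<^sub>C v' i = v i" for i
      by (simp add: T_def v'_def v_def scaleC_scaleC cvs.scale_left_distrib[symmetric] scaleC_one)
    show "y (T j h) = T i (y h)"
      if y: "bounded_clinear y" and c: "\<And>a h. y (\<sigma> j a h) = \<sigma> i a (y h)" for i j y h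
    proof -
      have 0: "y g = 0" if "i \<noteq> 0" "j = 0" for g
      proof (rule triv[of y])
        show "y \<in> intertwiners \<beta>"
          using c that y by (simp add: intertwiners_def \<sigma>_def)
      qed
      \<comment> \<open>The adjoint of an operator intertwining in the opposite direction lies in
        \<open>intertwiners \<beta>\<close>.\<close>
      have 1: "y g = 0" if "i = 0" "j \<noteq> 0" for g
      proof -
        have yc: "y (\<pi> (\<beta> a) h) = \<pi> a (y h)" for a h
          using c[of a h] that by (simp add: \<sigma>_def)
        have "adj y \<in> intertwiners \<beta>"
          unfolding intertwiners_def
        proof (intro CollectI conjI allI bcl_adj y cinner_ext)
          fix a h k
          have "cinner k (adj y (\<pi> a h)) = cinner (\<pi> (a\<^sup>\<star>) (y k)) h"
            by (simp add: adj_right[OF y] star star_star)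
          also have "\<dots> = cinner (\<pi> ((\<beta> a)\<^sup>\<star>) k) (adj y h)"
            by (simp add: adj_right[OF y] yc[symmetric] \<beta>.\<beta>_star)
          finally show "cinner k (adj y (\<pi> a h)) = cinner k (\<pi> (\<beta> a) (adj y h))"
            by (simp add: star star_star)
        qed
        then have "adj y k = 0" for k by (rule triv[of "adj y"])
        then have "cinner k (y g) = cinner k 0" for k
          by (simp add: adj_left[OF y, symmetric])
        then show ?thesis by (rule cinner_ext)
      qed
      show ?thesis
        using 0 1 by (cases "i = 0"; cases "j = 0") (simp_all add: T_def bcl_0[OF y] bcl_scaleC[OF y])
    qed
  qed (rule e)
  then obtain a where a: "a\<^sup>\<star> = a" "norm a \<le> 2" "\<And>i. i < 2 \<Longrightarrow> norm (\<sigma> i a (v i) - 4 *\<^sub>C T i (v' i)) < e"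
    by blast
  show ?thesis
    using a(1,2) a(3)[of 0] a(3)[of 1]
    by (intro exI[of _ a]) (simp add: \<sigma>_def v_def T_def v'_def scaleC_scaleC scaleC_one)
qed

text \<open>\<pi> p is the projection onto the closure of the commutant applied to h; an operator
  \<pi> E that kills h kills this subspace. The conclusion is purely algebraic, so that it can be
  transported by an automorphism.\<close>

lemma cyclic_support:
  assumes "h \<noteq> 0"
  obtains p where "p \<noteq> 0" "\<And>E. \<pi> E h = 0 \<Longrightarrow> E * p = 0"
proof -
  define L0 where "L0 = (\<lambda>y. y h) ` commutant"
  have "csubspace L0"
    unfolding cvs.subspace_def L0_def
  proof (intro conjI ballI allI)
    have "(\<lambda>_. 0) \<in> commutant"
      by (simp add: commutant_def bounded_clinear_def bcl_0[OF bcl])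
    then show "0 \<in> (\<lambda>y. y h) ` commutant" by (rule rev_image_eqI) simp
    show "u + v \<in> (\<lambda>y. y h) ` commutant"
      if uv: "u \<in> (\<lambda>y. y h) ` commutant" "v \<in> (\<lambda>y. y h) ` commutant" for u v
    proof -
      obtain y z where yz: "u = y h" "v = z h" "y \<in> commutant" "z \<in> commutant"
        using uv by blast
      then have "(\<lambda>h. y h + z h) \<in> commutant"
        by (simp add: commutant_def bcl_plus bcl_add[OF bcl])
      then show ?thesis by (rule rev_image_eqI) (simp add: yz)
    qed
    show "c *\<^sub>C u \<in> (\<lambda>y. y h) ` commutant" if u: "u \<in> (\<lambda>y. y h) ` commutant" for c u
    proof -
      obtain y where y: "u = y h" "y \<in> commutant" using u by blast
      then have "(\<lambda>h. c *\<^sub>C y h) \<in> commutant"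
        by (simp add: commutant_def bcl_cmult bcl_scaleC[OF bcl])
      then show ?thesis by (rule rev_image_eqI) (simp add: y)
    qed
  qed
  then have sL: "csubspace (closure L0)" by (rule csubspace_closure)
  have inv: "y g \<in> closure L0" if y: "y \<in> commutant" and g: "g \<in> closure L0" for y g
  proof -
    have yb: "bounded_clinear y" using y by (simp add: commutant_def)
    have "y ` closure L0 \<subseteq> closure (y ` L0)"
      by (rule continuous_image_closure_subset[OF bcl_continuous_on[OF yb continuous_on_id] subset_UNIV])
    also have "\<dots> \<subseteq> closure L0"
    proof (rule closure_mono, clarsimp simp: L0_def)
      fix z assume "z \<in> commutant"
      then have "(\<lambda>h. y (z h)) \<in> commutant"
        using y by (simp add: commutant_def bcl_compose)
      then show "y (z h) \<in> (\<lambda>y. y h) ` commutant" by (rule rev_image_eqI) simp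
    qed
    finally show ?thesis using g by blast
  qed
  define Q where "Q = proj (closure L0)"
  have Qb: "bounded_clinear Q" unfolding Q_def by (rule bcl_proj[OF sL closed_closure])
  have Qc: "y (Q g) = Q (y g)" if y: "y \<in> commutant" for y g
  proof -
    have yb: "bounded_clinear y" using y by (simp add: commutant_def)
    show ?thesis
      unfolding Q_def
      by (rule sym, rule proj_commute[OF sL closed_closure adj_right[OF yb, symmetric] yb
            inv[OF y] inv[OF adj_commutant[OF y]]])
  qed
  obtain p where p: "\<And>g. \<pi> p g = Q g"
    using bicommutant[OF Qb onorm_pos_le[OF bounded_clinear_bl[OF Qb]] bcl_norm[OF Qb] Qc] by blast
  have "h \<in> L0"
    unfolding L0_def by (rule rev_image_eqI[of "\<lambda>h. h"]) (simp_all add: commutant_def bcl_id)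
  then have Qh: "Q h = h"
    unfolding Q_def by (intro proj_fix[OF sL closed_closure] subsetD[OF closure_subset])
  have "p \<noteq> 0" using p[of h] Qh assms by (auto simp: zero)
  moreover have "E * p = 0" if E: "\<pi> E h = 0" for E
  proof (rule rep_inj)
    fix g
    have "closed {g. \<pi> E g = 0}"
      by (rule closed_Collect_eq[OF bcl_continuous_on[OF bcl continuous_on_id] continuous_on_const])
    moreover have "L0 \<subseteq> {g. \<pi> E g = 0}"
    proof
      fix g assume "g \<in> L0"
      then obtain y where y: "g = y h" "y \<in> commutant" by (auto simp: L0_def)
      then have "\<pi> E g = y (\<pi> E h)" by (simp add: commutant_def)
      also have "\<dots> = 0" using y bcl_0[of y] by (simp add: E commutant_def)
      finally show "g \<in> {g. \<pi> E g = 0}" by simp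
    qed
    ultimately have "closure L0 \<subseteq> {g. \<pi> E g = 0}" by (rule closure_minimal[rotated])
    then show "\<pi> (E * p) g = \<pi> 0 g"
      using proj_in[OF sL closed_closure, of g] by (auto simp: mult p zero Q_def)
  qed
  ultimately show ?thesis using that by blast
qed

text \<open>Automorphisms of \<open>W\<^sup>*\<close>-algebras are normal. Here normality enters in the following form: if
  there were no nonzero intertwiners, then \<open>1\<close> and \<open>0\<close> would be simultaneously approximated, at given
  vectors, by \<open>\<pi> a\<close> and \<open>\<pi> (\<beta> a)\<close>. This yields a decreasing sequence \<open>x\<^sub>m\<close> of positive contractions
  such that \<open>\<pi> (x\<^sub>m)\<close> tends to \<open>0\<close> at a vector and \<open>\<pi> (\<beta> (x\<^sub>m))\<close> does not. The contradiction comes from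
  the infimum of the \<open>\<beta> (x\<^sub>m)\<close>, which \<open>\<beta>\<^sup>-\<^sup>1\<close> maps to a lower bound of the \<open>x\<^sub>m\<close>.\<close>

lemma exists_intertwiner:
  assumes \<beta>: "star_automorphism \<beta>"
  shows "\<exists>Z h. Z \<in> intertwiners \<beta> \<and> Z h \<noteq> 0"
proof (rule ccontr)
  assume "\<not> ?thesis"
  then have triv: "\<And>Z h. Z \<in> intertwiners \<beta> \<Longrightarrow> Z h = 0" by blast
  interpret \<beta>: automorphism \<beta> by standard (rule \<beta>)
  interpret \<pi>\<beta>: star_rep "\<lambda>a. \<pi> (\<beta> a)" by (rule \<beta>.star_rep_compose[OF star_rep_axioms])
  obtain h :: 'h where "h \<noteq> 0" using nontrivial by blast
  then obtain p where p: "p \<noteq> 0" "\<And>E. \<pi> E h = 0 \<Longrightarrow> E * p = 0" using cyclic_support by blast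
  have "\<beta> p \<noteq> 0" using p(1) \<beta>.\<beta>_inj[of p 0] by auto
  then obtain k0 where k0: "\<pi> (\<beta> p) k0 \<noteq> 0" using rep_inj[of "\<beta> p" 0] by (auto simp: zero)
  \<comment> \<open>The vector k lies in the range of \<pi> (\<beta> p), so that an element
    annihilating \<beta> p from the left annihilates k.\<close>
  define k where "k = \<pi> (\<beta> p) k0"
  have k: "norm k > 0" using k0 by (simp add: k_def)
  define unit where "unit x \<longleftrightarrow> x\<^sup>\<star> = x \<and> (\<forall>v. 0 \<le> Re (cinner v (\<pi> x v)) \<and> Re (cinner v (\<pi> x v)) \<le> (norm v)\<^sup>2) \<and>
    (\<forall>v. 0 \<le> Re (cinner v (\<pi> (\<beta> x) v)) \<and> Re (cinner v (\<pi> (\<beta> x) v)) \<le> (norm v)\<^sup>2)" for x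
  \<comment> \<open>When \<open>norm a \<le> 2\<close>, the subtracted term is at most 4 x^2 / 8,
    hence at most x / 2, which keeps \<open>x'\<close> positive. At h it is about the square of
    \<open>norm (\<pi> x h)\<close> over 8; at k, under \<pi> \<circ> \<beta>, it is very
    small.\<close>
  define rel where "rel m x x' \<longleftrightarrow> (\<exists>a. x' = x - (1/8) *\<^sub>R (x * (a * (a * x))) \<and> a\<^sup>\<star> = a \<and>
    norm (\<pi> a (\<pi> x h) - \<pi> x h) < 1 / real (Suc m) \<and> norm (\<pi> (\<beta> a) (\<pi> (\<beta> x) k)) < norm k / 2 ^ Suc m)" for m x x'
  have drop: "Re (cinner v (\<sigma> (x - (1/8) *\<^sub>R (x * (a * (a * x)))) v))
      = Re (cinner v (\<sigma> x v)) - (norm (\<sigma> a (\<sigma> x v)))\<^sup>2 / 8"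
    if "star_rep \<sigma>" "x\<^sup>\<star> = x" "a\<^sup>\<star> = a" for \<sigma> :: "'m \<Rightarrow> 'h \<Rightarrow> 'h" and x a v
  proof -
    interpret \<sigma>: star_rep \<sigma> by fact
    have "cinner v (\<sigma> (x * (a * (a * x))) v) = cinner (\<sigma> a (\<sigma> x v)) (\<sigma> a (\<sigma> x v))"
      by (simp only: \<sigma>.mult \<sigma>.star_sa[OF that(2)] \<sigma>.star_sa[OF that(3)])
    then show ?thesis
      by (simp add: \<sigma>.diff \<sigma>.scaleR cinner_diff_right cinner_scaleR_right Re_cinner_self)
  qed
  have drop_unit: "0 \<le> Re (cinner v (\<sigma> x v)) - (norm (\<sigma> a (\<sigma> x v)))\<^sup>2 / 8"
    if \<sigma>: "star_rep \<sigma>" and x: "x\<^sup>\<star> = x" "\<And>v. 0 \<le> Re (cinner v (\<sigma> x v)) \<and> Re (cinner v (\<sigma> x v)) \<le> (norm v)\<^sup>2"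
      and a: "norm a \<le> 2" for \<sigma> :: "'m \<Rightarrow> 'h \<Rightarrow> 'h" and x a v
  proof -
    interpret \<sigma>: star_rep \<sigma> by fact
    have "(norm (\<sigma> x v))\<^sup>2 \<le> 1 * Re (cinner v (\<sigma> x v))"
      by (rule positive_norm_sq_le[OF \<sigma>.bcl \<sigma>.star_sa[OF x(1)]]) (use x(2) in auto)
    moreover have "(norm (\<sigma> a (\<sigma> x v)))\<^sup>2 \<le> (2 * norm (\<sigma> x v))\<^sup>2"
      using order.trans[OF \<sigma>.contractive mult_right_mono[OF a norm_ge_zero]] by (rule power_mono) simp
    moreover have "0 \<le> Re (cinner v (\<sigma> x v))" using x(2) by blast
    ultimately show ?thesis by (simp add: power_mult_distrib)
  qed
  have step: "\<exists>x'. unit x' \<and> rel m x x'" if x: "unit x" for m x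
  proof -
    define \<epsilon> where "\<epsilon> = min (1 / real (Suc m)) (norm k / 2 ^ Suc m)"
    have "\<epsilon> > 0" using k by (simp add: \<epsilon>_def)
    then obtain a where a: "a\<^sup>\<star> = a" "norm a \<le> 2" "norm (\<pi> a (\<pi> x h) - \<pi> x h) < \<epsilon>"
      "norm (\<pi> (\<beta> a) (\<pi> (\<beta> x) k)) < \<epsilon>"
      using separating_elements[of \<beta> \<epsilon> "\<pi> x h" "\<pi> (\<beta> x) k"] \<beta> triv by blast
    define x' where "x' = x - (1/8) *\<^sub>R (x * (a * (a * x)))"
    have xs: "x\<^sup>\<star> = x" using x by (simp add: unit_def)
    have "x'\<^sup>\<star> = x'" by (simp add: x'_def star_diff star_scaleR star_mult xs a(1) mult.assoc)
    moreover have "0 \<le> Re (cinner v (\<pi> x' v)) \<and> Re (cinner v (\<pi> x' v)) \<le> (norm v)\<^sup>2" for v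
    proof -
      have u: "\<And>v. 0 \<le> Re (cinner v (\<pi> x v)) \<and> Re (cinner v (\<pi> x v)) \<le> (norm v)\<^sup>2"
        using x by (simp add: unit_def)
      have "0 \<le> (norm (\<pi> a (\<pi> x v)))\<^sup>2 / 8" by simp
      with drop_unit[OF star_rep_axioms xs u a(2), of v] u[of v] show ?thesis
        unfolding x'_def drop[OF star_rep_axioms xs a(1)] by linarith
    qed
    moreover have "0 \<le> Re (cinner v (\<pi> (\<beta> x') v)) \<and> Re (cinner v (\<pi> (\<beta> x') v)) \<le> (norm v)\<^sup>2" for v
    proof -
      have u: "\<And>v. 0 \<le> Re (cinner v (\<pi> (\<beta> x) v)) \<and> Re (cinner v (\<pi> (\<beta> x) v)) \<le> (norm v)\<^sup>2"
        using x by (simp add: unit_def)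
      have "0 \<le> (norm (\<pi> (\<beta> a) (\<pi> (\<beta> x) v)))\<^sup>2 / 8" by simp
      with drop_unit[OF \<pi>\<beta>.star_rep_axioms xs u a(2), of v] u[of v] show ?thesis
        unfolding x'_def drop[OF \<pi>\<beta>.star_rep_axioms xs a(1)] by linarith
    qed
    ultimately have "unit x'" by (simp add: unit_def)
    moreover have "rel m x x'"
      unfolding rel_def by (rule exI[of _ a]) (use a x'_def in \<open>simp add: \<epsilon>_def\<close>)
    ultimately show ?thesis by blast
  qed
  have "unit 1"
    by (simp add: unit_def one Re_cinner_self)
  have "\<exists>x. \<forall>n. (unit (x n) \<and> (n = 0 \<longrightarrow> x n = 1)) \<and> rel n (x n) (x (Suc n))"
  proof (rule dependent_nat_choice)
    show "\<exists>x. unit x \<and> (0 = (0::nat) \<longrightarrow> x = 1)" using \<open>unit 1\<close> by blast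
    show "\<exists>y. (unit y \<and> (Suc n = 0 \<longrightarrow> y = 1)) \<and> rel n x y"
      if "unit x \<and> (n = 0 \<longrightarrow> x = 1)" for x n
      using step[of x n] that by blast
  qed
  then obtain x where x: "\<And>n. unit (x n)" "x 0 = 1" "\<And>n. rel n (x n) (x (Suc n))" by blast
  have xs: "(x n)\<^sup>\<star> = x n" for n using x(1) by (simp add: unit_def)
  obtain a where a: "\<And>m. x (Suc m) = x m - (1/8) *\<^sub>R (x m * (a m * (a m * x m)))" "\<And>m. (a m)\<^sup>\<star> = a m"
    "\<And>m. norm (\<pi> (a m) (\<pi> (x m) h) - \<pi> (x m) h) < 1 / real (Suc m)"
    "\<And>m. norm (\<pi> (\<beta> (a m)) (\<pi> (\<beta> (x m)) k)) < norm k / 2 ^ Suc m"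
    using x(3) unfolding rel_def by metis
  define c where "c m = Re (cinner h (\<pi> (x m) h))" for m
  define d where "d v m = Re (cinner v (\<pi> (\<beta> (x m)) v))" for v m
  have c_step: "c (Suc m) = c m - (norm (\<pi> (a m) (\<pi> (x m) h)))\<^sup>2 / 8" for m
    unfolding c_def a(1) by (rule drop[OF star_rep_axioms xs a(2)])
  have d_step: "d v (Suc m) = d v m - (norm (\<pi> (\<beta> (a m)) (\<pi> (\<beta> (x m)) v)))\<^sup>2 / 8" for v m
    unfolding d_def a(1) by (rule drop[OF \<pi>\<beta>.star_rep_axioms xs a(2)])
  have c0: "c m \<ge> 0" for m using x(1) by (simp add: c_def unit_def)
  have d0: "d v m \<ge> 0" for v m using x(1) by (simp add: d_def unit_def)
  have "decseq c" by (rule decseq_SucI) (simp add: c_step)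
  have d_dec: "decseq (d v)" for v by (rule decseq_SucI) (simp add: d_step)
  obtain l where l: "c \<longlonglongrightarrow> l" using decseq_convergent[OF \<open>decseq c\<close>, of 0] c0 by blast
  \<comment> \<open>The numbers c m converge, so their differences, which are the squares of
    \<open>norm (\<pi> (a m) (\<pi> (x m) h))\<close> over 8, tend to 0.\<close>
  have "(\<lambda>m. sqrt (8 * (c m - c (Suc m))) + 1 / real (Suc m)) \<longlonglongrightarrow> sqrt (8 * (l - l)) + 0"
    by (intro tendsto_intros l LIMSEQ_Suc[OF l] LIMSEQ_Suc[OF lim_1_over_n])
  then have lim0: "(\<lambda>m. sqrt (8 * (c m - c (Suc m))) + 1 / real (Suc m)) \<longlonglongrightarrow> 0" by simp
  have \<pi>x: "(\<lambda>m. \<pi> (x m) h) \<longlonglongrightarrow> 0"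
  proof (rule Lim_null_comparison[OF always_eventually lim0], intro allI)
    fix m
    have "norm (\<pi> (x m) h) \<le> norm (\<pi> (a m) (\<pi> (x m) h)) + norm (\<pi> (a m) (\<pi> (x m) h) - \<pi> (x m) h)"
      using norm_triangle_ineq4[of "\<pi> (a m) (\<pi> (x m) h)" "\<pi> (a m) (\<pi> (x m) h) - \<pi> (x m) h"] by simp
    also have "norm (\<pi> (a m) (\<pi> (x m) h)) = sqrt (8 * (c m - c (Suc m)))"
      by (simp add: c_step)
    finally show "norm (\<pi> (x m) h) \<le> sqrt (8 * (c m - c (Suc m))) + 1 / real (Suc m)"
      using a(3)[of m] by linarith
  qed
  have c_lim: "c \<longlonglongrightarrow> 0"
    using tendsto_Re[OF tendsto_cinner[OF tendsto_const \<pi>x, of h]] by (simp add: c_def[abs_def])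
  \<comment> \<open>The loss at stage m is at most the square of \<open>norm k\<close> times the (m
    + 2)-th power of 1/2, so all losses together leave at least half of the initial value.\<close>
  have d_lower: "d k m \<ge> (norm k)\<^sup>2 * (1/2 + (1/2) ^ Suc m)" for m
  proof (induction m)
    case 0
    then show ?case by (simp add: d_def x Re_cinner_self one)
  next
    case (Suc m)
    have "(norm (\<pi> (\<beta> (a m)) (\<pi> (\<beta> (x m)) k)))\<^sup>2 \<le> (norm k / 2 ^ Suc m)\<^sup>2"
      using a(4)[of m] by (intro power_mono) auto
    also have "\<dots> = (norm k)\<^sup>2 * ((1/2) ^ Suc m * (1/2) ^ Suc m)"
      by (simp add: power_divide power2_eq_square power_one_over)
    also have "\<dots> \<le> (norm k)\<^sup>2 * ((1/2) ^ Suc m * 1)"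
      by (intro mult_left_mono power_le_one) auto
    finally have "(norm (\<pi> (\<beta> (a m)) (\<pi> (\<beta> (x m)) k)))\<^sup>2 \<le> (norm k)\<^sup>2 * (1/2) ^ Suc m"
      by (simp only: mult_1_right)
    moreover have "0 \<le> (norm k)\<^sup>2 * (1/2) ^ Suc m" by simp
    moreover have "(norm k)\<^sup>2 * (1/2) ^ Suc (Suc m) = (norm k)\<^sup>2 * (1/2) ^ Suc m / 2" by simp
    ultimately have "(norm (\<pi> (\<beta> (a m)) (\<pi> (\<beta> (x m)) k)))\<^sup>2 / 8 \<le> (norm k)\<^sup>2 * (1/2) ^ Suc (Suc m)"
      by linarith
    then show ?case using Suc by (simp add: d_step algebra_simps)
  qed
  have nb: "norm (\<beta> (x m)) \<le> 6 * 1" for m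
  proof (rule rep_norm_lower)
    show "norm (\<pi> (\<beta> (x m)) v) \<le> 1 * norm v" for v
      by (rule positive_norm_le[OF \<pi>\<beta>.bcl \<pi>\<beta>.star_sa[OF xs]]) (use x(1) in \<open>auto simp: unit_def\<close>)
  qed simp
  have ev6: "eventually (\<lambda>m. norm (\<beta> (x m)) \<le> 6) sequentially" using nb by simp
  obtain F' D where F': "F' \<le> sequentially" "F' \<noteq> bot"
    and lim: "\<And>f. f \<in> predual \<Longrightarrow> ((\<lambda>i. f (\<beta> (x i))) \<longlongrightarrow> f D) F'"
    using weakstar_cluster[OF sequentially_bot ev6] by blast
  note limD = lim[OF vector_functional_predual]
  have Ds: "D\<^sup>\<star> = D"
  proof (rule rep_inj, rule cinner_ext)
    fix u v
    have "((\<lambda>i. cnj (cinner v (\<pi> (\<beta> (x i)) u))) \<longlongrightarrow> cnj (cinner v (\<pi> D u))) F'"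
      by (intro tendsto_cnj limD)
    moreover have "cnj (cinner v (\<pi> (\<beta> (x i)) u)) = cinner u (\<pi> (\<beta> (x i)) v)" for i
      using \<pi>\<beta>.star_sa[OF xs, of i u v] by (simp only: cinner_commute[symmetric])
    ultimately have "cnj (cinner v (\<pi> D u)) = cinner u (\<pi> D v)"
      using tendsto_unique[OF F'(2) _ limD] by simp
    then show "cinner u (\<pi> (D\<^sup>\<star>) v) = cinner u (\<pi> D v)"
      unfolding star[symmetric] by (simp only: cinner_commute[symmetric])
  qed
  have dlim: "(d v \<longlongrightarrow> Re (cinner v (\<pi> D v))) F'" for v
    unfolding d_def by (intro tendsto_Re limD)
  have D_pos: "0 \<le> Re (cinner v (\<pi> D v))" for v
    by (rule tendsto_lowerbound[OF dlim _ F'(2)]) (simp add: d0)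
  have D_le: "Re (cinner v (\<pi> D v)) \<le> d v m" for v m
  proof (rule tendsto_upperbound[OF dlim _ F'(2)])
    have "eventually (\<lambda>i. d v i \<le> d v m) sequentially"
      using eventually_ge_at_top[of m] by (rule eventually_mono) (rule decseqD[OF d_dec])
    then show "eventually (\<lambda>i. d v i \<le> d v m) F'" by (rule filter_leD[OF F'(1)])
  qed
  have D_k: "(norm k)\<^sup>2 / 2 \<le> Re (cinner k (\<pi> D k))"
  proof (rule tendsto_lowerbound[OF dlim always_eventually F'(2)], intro allI)
    fix m
    have "(norm k)\<^sup>2 / 2 \<le> (norm k)\<^sup>2 * (1/2 + (1/2) ^ Suc m)"
      by (simp add: distrib_left)
    then show "(norm k)\<^sup>2 / 2 \<le> d k m" using d_lower[of m] by (rule order.trans)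
  qed
  define E where "E = inv \<beta> D"
  interpret inv: automorphism "inv \<beta>" by standard (rule \<beta>.star_automorphism_inv)
  have rep_inv: "star_rep (\<lambda>a. \<pi> (inv \<beta> a))" by (rule inv.star_rep_compose[OF star_rep_axioms])
  have E_pos: "0 \<le> Re (cinner v (\<pi> E v))" for v
    unfolding E_def by (rule positive_transport[OF Ds D_pos rep_inv])
  have E_le: "Re (cinner h (\<pi> E h)) \<le> c m" for m
  proof -
    \<comment> \<open>The inequality D \<le> \<beta> (x m) holds under \<pi>; transported to the
      representation \<pi> \<circ> inv \<beta> it reads E \<le> x m.\<close>
    have "0 \<le> Re (cinner h (\<pi> (inv \<beta> (\<beta> (x m) - D)) h))"
    proof (rule positive_transport[OF _ _ rep_inv])
      show "(\<beta> (x m) - D)\<^sup>\<star> = \<beta> (x m) - D"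
        by (simp add: star_diff Ds \<beta>.\<beta>_star[symmetric] xs)
      show "0 \<le> Re (cinner v (\<pi> (\<beta> (x m) - D) v))" for v
        using D_le[of v m] by (simp add: diff cinner_diff_right d_def)
    qed
    then show ?thesis
      by (simp add: inv.\<beta>_diff \<beta>.inv_\<beta> diff cinner_diff_right c_def E_def)
  qed
  have "Re (cinner h (\<pi> E h)) \<le> 0"
    by (rule LIMSEQ_le_const[OF c_lim]) (use E_le in blast)
  then have "Re (cinner h (\<pi> E h)) = 0" using E_pos[of h] by linarith
  moreover have "E\<^sup>\<star> = E" by (simp add: E_def inv.\<beta>_star[symmetric] Ds)
  ultimately have "\<pi> E h = 0"
    by (intro positive_vanishes[OF bcl star_sa E_pos])
  then have "E * p = 0" by (rule p(2))
  then have "D * \<beta> p = 0" using \<beta>.\<beta>_mult[of E p] by (simp add: E_def \<beta>.inv_\<beta>)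
  then have "\<pi> D k = 0" by (simp add: k_def mult[symmetric] zero)
  then show False using D_k k by simp
qed

end

section \<open>The Fock space and the induced representation\<close>

lemma uniform_boundedness:
  fixes f :: "'i \<Rightarrow> 'a::banach \<Rightarrow> 'b::real_normed_vector"
  assumes f: "\<And>i. i \<in> I \<Longrightarrow> bounded_linear (f i)" and pw: "\<And>x. \<exists>K. \<forall>i\<in>I. norm (f i x) \<le> K"
  shows "\<exists>B\<ge>0. \<forall>i\<in>I. \<forall>x. norm (f i x) \<le> B * norm x"
proof -
  define C where "C n = {x. \<forall>i\<in>I. norm (f i x) \<le> real n}" for n
  have cl: "closed (C n)" for n
  proof -
    have "C n = (\<Inter>i\<in>I. {x. norm (f i x) \<le> real n})" by (auto simp: C_def)
    moreover have "closed {x. norm (f i x) \<le> real n}" if "i \<in> I" for i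
      by (intro closed_Collect_le continuous_on_norm bounded_linear.continuous_on[OF f[OF that]]
          continuous_on_id continuous_on_const)
    ultimately show ?thesis by (simp add: closed_INT)
  qed
  have "\<exists>n. interior (C n) \<noteq> {}"
  proof (rule ccontr)
    assume "\<nexists>n. interior (C n) \<noteq> {}"
    then have "Met_TC.mtopology interior_of \<Union> (range C) = {}"
      by (intro Met_TC.metric_Baire_category_alt)
        (auto simp: cl complete_UNIV interior_of_def interior_def)
    moreover have "\<Union> (range C) = UNIV"
    proof -
      have "\<exists>n. x \<in> C n" for x
      proof -
        obtain K where K: "\<forall>i\<in>I. norm (f i x) \<le> K" using pw by blast
        obtain n where "K \<le> real n" using real_arch_simple by blast
        then show ?thesis using K by (auto simp: C_def intro!: exI[of _ n])
      qed
      then show ?thesis by blast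
    qed
    ultimately show False
      using interior_of_topspace[of "euclidean :: 'a topology"] by simp
  qed
  then obtain n x0 where "x0 \<in> interior (C n)" by blast
  then obtain e where e: "e > 0" "cball x0 e \<subseteq> C n"
    unfolding mem_interior_cball by blast
  define B where "B = 2 * real n / e"
  have "norm (f i x) \<le> B * norm x" if i: "i \<in> I" for i x
  proof (cases "x = 0")
    case True
    then show ?thesis using linear_0[OF bounded_linear.linear[OF f[OF i]]] by simp
  next
    case False
    note lin = bounded_linear.linear[OF f[OF i]]
    define y where "y = (e / norm x) *\<^sub>R x"
    have "norm y = e" using False e by (simp add: y_def)
    then have "x0 + y \<in> C n" "x0 \<in> C n" using e by (auto simp: dist_norm)
    then have "norm (f i (x0 + y)) \<le> n" "norm (f i x0) \<le> n" using i by (auto simp: C_def)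
    moreover have "f i y = f i (x0 + y) - f i x0" using linear_add[OF lin, of x0 y] by simp
    ultimately have "norm (f i y) \<le> 2 * n"
      using norm_triangle_ineq4[of "f i (x0 + y)" "f i x0"] by simp
    moreover have "norm (f i y) = e / norm x * norm (f i x)"
      using e False by (simp add: y_def linear_scale[OF lin])
    ultimately show ?thesis using e False by (simp add: B_def field_simps)
  qed
  moreover have "B \<ge> 0" using e by (simp add: B_def)
  ultimately show ?thesis by blast
qed

text \<open>The estimate applied to differences shows that the graph is single-valued and that
  images of Cauchy sequences are Cauchy. Working with graphs spares a separate proof that X
  \<otimes> I is well defined on sums of elementary tensors.\<close>

lemma bounded_graph_extension:
  fixes G :: "('a::complex_hilbert \<times> 'b::complex_hilbert) set"
  assumes add: "\<And>u w u' w'. (u, w) \<in> G \<Longrightarrow> (u', w') \<in> G \<Longrightarrow> (u + u', w + w') \<in> G"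
    and scale: "\<And>u w c. (u, w) \<in> G \<Longrightarrow> (c *\<^sub>C u, c *\<^sub>C w) \<in> G"
    and le: "\<And>u w. (u, w) \<in> G \<Longrightarrow> norm w \<le> K * norm u"
    and dense: "closure (fst ` G) = UNIV"
  shows "\<exists>Z. bounded_clinear Z \<and> (\<forall>u w. (u, w) \<in> G \<longrightarrow> Z u = w) \<and> (\<forall>v. norm (Z v) \<le> K * norm v)"
proof -
  have diff: "norm (w - w') \<le> K * norm (u - u')" if "(u, w) \<in> G" "(u', w') \<in> G" for u w u' w'
  proof -
    have "(u + (- 1) *\<^sub>C u', w + (- 1) *\<^sub>C w') \<in> G" using that by (intro add scale)
    then show ?thesis using le by fastforce
  qed
  define lim where "lim v z \<longleftrightarrow> (\<exists>u w. (\<forall>n::nat. (u n, w n) \<in> G) \<and> u \<longlonglongrightarrow> v \<and> w \<longlonglongrightarrow> z)" for v z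
  have ex: "\<exists>z. lim v z" for v
  proof -
    have "v \<in> closure (fst ` G)" using dense by simp
    then obtain u where u: "\<And>n. u n \<in> fst ` G" "u \<longlonglongrightarrow> v" unfolding closure_sequential by blast
    then have "\<forall>n. \<exists>w. (u n, w) \<in> G" by force
    then obtain w where w: "\<And>n. (u n, w n) \<in> G" by metis
    have "Cauchy w"
    proof (rule metric_CauchyI)
      fix e :: real assume "e > 0"
      define d where "d = e / (\<bar>K\<bar> + 1)"
      have "d > 0" using \<open>e > 0\<close> by (simp add: d_def)
      then obtain M where M: "\<And>m n. m \<ge> M \<Longrightarrow> n \<ge> M \<Longrightarrow> dist (u m) (u n) < d"
        using metric_CauchyD[OF LIMSEQ_imp_Cauchy[OF u(2)]] by blast
      have "dist (w m) (w n) < e" if "m \<ge> M" "n \<ge> M" for m n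
      proof -
        have "dist (w m) (w n) \<le> K * dist (u m) (u n)"
          using diff[OF w w] by (simp add: dist_norm)
        also have "\<dots> \<le> \<bar>K\<bar> * dist (u m) (u n)" by (rule mult_right_mono) auto
        also have "\<dots> \<le> \<bar>K\<bar> * d" using M[OF that] by (intro mult_left_mono) auto
        also have "\<dots> < (\<bar>K\<bar> + 1) * d" using \<open>d > 0\<close> by simp
        also have "\<dots> = e" by (simp add: d_def)
        finally show ?thesis .
      qed
      then show "\<exists>M. \<forall>m\<ge>M. \<forall>n\<ge>M. dist (w m) (w n) < e" by blast
    qed
    then obtain z where "w \<longlonglongrightarrow> z" using Cauchy_convergent convergent_def by blast
    then show ?thesis using u w unfolding lim_def by blast
  qed
  have lim_le: "norm z \<le> K * norm v" if "lim v z" for v z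
  proof -
    obtain u w where uw: "\<And>n::nat. (u n, w n) \<in> G" "u \<longlonglongrightarrow> v" "w \<longlonglongrightarrow> z"
      using \<open>lim v z\<close> unfolding lim_def by blast
    show ?thesis
      by (rule LIMSEQ_le[OF tendsto_norm[OF uw(3)] tendsto_mult_left[OF tendsto_norm[OF uw(2)]]])
        (use le[OF uw(1)] in blast)
  qed
  have lim_add: "lim (v + v') (z + z')" if "lim v z" "lim v' z'" for v z v' z'
  proof -
    obtain u w where uw: "\<And>n::nat. (u n, w n) \<in> G" "u \<longlonglongrightarrow> v" "w \<longlonglongrightarrow> z"
      using \<open>lim v z\<close> unfolding lim_def by blast
    obtain u' w' where uw': "\<And>n::nat. (u' n, w' n) \<in> G" "u' \<longlonglongrightarrow> v'" "w' \<longlonglongrightarrow> z'"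
      using \<open>lim v' z'\<close> unfolding lim_def by blast
    have "\<forall>n. (u n + u' n, w n + w' n) \<in> G" using add uw(1) uw'(1) by blast
    moreover have "(\<lambda>n. u n + u' n) \<longlonglongrightarrow> v + v'" "(\<lambda>n. w n + w' n) \<longlonglongrightarrow> z + z'"
      by (intro tendsto_add uw uw')+
    ultimately show ?thesis
      unfolding lim_def by (intro exI[of _ "\<lambda>n. u n + u' n"] exI[of _ "\<lambda>n. w n + w' n"] conjI)
  qed
  have lim_scale: "lim (c *\<^sub>C v) (c *\<^sub>C z)" if "lim v z" for c v z
  proof -
    obtain u w where uw: "\<And>n::nat. (u n, w n) \<in> G" "u \<longlonglongrightarrow> v" "w \<longlonglongrightarrow> z"
      using \<open>lim v z\<close> unfolding lim_def by blast
    have "\<forall>n. (c *\<^sub>C u n, c *\<^sub>C w n) \<in> G" using scale uw(1) by blast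
    moreover have "(\<lambda>n. c *\<^sub>C u n) \<longlonglongrightarrow> c *\<^sub>C v" "(\<lambda>n. c *\<^sub>C w n) \<longlonglongrightarrow> c *\<^sub>C z"
      by (intro tendsto_scaleC uw)+
    ultimately show ?thesis
      unfolding lim_def by (intro exI[of _ "\<lambda>n. c *\<^sub>C u n"] exI[of _ "\<lambda>n. c *\<^sub>C w n"] conjI)
  qed
  have lim_unique: "z = z'" if "lim v z" "lim v z'" for v z z'
  proof -
    have "lim (v + (- 1) *\<^sub>C v) (z + (- 1) *\<^sub>C z')" using that by (intro lim_add lim_scale)
    from lim_le[OF this] show ?thesis by simp
  qed
  obtain Z where Z: "\<And>v. lim v (Z v)" using ex by metis
  have "bounded_clinear Z"
  proof (rule bounded_clinearI[where K = K])
    show "Z (x + y) = Z x + Z y" for x y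
      by (rule lim_unique[OF Z lim_add[OF Z Z]])
    show "Z (c *\<^sub>C x) = c *\<^sub>C Z x" for c x
      by (rule lim_unique[OF Z lim_scale[OF Z]])
    show "norm (Z x) \<le> K * norm x" for x by (rule lim_le[OF Z])
  qed
  moreover have "Z u = w" if "(u, w) \<in> G" for u w
  proof (rule lim_unique[OF Z])
    show "lim u w"
      unfolding lim_def
      by (rule exI[of _ "\<lambda>_. u"], rule exI[of _ "\<lambda>_. w"]) (use that in simp)
  qed
  ultimately show ?thesis using lim_le[OF Z] by blast
qed

text \<open>Iterating \<open>sq\<close> gives \<open>(p 0 / n) ^ 2 ^ k \<le> p k / n\<close>, and
  2^k-th roots remove the constant C / n of the a priori bound.\<close>

lemma bound_from_squares:
  fixes p :: "nat \<Rightarrow> real"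
  assumes sq: "\<And>k. (p k)\<^sup>2 \<le> n * p (Suc k)" and le: "\<And>k. p k \<le> C * b ^ 2 ^ k"
    and nonneg: "\<And>k. 0 \<le> p k" "0 \<le> n" "0 \<le> b"
  shows "p 0 \<le> n * b"
proof (cases "n = 0")
  case True
  then show ?thesis using sq[of 0] by simp
next
  case False
  then have n: "n > 0" using nonneg by simp
  have pow: "(p 0 / n) ^ 2 ^ k \<le> p k / n" for k
  proof (induction k)
    case (Suc k)
    have "(p 0 / n) ^ 2 ^ Suc k = ((p 0 / n) ^ 2 ^ k)\<^sup>2"
      by (simp add: power_mult[symmetric] mult.commute)
    also have "\<dots> \<le> (p k / n)\<^sup>2"
      using Suc nonneg n by (intro power_mono) auto
    also have "\<dots> \<le> p (Suc k) / n"
      using sq[of k] n by (simp add: power_divide power2_eq_square field_simps)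
    finally show ?case .
  qed simp
  have "p 0 / n \<le> b"
  proof (rule ccontr)
    assume "\<not> p 0 / n \<le> b"
    then have gt: "b < p 0 / n" by simp
    show False
    proof (cases "b = 0")
      case True
      then show False using gt le[of 0] n by (simp add: zero_less_divide_iff)
    next
      case False
      then have b: "b > 0" using nonneg by simp
      define r where "r = p 0 / n / b"
      have r: "r > 1" unfolding r_def using gt b by (subst less_divide_eq_1_pos)
      have "r ^ 2 ^ k \<le> C / n" for k
      proof -
        have "(p 0 / n) ^ 2 ^ k \<le> C / n * b ^ 2 ^ k"
          using pow[of k] divide_right_mono[OF le[of k], of n] n by simp
        moreover have "r ^ 2 ^ k = (p 0 / n) ^ 2 ^ k / b ^ 2 ^ k"
          unfolding r_def by (rule power_divide)
        ultimately show ?thesis using b by (simp only: pos_divide_le_eq zero_less_power)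
      qed
      moreover obtain k where k: "C / n < r ^ k" using real_arch_pow[OF r] by blast
      moreover have "r ^ k \<le> r ^ 2 ^ k"
        using r less_imp_le[OF less_exp[of k]] by (intro power_increasing) auto
      ultimately show False by (meson less_le_trans not_le)
    qed
  qed
  then show ?thesis using n by (simp add: field_simps)
qed

section \<open>Adjointable operators on Hilbert modules\<close>

context hilbert_wstar_module
begin

lemma minner_add_left: "minner E (x + y) z = minner E x z + minner E y z"
proof -
  have "(minner E z (x + y))\<^sup>\<star> = (minner E z x)\<^sup>\<star> + (minner E z y)\<^sup>\<star>"
    by (simp only: minner_add star_add)
  then show ?thesis by (simp only: minner_star)
qed

lemma minner_scaleC_left: "minner E (c *\<^sub>C x) z = cnj c *\<^sub>C minner E x z"
proof -
  have "(minner E z (c *\<^sub>C x))\<^sup>\<star> = cnj c *\<^sub>C (minner E z x)\<^sup>\<star>"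
    by (simp only: minner_scaleC star_scaleC)
  then show ?thesis by (simp only: minner_star)
qed

lemma minner_ract_left: "minner E (ract E x a) z = a\<^sup>\<star> * minner E x z"
proof -
  have "(minner E z (ract E x a))\<^sup>\<star> = a\<^sup>\<star> * (minner E z x)\<^sup>\<star>"
    by (simp only: minner_ract star_mult)
  then show ?thesis by (simp only: minner_star)
qed

lemma minner_diff: "minner E x (y - z) = minner E x y - minner E x z"
  using minner_add[of x "y - z" z] by simp

lemma minner_diff_left: "minner E (y - z) x = minner E y x - minner E z x"
  using minner_add_left[of "y - z" z x] by simp

lemma minner_ext: "(\<And>z. minner E z x = minner E z y) \<Longrightarrow> x = y"
proof -
  assume "\<And>z. minner E z x = minner E z y"
  then have "minner E (x - y) (x - y) = 0" by (simp add: minner_diff)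
  then show ?thesis using norm_minner[of "x - y"] by simp
qed

lemma minner_eqI:
  assumes "minner E x x = c" "minner E x y = c" "minner E y x = c" "minner E y y = c"
  shows "x = y"
proof -
  have "minner E (x - y) (x - y) = 0" by (simp add: minner_diff minner_diff_left assms)
  then show ?thesis using norm_minner[of "x - y"] by simp
qed

lemma norm_sq_minner: "(norm \<xi>)\<^sup>2 = norm (minner E \<xi> \<xi>)"
  using norm_minner[of \<xi>] by simp

text \<open>By polarization; the constant could be improved to \<open>1\<close>.\<close>

lemma norm_minner_le: "norm (minner E x y) \<le> 4 * (norm x * norm y)"
proof -
  have *: "norm (minner E x y) \<le> (norm x + norm y)\<^sup>2" for x y
  proof -
    define Q where "Q c = minner E (x + c *\<^sub>C y) (x + c *\<^sub>C y)" for c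
    have "4 *\<^sub>C minner E x y = (Q 1 + (- 1) *\<^sub>C Q (- 1)) + ((- \<i>) *\<^sub>C Q \<i> + \<i> *\<^sub>C Q (- \<i>))"
    proof -
      have Q: "Q c = minner E x x + c *\<^sub>C minner E x y + cnj c *\<^sub>C minner E y x + (cnj c * c) *\<^sub>C minner E y y" for c
        by (simp add: Q_def minner_add minner_scaleC minner_add_left minner_scaleC_left
            scaleC_add_right scaleC_scaleC algebra_simps)
      have "4 *\<^sub>C minner E x y = 2 *\<^sub>C minner E x y + 2 *\<^sub>C minner E x y"
        by (simp add: scaleC_add_left[symmetric])
      moreover have "2 *\<^sub>C minner E x y = minner E x y + minner E x y"
        using scaleC_add_left[of 1 1 "minner E x y"] by (simp add: scaleC_one)
      ultimately show ?thesis
        by (simp add: Q scaleC_add_right scaleC_scaleC scaleC_one algebra_simps)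
    qed
    moreover have "norm (Q c) \<le> (norm x + norm y)\<^sup>2" if "cmod c = 1" for c
    proof -
      have "norm (Q c) = (norm (x + c *\<^sub>C y))\<^sup>2" by (simp add: Q_def norm_sq_minner)
      also have "\<dots> \<le> (norm x + norm y)\<^sup>2"
        using norm_triangle_ineq[of x "c *\<^sub>C y"] that by (intro power_mono) (simp_all add: norm_scaleC)
      finally show ?thesis .
    qed
    ultimately have "norm (4 *\<^sub>C minner E x y) \<le> ((norm x + norm y)\<^sup>2 + (norm x + norm y)\<^sup>2)
        + ((norm x + norm y)\<^sup>2 + (norm x + norm y)\<^sup>2)"
      by (simp only:) (intro norm_triangle_le add_mono, simp_all add: norm_scaleC)
    then show ?thesis by (simp add: norm_scaleC)
  qed
  show ?thesis
  proof (cases "x = 0 \<or> y = 0")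
    case True
    then show ?thesis
      using minner_scaleC[of x 0 y] minner_scaleC_left[of 0 x y] by auto
  next
    case False
    \<comment> \<open>For unit vectors the bound above is 4; homogeneity gives the general
      case.\<close>
    define u v where "u = of_real (1 / norm x) *\<^sub>C x" "v = of_real (1 / norm y) *\<^sub>C y"
    have "norm u = 1" "norm v = 1" using False by (simp_all add: u_v_def norm_scaleC norm_divide)
    then have "norm (minner E u v) \<le> 4" using *[of u v] by simp
    moreover have "norm (minner E u v) = norm (minner E x y) / (norm x * norm y)"
      by (simp add: u_v_def minner_scaleC minner_scaleC_left norm_scaleC norm_divide norm_mult)
    ultimately show ?thesis using False by (simp add: field_simps)
  qed
qed

lemma norm_le_of_minner:
  assumes "B \<ge> 0" "norm (minner E \<xi> \<xi>) \<le> B * norm \<xi>"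
  shows "norm \<xi> \<le> B"
proof (cases "\<xi> = 0")
  case False
  then show ?thesis using assms(2) by (simp add: norm_sq_minner[symmetric] power2_eq_square)
qed (use assms in simp)

definition module_adjoint :: "('e \<Rightarrow> 'e) \<Rightarrow> ('e \<Rightarrow> 'e) \<Rightarrow> bool"
  where "module_adjoint T S \<longleftrightarrow> (\<forall>x y. minner E (T x) y = minner E x (S y))"

lemma adjointable_iff: "T \<in> adjointable E \<longleftrightarrow> (\<exists>S. module_adjoint T S)"
  by (simp add: adjointable_def module_adjoint_def)

lemma module_adjoint_sym: "module_adjoint T S \<Longrightarrow> module_adjoint S T"
  unfolding module_adjoint_def
proof (intro allI)
  fix x y assume "\<forall>x y. minner E (T x) y = minner E x (S y)"
  then have "(minner E (T y) x)\<^sup>\<star> = (minner E y (S x))\<^sup>\<star>" by simp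
  then show "minner E (S x) y = minner E x (T y)" by (simp only: minner_star)
qed

lemma module_adjoint_compose:
  "module_adjoint T S \<Longrightarrow> module_adjoint T' S' \<Longrightarrow> module_adjoint (T \<circ> T') (S' \<circ> S)"
  by (simp add: module_adjoint_def)

lemma
  assumes "module_adjoint T S"
  shows module_adjoint_add: "T (x + y) = T x + T y"
    and module_adjoint_scaleC: "T (c *\<^sub>C x) = c *\<^sub>C T x"
    and module_adjoint_ract: "T (ract E x a) = ract E (T x) a"
proof -
  have *: "minner E z (T x) = minner E (S z) x" for z x
    using module_adjoint_sym[OF assms] by (simp add: module_adjoint_def)
  show "T (x + y) = T x + T y" by (rule minner_ext) (simp add: * minner_add)
  show "T (c *\<^sub>C x) = c *\<^sub>C T x" by (rule minner_ext) (simp add: * minner_scaleC)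
  show "T (ract E x a) = ract E (T x) a" by (rule minner_ext) (simp add: * minner_ract)
qed

text \<open>The maps \<open>minner E (T \<xi>)\<close> with \<open>norm \<xi> \<le> 1\<close> are
  pointwise bounded through the adjoint S, hence uniformly bounded. Evaluating them at T \<xi>
  bounds T.\<close>

lemma module_adjoint_bcl:
  assumes TS: "module_adjoint T S"
  shows "bounded_clinear T"
proof -
  have "\<exists>B\<ge>0. \<forall>\<xi>\<in>cball 0 1. \<forall>y. norm (minner E (T \<xi>) y) \<le> B * norm y"
  proof (rule uniform_boundedness)
    show "bounded_linear (minner E (T \<xi>))" for \<xi>
      by (rule bounded_linear_intro[where K = "4 * norm (T \<xi>)"])
        (use norm_minner_le[of "T \<xi>"] in \<open>simp_all add: minner_add scaleR_scaleC minner_scaleC mult_ac\<close>)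
    show "\<exists>K. \<forall>\<xi>\<in>cball 0 1. norm (minner E (T \<xi>) x) \<le> K" for x
    proof (intro exI[of _ "4 * norm (S x)"] ballI)
      fix \<xi> :: 'e assume "\<xi> \<in> cball 0 1"
      then have "4 * (norm \<xi> * norm (S x)) \<le> 4 * (1 * norm (S x))"
        by (intro mult_left_mono mult_right_mono) auto
      then show "norm (minner E (T \<xi>) x) \<le> 4 * norm (S x)"
        using TS norm_minner_le[of \<xi> "S x"] by (simp add: module_adjoint_def)
    qed
  qed
  then obtain B where B: "B \<ge> 0" "\<And>\<xi> y. norm \<xi> \<le> 1 \<Longrightarrow> norm (minner E (T \<xi>) y) \<le> B * norm y"
    by auto
  have B1: "norm (T \<xi>) \<le> B" if "norm \<xi> \<le> 1" for \<xi>
    by (rule norm_le_of_minner[OF B(1) B(2)[OF that]])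
  show ?thesis
  proof (rule bounded_clinearI[OF module_adjoint_add[OF TS] module_adjoint_scaleC[OF TS]])
    show "norm (T \<xi>) \<le> B * norm \<xi>" for \<xi>
    proof (cases "\<xi> = 0")
      case True
      then show ?thesis using module_adjoint_scaleC[OF TS, of 0 0] by simp
    next
      case False
      have "T (of_real (1 / norm \<xi>) *\<^sub>C \<xi>) = of_real (1 / norm \<xi>) *\<^sub>C T \<xi>"
        by (rule module_adjoint_scaleC[OF TS])
      moreover have "norm (T (of_real (1 / norm \<xi>) *\<^sub>C \<xi>)) \<le> B"
        using False by (intro B1) (simp add: norm_scaleC norm_divide)
      ultimately have "1 / norm \<xi> * norm (T \<xi>) \<le> B"
        by (simp add: norm_scaleC norm_divide)
      then show ?thesis using False by (simp add: field_simps)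
    qed
  qed
qed

lemma module_adjoint_onorm:
  assumes TS: "module_adjoint T S"
  shows "onorm S \<le> 4 * onorm T"
proof (rule onorm_bound)
  note T = module_adjoint_bcl[OF TS]
  have ST: "minner E (S x) y = minner E x (T y)" for x y
    using module_adjoint_sym[OF TS] by (simp add: module_adjoint_def)
  have o: "0 \<le> onorm T" by (rule onorm_pos_le[OF bounded_clinear_bl[OF T]])
  then show "0 \<le> 4 * onorm T" by simp
  fix y
  show "norm (S y) \<le> 4 * onorm T * norm y"
  proof (rule norm_le_of_minner)
    have "norm (minner E (S y) (S y)) \<le> 4 * (norm y * norm (T (S y)))"
      unfolding ST by (rule norm_minner_le)
    also have "\<dots> \<le> 4 * (norm y * (onorm T * norm (S y)))"
      by (intro mult_left_mono bcl_norm[OF T]) auto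
    finally show "norm (minner E (S y) (S y)) \<le> 4 * onorm T * norm y * norm (S y)"
      by (simp add: mult_ac)
  qed (use o in simp)
qed

lemma adjointable_add:
  "S \<in> adjointable E \<Longrightarrow> T \<in> adjointable E \<Longrightarrow> (\<lambda>x. S x + T x) \<in> adjointable E"
proof -
  assume "S \<in> adjointable E" "T \<in> adjointable E"
  then obtain S' T' where "module_adjoint S S'" "module_adjoint T T'" using adjointable_iff by blast
  then have "module_adjoint (\<lambda>x. S x + T x) (\<lambda>x. S' x + T' x)"
    by (simp add: module_adjoint_def minner_add_left minner_add)
  then show ?thesis using adjointable_iff by blast
qed

lemma adjointable_scaleC: "T \<in> adjointable E \<Longrightarrow> (\<lambda>x. c *\<^sub>C T x) \<in> adjointable E"
proof -
  assume "T \<in> adjointable E"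
  then obtain T' where "module_adjoint T T'" using adjointable_iff by blast
  then have "module_adjoint (\<lambda>x. c *\<^sub>C T x) (\<lambda>x. cnj c *\<^sub>C T' x)"
    by (simp add: module_adjoint_def minner_scaleC_left minner_scaleC)
  then show ?thesis using adjointable_iff by blast
qed

lemma adjointable_compose: "S \<in> adjointable E \<Longrightarrow> T \<in> adjointable E \<Longrightarrow> S \<circ> T \<in> adjointable E"
  using module_adjoint_compose adjointable_iff by meson

lemma topspace_adjointable: "topspace (adjointable_ultraweak E) = adjointable E"
  unfolding adjointable_ultraweak_def
proof (rule topspace_weak_topology)
  have "0 \<le> onorm T" if "T \<in> adjointable E" for T
    using that onorm_pos_le bounded_clinear_bl module_adjoint_bcl unfolding adjointable_iff by blast
  then have "(\<lambda>_. 0) \<in> adjointable_predual E"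
    unfolding adjointable_predual_def closed_sums_def by (auto intro!: exI[of _ "[]"])
  then show "adjointable_predual E \<noteq> {}" by blast
qed

end

text \<open>The product \<alpha>^(n-1)(x1) ... \<alpha>(x(n-1)) xn, which is the coefficient of an
  elementary tensor with respect to \<open>e n\<close>. It reflects the identification of the n-th
  tensor power of \<open>twisted \<alpha>\<close> with
  \<open>twisted (\<alpha> ^^ n)\<close>.\<close>

primrec lprod :: "('m::monoid_mult \<Rightarrow> 'm) \<Rightarrow> 'm list \<Rightarrow> 'm" where
  "lprod \<alpha> [] = 1"
| "lprod \<alpha> (\<xi> # \<xi>s) = (\<alpha> ^^ length \<xi>s) \<xi> * lprod \<alpha> \<xi>s"

text \<open>The inner product of the leading factors enters the next factor through the left action
  and so picks up one \<alpha>; over the remaining length this accumulates to the power of \<alpha>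
  in \<open>lprod\<close>.\<close>

lemma tensor_inner_twisted:
  assumes \<alpha>: "star_automorphism \<alpha>" and "\<xi>s \<noteq> []"
  shows "tensor_inner (twisted \<alpha>) \<xi>s \<eta>s = (if length \<xi>s = length \<eta>s then (lprod \<alpha> \<xi>s)\<^sup>\<star> * lprod \<alpha> \<eta>s else 0)"
  using assms(2)
proof (induction "twisted \<alpha>" \<xi>s \<eta>s rule: tensor_inner.induct)
  case (1 \<xi> \<eta>)
  then show ?case by (simp add: twisted_def)
next
  case (2 \<xi> \<xi>' \<xi>s \<eta> \<eta>' \<eta>s)
  interpret a: automorphism "\<alpha> ^^ length \<eta>s"
    by standard (rule star_automorphism_funpow[OF \<alpha>])
  interpret \<alpha>: automorphism \<alpha> by standard (rule \<alpha>)
  show ?case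
    using 2 by (simp add: twisted_def a.\<beta>_mult a.\<beta>_star \<alpha>.\<beta>_mult \<alpha>.\<beta>_star star_mult mult.assoc funpow_swap1)
qed auto

section \<open>The basis of the Fock space and its image in the induced Hilbert space\<close>

locale fock_rep = full_fock_space "twisted \<alpha>" F + normal_representation \<pi>
  for \<alpha> :: "'m::wstar_algebra \<Rightarrow> 'm"
    and F :: "('m, 'm, 'f::complex_banach, 'z) fock_module_scheme"
    and \<pi> :: "'m \<Rightarrow> 'h::complex_hilbert \<Rightarrow> 'h" +
  fixes t :: "'f \<Rightarrow> 'h \<Rightarrow> 'k::complex_hilbert"
  assumes \<alpha>: "star_automorphism \<alpha>"
    and tensor: "is_hilbert_tensor F \<pi> t"
begin

lemma t_inner: "cinner (t \<xi> h) (t \<eta> k) = cinner h (\<pi> (minner F \<xi> \<eta>) k)"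
  using tensor unfolding is_hilbert_tensor_def by blast

lemma t_total: "closure (cspan {t \<xi> h | \<xi> h. True}) = UNIV"
  using tensor unfolding is_hilbert_tensor_def by blast

lemma total_ext:
  assumes "\<And>\<xi> h. cinner x (t \<xi> h) = 0"
  shows "x = 0"
proof -
  have "{t \<xi> h | \<xi> h. True} \<subseteq> {y. cinner x y = 0}" using assms by blast
  moreover have "csubspace {y. cinner x y = 0}"
    by (auto simp: cvs.subspace_def cinner_add_right cinner_scaleC_right)
  ultimately have "cspan {t \<xi> h | \<xi> h. True} \<subseteq> {y. cinner x y = 0}" by (rule cvs.span_minimal)
  moreover have "closed {y. cinner x y = 0}"
    by (rule closed_Collect_eq[OF bcl_continuous_on[OF bcl_cinner continuous_on_id] continuous_on_const])
  ultimately have "closure (cspan {t \<xi> h | \<xi> h. True}) \<subseteq> {y. cinner x y = 0}" by (rule closure_minimal)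
  then have "cinner x x = 0" unfolding t_total by blast
  then show ?thesis by (simp add: cinner_norm)
qed

lemma total_eqI:
  assumes "\<And>\<xi> h. cinner (t \<xi> h) x = cinner (t \<xi> h) y"
  shows "x = y"
proof -
  have "cinner (x - y) (t \<xi> h) = 0" for \<xi> h
    by (rule cinner_eq_0_swap) (simp add: cinner_diff_right assms)
  then have "x - y = 0" by (rule total_ext)
  then show ?thesis by simp
qed

lemma norm_t: "norm (t \<xi> h) \<le> norm \<xi> * norm h"
proof -
  have "(norm (t \<xi> h))\<^sup>2 = Re (cinner h (\<pi> (minner F \<xi> \<xi>) h))"
    by (simp add: Re_cinner_self[symmetric] t_inner)
  also have "\<dots> \<le> norm h * norm (\<pi> (minner F \<xi> \<xi>) h)"
    using complex_Re_le_cmod cinner_Cauchy_Schwarz order.trans by blast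
  also have "\<dots> \<le> norm h * (norm (minner F \<xi> \<xi>) * norm h)"
    by (rule mult_left_mono[OF contractive norm_ge_zero])
  also have "\<dots> = (norm \<xi> * norm h)\<^sup>2"
    by (simp add: F.norm_sq_minner[symmetric] power2_eq_square)
  finally show ?thesis by (rule power2_le_imp_le) simp
qed

lemma t_bcl: "bounded_clinear (t \<xi>)"
proof (rule bounded_clinearI[OF _ _ norm_t])
  show "t \<xi> (x + y) = t \<xi> x + t \<xi> y" for x y
    by (rule total_eqI) (simp add: t_inner cinner_add_right bcl_add[OF bcl])
  show "t \<xi> (c *\<^sub>C x) = c *\<^sub>C t \<xi> x" for c x
    by (rule total_eqI) (simp add: t_inner cinner_scaleC_right bcl_scaleC[OF bcl])
qed

lemma t_add_left: "t (\<xi> + \<eta>) h = t \<xi> h + t \<eta> h"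
  by (rule total_eqI) (simp add: t_inner cinner_add_right F.minner_add add)

lemma t_scaleC_left: "t (c *\<^sub>C \<xi>) h = c *\<^sub>C t \<xi> h"
  by (rule total_eqI) (simp add: t_inner cinner_scaleC_right F.minner_scaleC scaleC)

lemma t_ract: "t (ract F \<xi> a) h = t \<xi> (\<pi> a h)"
  by (rule total_eqI) (simp add: t_inner F.minner_ract mult)

text \<open>The tensors 1 \<otimes> ... \<otimes> 1. They are orthonormal, and every elementary
  tensor of length n is a right multiple of \<open>e n\<close>.\<close>

definition e :: "nat \<Rightarrow> 'f"
  where "e n = (if n = 0 then vac F 1 else tens F (replicate n 1))"

lemma lprod_replicate: "lprod \<alpha> (replicate n 1) = 1"
proof (induction n)
  case (Suc n)
  interpret a: automorphism "\<alpha> ^^ n" by standard (rule star_automorphism_funpow[OF \<alpha>])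
  show ?case using Suc by simp
qed simp

lemma inner_e_tens:
  assumes "\<xi>s \<noteq> []"
  shows "minner F (e n) (tens F \<xi>s) = (if n = length \<xi>s then lprod \<alpha> \<xi>s else 0)"
  using assms by (auto simp: e_def inner_vac_tens inner_tens tensor_inner_twisted[OF \<alpha>] lprod_replicate)

lemma e_inner: "minner F (e i) (e j) = (if i = j then 1 else 0)"
proof (cases "j = 0")
  case True
  show ?thesis
  proof (cases "i = 0")
    case False
    then have "(minner F (vac F 1) (tens F (replicate i 1)))\<^sup>\<star> = 0\<^sup>\<star>"
      by (subst inner_vac_tens) auto
    then show ?thesis using True False by (simp add: e_def F.minner_star)
  qed (use True in \<open>simp add: e_def inner_vac\<close>)
next
  case False
  then show ?thesis
    using inner_e_tens[of "replicate j 1" i] by (simp add: e_def[of j] lprod_replicate)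
qed

lemma tens_eq:
  assumes "\<xi>s \<noteq> []"
  shows "tens F \<xi>s = ract F (e (length \<xi>s)) (lprod \<alpha> \<xi>s)"
proof (rule F.minner_eqI)
  have "(minner F (e (length \<xi>s)) (tens F \<xi>s))\<^sup>\<star> = (lprod \<alpha> \<xi>s)\<^sup>\<star>"
    by (simp add: inner_e_tens assms)
  then have 1: "minner F (tens F \<xi>s) (e (length \<xi>s)) = (lprod \<alpha> \<xi>s)\<^sup>\<star>"
    by (simp only: F.minner_star)
  show "minner F (tens F \<xi>s) (tens F \<xi>s) = (lprod \<alpha> \<xi>s)\<^sup>\<star> * lprod \<alpha> \<xi>s"
    by (simp add: inner_tens assms tensor_inner_twisted[OF \<alpha>])
  show "minner F (tens F \<xi>s) (ract F (e (length \<xi>s)) (lprod \<alpha> \<xi>s)) = (lprod \<alpha> \<xi>s)\<^sup>\<star> * lprod \<alpha> \<xi>s"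
    by (simp add: F.minner_ract 1)
  show "minner F (ract F (e (length \<xi>s)) (lprod \<alpha> \<xi>s)) (tens F \<xi>s) = (lprod \<alpha> \<xi>s)\<^sup>\<star> * lprod \<alpha> \<xi>s"
    by (simp add: F.minner_ract_left inner_e_tens assms)
  show "minner F (ract F (e (length \<xi>s)) (lprod \<alpha> \<xi>s)) (ract F (e (length \<xi>s)) (lprod \<alpha> \<xi>s))
      = (lprod \<alpha> \<xi>s)\<^sup>\<star> * lprod \<alpha> \<xi>s"
    by (simp add: F.minner_ract F.minner_ract_left e_inner)
qed

lemma vac_eq: "vac F a = ract F (e 0) a"
  by (rule F.minner_eqI[where c = "a\<^sup>\<star> * a"])
    (simp_all add: e_def inner_vac F.minner_ract F.minner_ract_left)

text \<open>Moving \<xi> through the n unit factors to its right applies \<alpha> once per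
  factor.\<close>

lemma creation_e: "creation F \<xi> (e n) = ract F (e (Suc n)) ((\<alpha> ^^ n) \<xi>)"
proof (cases "n = 0")
  case True
  then show ?thesis
    using tens_eq[of "[\<xi>]"] by (simp add: e_def[of 0] creation_vac twisted_def)
next
  case False
  then have "creation F \<xi> (e n) = tens F (\<xi> # replicate n 1)"
    by (simp add: e_def creation_tens)
  then show ?thesis
    using tens_eq[of "\<xi> # replicate n 1"] by (simp add: lprod_replicate)
qed

lemma lact_e: "lact F a (e n) = ract F (e n) ((\<alpha> ^^ n) a)"
proof (cases n)
  case 0
  then show ?thesis by (simp add: e_def[of 0] lact_vac) (simp add: vac_eq e_def[symmetric] F.ract_one)
next
  case (Suc m)
  then have "lact F a (e n) = tens F (\<alpha> a # replicate m 1)"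
    using lact_tens[of a 1 "replicate m 1"] by (simp add: e_def twisted_def)
  then show ?thesis
    using tens_eq[of "\<alpha> a # replicate m 1"] Suc by (simp add: lprod_replicate funpow_swap1)
qed

definition V :: "nat \<Rightarrow> 'h \<Rightarrow> 'k" where "V n = t (e n)"

sublocale amplification V
proof
  show "bounded_clinear (V i)" for i unfolding V_def by (rule t_bcl)
  show "cinner (V i h) (V j k) = (if i = j then cinner h k else 0)" for i h j k
    by (simp add: V_def t_inner e_inner one zero)
qed

end

section \<open>Coordinates in the induced Hilbert space and the operators X \<otimes> I\<close>

locale fock_factor_rep = fock_rep \<alpha> F \<pi> t
  for \<alpha> :: "'m::wstar_algebra \<Rightarrow> 'm"
    and F :: "('m, 'm, 'f::complex_banach, 'z) fock_module_scheme"
    and \<pi> :: "'m \<Rightarrow> 'h::complex_hilbert \<Rightarrow> 'h"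
    and t :: "'f \<Rightarrow> 'h \<Rightarrow> 'k::complex_hilbert" +
  assumes factor: "(center :: 'm set) = range (\<lambda>c. c *\<^sub>C 1)"
    and nontrivial: "\<exists>h::'h. h \<noteq> 0"
begin

sublocale factor_rep \<pi> V
  by standard (rule factor, rule nontrivial)

definition tsum :: "('f \<times> 'h) list \<Rightarrow> 'k"
  where "tsum ps = (\<Sum>p\<leftarrow>ps. t (fst p) (snd p))"

lemma tsum_simps [simp]: "tsum [] = 0" "tsum (p # ps) = t (fst p) (snd p) + tsum ps"
  "tsum (ps @ qs) = tsum ps + tsum qs"
  by (simp_all add: tsum_def)

lemma tsum_scale: "tsum (map (\<lambda>p. (fst p, c *\<^sub>C snd p)) ps) = c *\<^sub>C tsum ps"
  by (induction ps) (simp_all add: bcl_scaleC[OF t_bcl] scaleC_add_right)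

lemma tsum_dense: "\<epsilon> > 0 \<Longrightarrow> \<exists>ps. norm (u - tsum ps) < \<epsilon>"
proof -
  assume "\<epsilon> > 0"
  have "csubspace (range tsum)"
    unfolding cvs.subspace_def
  proof (intro conjI ballI allI)
    show "0 \<in> range tsum" by (rule range_eqI[of _ _ "[]"]) simp
    show "x + y \<in> range tsum" if xy: "x \<in> range tsum" "y \<in> range tsum" for x y
    proof -
      obtain ps qs where "x = tsum ps" "y = tsum qs" using xy by blast
      then show ?thesis by (intro range_eqI[of _ _ "ps @ qs"]) simp
    qed
    show "c *\<^sub>C x \<in> range tsum" if x: "x \<in> range tsum" for c x
    proof -
      obtain ps where "x = tsum ps" using x by blast
      then show ?thesis by (intro range_eqI[of _ _ "map (\<lambda>p. (fst p, c *\<^sub>C snd p)) ps"]) (simp add: tsum_scale)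
    qed
  qed
  moreover have "t \<xi> h \<in> range tsum" for \<xi> h by (rule range_eqI[of _ _ "[(\<xi>, h)]"]) simp
  ultimately have "cspan {t \<xi> h | \<xi> h. True} \<subseteq> range tsum"
    by (intro cvs.span_minimal) blast+
  then have "u \<in> closure (range tsum)" using t_total closure_mono by blast
  then show ?thesis
    using \<open>\<epsilon> > 0\<close> unfolding closure_approachable by (auto simp: dist_norm norm_minus_commute)
qed

text \<open>For a finite sum x of elementary tensors the functional is a finite sum of defining
  ones; in general it is a norm limit of such sums, by density and the estimate
  \<open>norm_t\<close>.\<close>

lemma vector_functional_module: "(\<lambda>\<xi>. cinner x (t \<xi> h)) \<in> module_predual F"
  unfolding module_predual_def closed_sums_def mem_Collect_eq
proof (intro allI impI)
  fix \<epsilon> :: real assume "\<epsilon> > 0"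
  then have pos: "\<epsilon> / (norm h + 1) > 0" by (simp add: add_nonneg_pos)
  then obtain ps where ps: "norm (x - tsum ps) < \<epsilon> / (norm h + 1)" using tsum_dense by blast
  define gs where "gs = map (\<lambda>p \<xi>. cinner (snd p) (\<pi> (minner F (fst p) \<xi>) h)) ps"
  have sum: "(\<Sum>g\<leftarrow>gs. g \<xi>) = cinner (tsum ps) (t \<xi> h)" for \<xi>
    unfolding gs_def by (induction ps) (simp_all add: cinner_add_left t_inner)
  have "set gs \<subseteq> {\<lambda>x. \<omega> (minner F y x) | \<omega> y. \<omega> \<in> predual}"
  proof
    fix g assume "g \<in> set gs"
    then obtain p where "g = (\<lambda>\<xi>. cinner (snd p) (\<pi> (minner F (fst p) \<xi>) h))"
      by (auto simp: gs_def)
    then show "g \<in> {\<lambda>x. \<omega> (minner F y x) | \<omega> y. \<omega> \<in> predual}"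
      using vector_functional_predual[of "snd p" h]
      by (intro CollectI exI[of _ "\<lambda>a. cinner (snd p) (\<pi> a h)"] exI[of _ "fst p"]) simp
  qed
  moreover have "cmod (cinner x (t \<xi> h) - (\<Sum>g\<leftarrow>gs. g \<xi>)) \<le> \<epsilon> * norm \<xi>" for \<xi>
  proof -
    have "cmod (cinner x (t \<xi> h) - (\<Sum>g\<leftarrow>gs. g \<xi>)) = cmod (cinner (x - tsum ps) (t \<xi> h))"
      by (simp add: sum cinner_diff_left)
    also have "\<dots> \<le> norm (x - tsum ps) * norm (t \<xi> h)" by (rule cinner_Cauchy_Schwarz)
    also have "\<dots> \<le> \<epsilon> / (norm h + 1) * (norm \<xi> * norm h)"
      using ps pos norm_t by (intro mult_mono) auto
    also have "\<dots> = \<epsilon> * norm \<xi> * (norm h / (norm h + 1))" by simp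
    also have "\<dots> \<le> \<epsilon> * norm \<xi> * 1"
      using \<open>\<epsilon> > 0\<close> by (intro mult_left_mono) (auto simp: divide_le_eq_1 intro: add_nonneg_pos)
    finally show ?thesis by simp
  qed
  ultimately show "\<exists>gs. set gs \<subseteq> {\<lambda>x. \<omega> (minner F y x) | \<omega> y. \<omega> \<in> predual} \<and>
      (\<forall>\<xi>\<in>UNIV. cmod (cinner x (t \<xi> h) - (\<Sum>g\<leftarrow>gs. g \<xi>)) \<le> \<epsilon> * norm \<xi>)"
    by blast
qed

text \<open>The elementary tensors span the Fock module only up to ultraweak closure, so norm
  estimates do not reach all of it. The functionals of \<open>vector_functional_module\<close> are
  ultraweakly continuous and do.\<close>

lemma V_total:
  assumes "\<And>n h. cinner x (V n h) = 0"
  shows "x = 0"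
proof (rule total_ext)
  fix \<xi> h
  define f where "f \<xi> = cinner x (t \<xi> h)" for \<xi>
  have f: "f \<in> module_predual F" unfolding f_def[abs_def] by (rule vector_functional_module)
  have f_span: "f \<eta> = 0" if "\<eta> \<in> cspan S" "\<And>\<eta>. \<eta> \<in> S \<Longrightarrow> f \<eta> = 0" for \<eta> S
  proof -
    have "csubspace {\<eta>. f \<eta> = 0}"
      unfolding cvs.subspace_def f_def
      by (auto simp: t_add_left t_scaleC_left cinner_add_right cinner_scaleC_right
          simp del: cinner_zero_left) (metis cinner_zero_right cvs.scale_zero_left t_scaleC_left)
    then have "cspan S \<subseteq> {\<eta>. f \<eta> = 0}" using that(2) by (intro cvs.span_minimal) auto
    then show ?thesis using that(1) by blast
  qed
  have fe: "f (ract F (e n) a) = 0" for n a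
    using assms[of n "\<pi> a h"] by (simp add: f_def t_ract V_def)
  have ft: "f \<eta> = 0" if "\<eta> \<in> tensor_power F n" for n \<eta>
  proof (cases "n = 0")
    case True
    then show ?thesis using that fe by (auto simp: tensor_power_def vac_eq)
  next
    case False
    then have "\<eta> \<in> module_ultraweak F closure_of (cspan (tens F ` {\<xi>s. length \<xi>s = n}))"
      using that by (simp add: tensor_power_def)
    then show ?thesis
      unfolding module_ultraweak_def
    proof (rule weak_closure_annihilator[OF _ f])
      fix \<zeta> assume "\<zeta> \<in> cspan (tens F ` {\<xi>s. length \<xi>s = n})"
      then show "f \<zeta> = 0"
        by (rule f_span) (use False in \<open>auto simp: tens_eq fe simp flip: length_greater_0_conv\<close>)
    qed
  qed
  have "\<xi> \<in> module_ultraweak F closure_of (cspan (\<Union>n. tensor_power F n))"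
    by (simp add: total)
  then show "cinner x (t \<xi> h) = 0"
    unfolding f_def[symmetric] module_ultraweak_def
    by (rule weak_closure_annihilator[OF _ f]) (erule f_span, use ft in blast)
qed

lemma W_total: "(\<And>n. W n x = W n y) \<Longrightarrow> x = y"
proof -
  assume *: "\<And>n. W n x = W n y"
  have "cinner (x - y) (V n h) = 0" for n h
    using * by (simp add: W_left[symmetric] bcl_diff[OF W_bcl])
  then have "x - y = 0" by (rule V_total)
  then show ?thesis by simp
qed

definition P :: "nat \<Rightarrow> 'k \<Rightarrow> 'k" where "P N x = (\<Sum>i<N. V i (W i x))"

lemma P_bcl: "bounded_clinear (P N)"
  unfolding P_def by (rule bcl_setsum[OF finite_lessThan bcl_compose[OF V_bcl W_bcl]])

lemma W_P: "W j (P N x) = (if j < N then W j x else 0)"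
proof (cases "j < N")
  case False
  then show ?thesis unfolding P_def bcl_sum[OF W_bcl] by (simp add: W_V)
qed (simp add: P_def W_sum)

lemma norm_P: "norm (P N x) \<le> norm x"
proof -
  have "cinner (P N x) (x - P N x) = 0"
    unfolding P_def[of N x] cinner_sum_left W_right[symmetric]
    by (simp add: bcl_diff[OF W_bcl] W_sum)
  from norm_le_of_orth[OF this] show ?thesis by simp
qed

lemma P_tendsto: "(\<lambda>N. P N x) \<longlonglongrightarrow> x"
proof -
  define L where "L = {x. \<exists>M. \<forall>N\<ge>M. P N x = x}"
  have L: "csubspace L"
    unfolding cvs.subspace_def L_def
  proof (intro conjI ballI allI CollectI)
    show "\<exists>M. \<forall>N\<ge>M. P N 0 = 0" by (simp add: bcl_0[OF P_bcl])
    show "\<exists>M. \<forall>N\<ge>M. P N (x + y) = x + y"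
      if x: "x \<in> {x. \<exists>M. \<forall>N\<ge>M. P N x = x}" and y: "y \<in> {x. \<exists>M. \<forall>N\<ge>M. P N x = x}" for x y
    proof -
      obtain M M' where "\<And>N. N \<ge> M \<Longrightarrow> P N x = x" "\<And>N. N \<ge> M' \<Longrightarrow> P N y = y" using x y by blast
      then show ?thesis by (intro exI[of _ "max M M'"]) (simp add: bcl_add[OF P_bcl])
    qed
    show "\<exists>M. \<forall>N\<ge>M. P N (c *\<^sub>C x) = c *\<^sub>C x" if "x \<in> {x. \<exists>M. \<forall>N\<ge>M. P N x = x}" for c x
      using that by (auto simp: bcl_scaleC[OF P_bcl])
  qed
  have VL: "V n h \<in> L" for n h
  proof -
    have "P N (V n h) = V n h" if "N \<ge> Suc n" for N
      by (rule W_total) (use that in \<open>auto simp: W_P W_V\<close>)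
    then show ?thesis by (auto simp: L_def)
  qed
  have "closure L = UNIV"
    by (rule closure_eq_UNIV_of_orth[OF L V_total], rule cinner_eq_0_swap) (use VL in blast)
  show ?thesis
  proof (rule LIMSEQ_I)
    fix r :: real assume "r > 0"
    then obtain y where y: "y \<in> L" "dist y x < r / 2"
      using \<open>closure L = UNIV\<close> closure_approachable[of x L] by (metis UNIV_I half_gt_zero)
    then obtain M where M: "\<And>N. N \<ge> M \<Longrightarrow> P N y = y" by (auto simp: L_def)
    have "norm (P N x - x) < r" if "N \<ge> M" for N
    proof -
      have "P N x - x = P N (x - y) + (y - x)" by (simp add: bcl_diff[OF P_bcl] M[OF that])
      also have "norm \<dots> \<le> norm (x - y) + norm (y - x)"
        by (rule order.trans[OF norm_triangle_ineq add_right_mono[OF norm_P]])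
      also have "\<dots> < r" using y(2) by (simp add: dist_norm norm_minus_commute)
      finally show ?thesis .
    qed
    then show "\<exists>no. \<forall>n\<ge>no. norm (P n x - x) < r" by blast
  qed
qed

text \<open>X \<otimes> I on formal sums: before its boundedness is established, it is not known to
  respect equality of the vectors \<open>tsum ps\<close>.\<close>

definition mapt :: "('f \<Rightarrow> 'f) \<Rightarrow> ('f \<times> 'h) list \<Rightarrow> ('f \<times> 'h) list"
  where "mapt X ps = map (\<lambda>p. (X (fst p), snd p)) ps"

lemma mapt_append: "mapt X (ps @ qs) = mapt X ps @ mapt X qs"
  by (simp add: mapt_def)

lemma mapt_mapt: "mapt X (mapt Y ps) = mapt (X \<circ> Y) ps"
  by (simp add: mapt_def)

lemma tsum_mapt_adjoint:
  assumes XY: "F.module_adjoint X Y"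
  shows "cinner (tsum (mapt X ps)) (tsum qs) = cinner (tsum ps) (tsum (mapt Y qs))"
proof -
  have 1: "cinner (t (X \<xi>) h) (tsum qs) = cinner (t \<xi> h) (tsum (mapt Y qs))" for \<xi> h
    using XY by (induction qs) (simp_all add: mapt_def cinner_add_right t_inner F.module_adjoint_def)
  show ?thesis
    by (induction ps) (simp_all add: mapt_def cinner_add_left 1[unfolded mapt_def])
qed

text \<open>The norm of \<open>X \<otimes> I\<close> on a finite sum \<open>u\<close> of elementary tensors is estimated by applying the
  Cauchy-Schwarz inequality to \<open>\<langle>u, (X\<^sup>*X)\<^sup>n u\<rangle>\<close>, \<open>n = 2\<^sup>k\<close>, and letting \<open>k\<close> tend to infinity; complete
  positivity is not needed.\<close>

lemma norm_tsum_mapt: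
  assumes XY: "F.module_adjoint X Y"
  shows "norm (tsum (mapt X ps)) \<le> 2 * onorm X * norm (tsum ps)"
proof -
  define Q where "Q = Y \<circ> X"
  have QQ: "F.module_adjoint Q Q"
    unfolding Q_def by (rule F.module_adjoint_compose[OF F.module_adjoint_sym[OF XY] XY])
  have Qn: "F.module_adjoint (Q ^^ n) (Q ^^ n)" for n
  proof (induction n)
    case (Suc n)
    show ?case
      using F.module_adjoint_compose[OF QQ Suc]
      by (simp only: funpow.simps(2)[symmetric] funpow_Suc_right[symmetric])
  qed (simp add: F.module_adjoint_def)
  note X = F.module_adjoint_bcl[OF XY] and Y = F.module_adjoint_bcl[OF F.module_adjoint_sym[OF XY]]
    and Q = F.module_adjoint_bcl[OF QQ]
  have oX: "0 \<le> onorm X" and oQ: "0 \<le> onorm Q"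
    using onorm_pos_le bounded_clinear_bl X Q by blast+
  have "onorm Q \<le> onorm Y * onorm X"
    unfolding Q_def by (rule onorm_compose[OF bounded_clinear_bl[OF Y] bounded_clinear_bl[OF X]])
  also have "\<dots> \<le> 4 * onorm X * onorm X"
    by (rule mult_right_mono[OF F.module_adjoint_onorm[OF XY] oX])
  \<comment> \<open>The factor 4 becomes the 2 of the conclusion when the square root is taken at
    the end.\<close>
  finally have QX: "onorm Q \<le> 4 * onorm X * onorm X" .
  define p where "p k = norm (tsum (mapt (Q ^^ 2 ^ k) ps))" for k
  define n where "n = norm (tsum ps)"
  have sq: "(p k)\<^sup>2 \<le> n * p (Suc k)" for k
  proof -
    have "(p k)\<^sup>2 = Re (cinner (tsum (mapt (Q ^^ 2 ^ k) ps)) (tsum (mapt (Q ^^ 2 ^ k) ps)))"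
      by (simp add: p_def Re_cinner_self)
    also have "\<dots> = Re (cinner (tsum ps) (tsum (mapt (Q ^^ 2 ^ Suc k) ps)))"
      unfolding tsum_mapt_adjoint[OF Qn] mapt_mapt by (simp add: funpow_add[symmetric] mult_2)
    also have "\<dots> \<le> norm (tsum ps) * norm (tsum (mapt (Q ^^ 2 ^ Suc k) ps))"
      using complex_Re_le_cmod cinner_Cauchy_Schwarz order.trans by blast
    finally show ?thesis by (simp only: p_def n_def)
  qed
  define C where "C = (\<Sum>p\<leftarrow>ps. norm (fst p) * norm (snd p))"
  have Qpow: "norm ((Q ^^ m) \<xi>) \<le> onorm Q ^ m * norm \<xi>" for m \<xi>
  proof (induction m)
    case (Suc m)
    have "norm ((Q ^^ Suc m) \<xi>) \<le> onorm Q * norm ((Q ^^ m) \<xi>)" by (simp add: bcl_norm[OF Q])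
    also have "\<dots> \<le> onorm Q * (onorm Q ^ m * norm \<xi>)" by (rule mult_left_mono[OF Suc oQ])
    finally show ?case by (simp add: mult_ac)
  qed simp
  \<comment> \<open>A crude bound that depends on the chosen list; its constant disappears in
    \<open>bound_from_squares\<close>.\<close>
  have le: "p k \<le> C * onorm Q ^ 2 ^ k" for k
    unfolding p_def C_def
  proof (induction ps)
    case (Cons q ps)
    have "norm (t ((Q ^^ 2 ^ k) (fst q)) (snd q)) \<le> norm ((Q ^^ 2 ^ k) (fst q)) * norm (snd q)"
      by (rule norm_t)
    also have "\<dots> \<le> onorm Q ^ 2 ^ k * norm (fst q) * norm (snd q)"
      by (rule mult_right_mono[OF Qpow]) simp
    finally have q: "norm (t ((Q ^^ 2 ^ k) (fst q)) (snd q)) \<le> norm (fst q) * norm (snd q) * onorm Q ^ 2 ^ k"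
      by (simp add: mult_ac)
    have "tsum (mapt (Q ^^ 2 ^ k) (q # ps)) = t ((Q ^^ 2 ^ k) (fst q)) (snd q) + tsum (mapt (Q ^^ 2 ^ k) ps)"
      by (simp add: mapt_def)
    then show ?case
      by (simp only: list.map sum_list.Cons distrib_right)
        (rule order.trans[OF norm_triangle_ineq add_mono[OF q Cons]])
  qed (simp add: mapt_def)
  have "p 0 \<le> n * onorm Q"
    by (rule bound_from_squares[OF sq le]) (simp_all add: p_def n_def oQ)
  then have p0: "norm (tsum (mapt Q ps)) \<le> n * onorm Q" by (simp add: p_def)
  have "(norm (tsum (mapt X ps)))\<^sup>2 = Re (cinner (tsum ps) (tsum (mapt Q ps)))"
    unfolding Re_cinner_self[symmetric] tsum_mapt_adjoint[OF XY] mapt_mapt Q_def ..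
  also have "\<dots> \<le> norm (tsum ps) * norm (tsum (mapt Q ps))"
    using complex_Re_le_cmod cinner_Cauchy_Schwarz order.trans by blast
  also have "\<dots> \<le> n * (n * (4 * onorm X * onorm X))"
    unfolding n_def[symmetric]
    by (intro mult_left_mono order.trans[OF p0] QX) (simp_all add: n_def)
  also have "\<dots> = (2 * onorm X * n)\<^sup>2" by (simp add: power2_eq_square)
  finally show ?thesis
    unfolding n_def by (rule power2_le_imp_le) (use oX in simp)
qed

lemma induced_exists:
  assumes X: "X \<in> adjointable F"
  shows "\<exists>Z. bounded_clinear Z \<and> (\<forall>\<xi> h. Z (t \<xi> h) = t (X \<xi>) h) \<and> (\<forall>v. norm (Z v) \<le> 2 * onorm X * norm v)"
proof -
  obtain Y where XY: "F.module_adjoint X Y" using X F.adjointable_iff by blast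
  define G where "G = range (\<lambda>ps. (tsum ps, tsum (mapt X ps)))"
  have "\<exists>Z. bounded_clinear Z \<and> (\<forall>u w. (u, w) \<in> G \<longrightarrow> Z u = w) \<and> (\<forall>v. norm (Z v) \<le> 2 * onorm X * norm v)"
  proof (rule bounded_graph_extension)
    show "(u + u', w + w') \<in> G" if "(u, w) \<in> G" "(u', w') \<in> G" for u w u' w'
    proof -
      obtain ps qs where "u = tsum ps" "w = tsum (mapt X ps)" "u' = tsum qs" "w' = tsum (mapt X qs)"
        using \<open>(u, w) \<in> G\<close> \<open>(u', w') \<in> G\<close> unfolding G_def by blast
      then show ?thesis
        unfolding G_def by (intro range_eqI[of _ _ "ps @ qs"]) (simp add: mapt_append)
    qed
    show "(c *\<^sub>C u, c *\<^sub>C w) \<in> G" if "(u, w) \<in> G" for c u w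
    proof -
      obtain ps where ps: "u = tsum ps" "w = tsum (mapt X ps)"
        using \<open>(u, w) \<in> G\<close> unfolding G_def by blast
      define qs where "qs = map (\<lambda>p. (fst p, c *\<^sub>C snd p)) ps"
      have "mapt X qs = map (\<lambda>p. (fst p, c *\<^sub>C snd p)) (mapt X ps)"
        by (simp add: mapt_def qs_def)
      then show ?thesis
        unfolding G_def ps by (intro range_eqI[of _ _ qs]) (simp add: tsum_scale qs_def)
    qed
    show "norm w \<le> 2 * onorm X * norm u" if "(u, w) \<in> G" for u w
      using that norm_tsum_mapt[OF XY] by (auto simp: G_def)
    have "fst ` G = range tsum" by (force simp: G_def)
    then show "closure (fst ` G) = UNIV"
      using tsum_dense by (auto simp: closure_approachable dist_norm norm_minus_commute)
  qed
  then obtain Z where Z: "bounded_clinear Z" "\<And>u w. (u, w) \<in> G \<Longrightarrow> Z u = w"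
    "\<And>v. norm (Z v) \<le> 2 * onorm X * norm v" by blast
  have "Z (t \<xi> h) = t (X \<xi>) h" for \<xi> h
    by (rule Z(2)) (auto simp: G_def mapt_def intro!: range_eqI[of _ _ "[(\<xi>, h)]"])
  then show ?thesis using Z by blast
qed

lemma induced_eqI:
  assumes Z: "bounded_clinear Z" "\<And>\<xi> h. Z (t \<xi> h) = t (X \<xi>) h"
  shows "induced t X = Z"
  unfolding induced_def
proof (rule the_equality)
  show "Z \<in> bounded_operators \<and> (\<forall>\<xi> h. Z (t \<xi> h) = t (X \<xi>) h)"
    using Z by (simp add: bounded_operators_def)
  fix Y assume Y: "Y \<in> bounded_operators \<and> (\<forall>\<xi> h. Y (t \<xi> h) = t (X \<xi>) h)"
  then have Yb: "bounded_clinear Y" by (simp add: bounded_operators_def)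
  show "Y = Z"
  proof
    fix u
    have "adj Y v = adj Z v" for v
    proof -
      have "cinner (adj Y v - adj Z v) (t \<xi> h) = 0" for \<xi> h
        using Y Z by (simp add: cinner_diff_left adj_left[OF Yb] adj_left[OF Z(1)])
      then have "adj Y v - adj Z v = 0" by (rule total_ext)
      then show ?thesis by simp
    qed
    then show "Y u = Z u"
      by (intro cinner_ext) (simp add: adj_left[OF Yb, symmetric] adj_left[OF Z(1), symmetric])
  qed
qed

lemma
  assumes X: "X \<in> adjointable F"
  shows induced_bcl: "bounded_clinear (induced t X)"
    and induced_t: "induced t X (t \<xi> h) = t (X \<xi>) h"
    and induced_norm: "norm (induced t X v) \<le> 2 * onorm X * norm v"
proof -
  obtain Z where Z: "bounded_clinear Z" "\<And>\<xi> h. Z (t \<xi> h) = t (X \<xi>) h"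
    "\<And>v. norm (Z v) \<le> 2 * onorm X * norm v" using induced_exists[OF X] by blast
  note eq = induced_eqI[OF Z(1,2)]
  show "bounded_clinear (induced t X)" "induced t X (t \<xi> h) = t (X \<xi>) h"
    "norm (induced t X v) \<le> 2 * onorm X * norm v"
    unfolding eq by (rule Z)+
qed

end

context fock_factor_rep
begin

section \<open>Invariant subspaces\<close>

lemma induced_tsum: "X \<in> adjointable F \<Longrightarrow> induced t X (tsum ps) = tsum (mapt X ps)"
  by (induction ps) (simp_all add: mapt_def bcl_0[OF induced_bcl] bcl_add[OF induced_bcl] induced_t)

text \<open>Approximating u and v by finite sums of elementary tensors approximates the functional,
  in the dual norm, by finite sums of defining functionals. Thus X \<mapsto> X \<otimes> I is
  continuous from the ultraweak to the weak operator topology.\<close>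

lemma induced_functional: "(\<lambda>X. cinner v (induced t X u)) \<in> adjointable_predual F"
  unfolding adjointable_predual_def closed_sums_def mem_Collect_eq
proof (intro allI impI)
  fix \<epsilon> :: real assume \<epsilon>: "\<epsilon> > 0"
  have "\<epsilon> / (4 * (norm u + 1)) > 0" using \<epsilon> by (simp add: add_nonneg_pos)
  then obtain ps where ps: "norm (v - tsum ps) < \<epsilon> / (4 * (norm u + 1))" using tsum_dense by blast
  \<comment> \<open>The second approximation depends on the first, whose norm enters the
    error.\<close>
  have "\<epsilon> / (4 * (norm (tsum ps) + 1)) > 0" using \<epsilon> by (simp add: add_nonneg_pos)
  then obtain qs where qs: "norm (u - tsum qs) < \<epsilon> / (4 * (norm (tsum ps) + 1))" using tsum_dense by blast
  have small: "x * y \<le> \<epsilon> / 4" if "0 \<le> x" "0 \<le> y" "x < \<epsilon> / (4 * (y + 1))" for x y :: real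
  proof -
    have "x * y \<le> \<epsilon> / (4 * (y + 1)) * (y + 1)"
      using that \<epsilon> by (intro mult_mono) auto
    also have "\<dots> = \<epsilon> / 4" using that(2) by (simp add: field_simps)
    finally show ?thesis .
  qed
  define gs where "gs = concat (map (\<lambda>p. map (\<lambda>q X. cinner (snd p) (\<pi> (minner F (fst p) (X (fst q))) (snd q))) qs) ps)"
  have "set gs \<subseteq> {\<lambda>T. \<omega> (minner F x (T y)) | \<omega> x y. \<omega> \<in> predual}"
  proof
    fix g assume "g \<in> set gs"
    then obtain p q where "g = (\<lambda>X. cinner (snd p) (\<pi> (minner F (fst p) (X (fst q))) (snd q)))"
      by (auto simp: gs_def)
    then show "g \<in> {\<lambda>T. \<omega> (minner F x (T y)) | \<omega> x y. \<omega> \<in> predual}"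
      using vector_functional_predual[of "snd p" "snd q"]
      by (intro CollectI exI[of _ "\<lambda>a. cinner (snd p) (\<pi> a (snd q))"] exI[of _ "fst p"] exI[of _ "fst q"]) simp
  qed
  moreover have "cmod (cinner v (induced t X u) - (\<Sum>g\<leftarrow>gs. g X)) \<le> \<epsilon> * onorm X"
    if X: "X \<in> adjointable F" for X
  proof -
    let ?Z = "induced t X"
    obtain Y where "F.module_adjoint X Y" using X F.adjointable_iff by blast
    then have o: "0 \<le> onorm X" using onorm_pos_le bounded_clinear_bl F.module_adjoint_bcl by blast
    have 1: "(\<Sum>q\<leftarrow>qs. cinner h (\<pi> (minner F \<xi> (X (fst q))) (snd q))) = cinner (t \<xi> h) (tsum (mapt X qs))" for \<xi> h
      by (induction qs) (simp_all add: mapt_def cinner_add_right t_inner)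
    have "(\<Sum>g\<leftarrow>gs. g X) = cinner (tsum ps) (tsum (mapt X qs))"
      unfolding gs_def
      by (induction ps) (simp_all add: cinner_add_left 1[symmetric] comp_def)
    then have "cinner v (?Z u) - (\<Sum>g\<leftarrow>gs. g X) = cinner (v - tsum ps) (?Z u) + cinner (tsum ps) (?Z (u - tsum qs))"
      by (simp add: cinner_diff_left cinner_diff_right bcl_diff[OF induced_bcl[OF X]] induced_tsum[OF X])
    also have "cmod \<dots> \<le> norm (v - tsum ps) * norm (?Z u) + norm (tsum ps) * norm (?Z (u - tsum qs))"
      by (rule order.trans[OF norm_triangle_ineq add_mono[OF cinner_Cauchy_Schwarz cinner_Cauchy_Schwarz]])
    also have "\<dots> \<le> norm (v - tsum ps) * (2 * onorm X * norm u) + norm (tsum ps) * (2 * onorm X * norm (u - tsum qs))"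
      by (intro add_mono mult_left_mono induced_norm[OF X]) auto
    also have "\<dots> = 2 * onorm X * (norm (v - tsum ps) * norm u + norm (u - tsum qs) * norm (tsum ps))"
      by (simp add: algebra_simps)
    also have "\<dots> \<le> 2 * onorm X * (\<epsilon> / 4 + \<epsilon> / 4)"
      using o ps qs by (intro mult_left_mono add_mono small) auto
    finally show ?thesis by (simp add: mult.commute)
  qed
  ultimately show "\<exists>gs. set gs \<subseteq> {\<lambda>T. \<omega> (minner F x (T y)) | \<omega> x y. \<omega> \<in> predual} \<and>
      (\<forall>X\<in>adjointable F. cmod (cinner v (induced t X u) - (\<Sum>g\<leftarrow>gs. g X)) \<le> \<epsilon> * onorm X)"
    by blast
qed

section \<open>Action of the generators, and invariant subspaces as annihilators\<close>

abbreviation generators :: "('f \<Rightarrow> 'f) set"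
  where "generators \<equiv> generated_algebra (range (creation F) \<union> range (lact F))"

lemma generators_adjointable: "Y \<in> generators \<Longrightarrow> Y \<in> adjointable F"
proof (induction rule: generated_algebra.induct)
  case (mult S T)
  then show ?case by (intro F.adjointable_compose)
qed (auto simp: creation_adjointable lact_adjointable F.adjointable_add F.adjointable_scaleC)

lemma hardy_adjointable: "X \<in> hardy_algebra F \<Longrightarrow> X \<in> adjointable F"
  unfolding hardy_algebra_def F.topspace_adjointable[symmetric]
  by (rule subsetD[OF closure_of_subset_topspace])

lemma induced_creation: "induced t (creation F \<xi>) (V n h) = V (Suc n) (\<pi> ((\<alpha> ^^ n) \<xi>) h)"
  unfolding V_def induced_t[OF creation_adjointable] creation_e t_ract ..

lemma induced_lact: "induced t (lact F a) (V n h) = V n (\<pi> ((\<alpha> ^^ n) a) h)"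
  unfolding V_def induced_t[OF lact_adjointable] lact_e t_ract ..

lemma \<alpha>_star: "((\<alpha> ^^ n) a)\<^sup>\<star> = (\<alpha> ^^ n) (a\<^sup>\<star>)"
proof -
  interpret a: automorphism "\<alpha> ^^ n" by standard (rule star_automorphism_funpow[OF \<alpha>])
  show ?thesis by (simp add: a.\<beta>_star)
qed

lemma adj_creation: "W n (adj (induced t (creation F \<xi>)) v) = \<pi> ((\<alpha> ^^ n) (\<xi>\<^sup>\<star>)) (W (Suc n) v)"
proof (rule cinner_ext)
  fix h
  have "cinner h (W n (adj (induced t (creation F \<xi>)) v)) = cinner (V (Suc n) (\<pi> ((\<alpha> ^^ n) \<xi>) h)) v"
    unfolding W_right adj_right[OF induced_bcl[OF creation_adjointable]] induced_creation ..
  also have "\<dots> = cinner h (\<pi> ((\<alpha> ^^ n) (\<xi>\<^sup>\<star>)) (W (Suc n) v))"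
    unfolding W_right[symmetric] star \<alpha>_star ..
  finally show "cinner h (W n (adj (induced t (creation F \<xi>)) v)) = \<dots>" .
qed

lemma adj_lact: "W n (adj (induced t (lact F a)) v) = \<pi> ((\<alpha> ^^ n) (a\<^sup>\<star>)) (W n v)"
proof (rule cinner_ext)
  fix h
  have "cinner h (W n (adj (induced t (lact F a)) v)) = cinner (V n (\<pi> ((\<alpha> ^^ n) a) h)) v"
    unfolding W_right adj_right[OF induced_bcl[OF lact_adjointable]] induced_lact ..
  also have "\<dots> = cinner h (\<pi> ((\<alpha> ^^ n) (a\<^sup>\<star>)) (W n v))"
    unfolding W_right[symmetric] star \<alpha>_star ..
  finally show "cinner h (W n (adj (induced t (lact F a)) v)) = \<dots>" .
qed

text \<open>Invariant subspaces are given as annihilators because the adjoints of the generators act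
  on coordinates by the simple formulas \<open>adj_creation\<close> and \<open>adj_lact\<close>.
  Invariance passes from the generators to the Hardy algebra by
  \<open>induced_functional\<close>.\<close>

lemma annihilator_in_Lat:
  assumes creation: "\<And>v \<xi>. v \<in> N \<Longrightarrow> adj (induced t (creation F \<xi>)) v \<in> N"
    and lact: "\<And>v a. v \<in> N \<Longrightarrow> adj (induced t (lact F a)) v \<in> N"
  shows "{u. \<forall>v\<in>N. cinner v u = 0} \<in> Lat (induced t ` hardy_algebra F)"
proof -
  define L where "L = {u. \<forall>v\<in>N. cinner v u = 0}"
  have "L = (\<Inter>v\<in>N. {u. cinner v u = 0})" by (auto simp: L_def)
  moreover have "closed {u. cinner v u = 0}" for v :: 'k
    by (rule closed_Collect_eq[OF bcl_continuous_on[OF bcl_cinner continuous_on_id] continuous_on_const])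
  ultimately have "closed L" by (simp add: closed_INT)
  have sL: "csubspace L"
    by (auto simp: L_def cvs.subspace_def cinner_add_right cinner_scaleC_right)
  have gen: "induced t Y u \<in> L" if Y: "Y \<in> generators" and u: "u \<in> L" for Y u
    using Y u
  proof (induction arbitrary: u rule: generated_algebra.induct)
    case (gen T)
    have "cinner v (induced t T u) = 0" if "v \<in> N" for v
      using gen(1)
    proof
      assume "T \<in> range (creation F)"
      then obtain \<xi> where "T = creation F \<xi>" by blast
      then show ?thesis
        using adj_left[OF induced_bcl[OF creation_adjointable], of \<xi> v u] creation[OF that, of \<xi>] gen(2)
        by (simp add: L_def)
    next
      assume "T \<in> range (lact F)"
      then obtain a where "T = lact F a" by blast
      then show ?thesis
        using adj_left[OF induced_bcl[OF lact_adjointable], of a v u] lact[OF that, of a] gen(2)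
        by (simp add: L_def)
    qed
    then show ?case by (simp add: L_def)
  next
    case (add S T)
    note S = generators_adjointable[OF add(1)] and T = generators_adjointable[OF add(2)]
    have "induced t (\<lambda>x. S x + T x) = (\<lambda>x. induced t S x + induced t T x)"
      by (rule induced_eqI[OF bcl_plus[OF induced_bcl[OF S] induced_bcl[OF T]]])
        (simp add: induced_t[OF S] induced_t[OF T] t_add_left)
    then show ?case using add cvs.subspace_add[OF sL] by simp
  next
    case (scale T c)
    note T = generators_adjointable[OF scale(1)]
    have "induced t (\<lambda>x. c *\<^sub>C T x) = (\<lambda>x. c *\<^sub>C induced t T x)"
      by (rule induced_eqI[OF bcl_cmult[OF induced_bcl[OF T]]])
        (simp add: induced_t[OF T] t_scaleC_left)
    then show ?case using scale cvs.subspace_scale[OF sL] by simp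
  next
    case (mult S T)
    note S = generators_adjointable[OF mult(1)] and T = generators_adjointable[OF mult(2)]
    have eq: "induced t (S \<circ> T) = (\<lambda>x. induced t S (induced t T x))"
      by (rule induced_eqI[OF bcl_compose[OF induced_bcl[OF S] induced_bcl[OF T]]])
        (simp add: induced_t[OF S] induced_t[OF T])
    show ?case
      unfolding eq by (rule mult.IH(1)[OF mult.IH(2)[OF mult.prems]])
  qed
  have "induced t X u \<in> L" if X: "X \<in> hardy_algebra F" and u: "u \<in> L" for X u
  proof -
    have "cinner v (induced t X u) = 0" if v: "v \<in> N" for v
      using X unfolding hardy_algebra_def adjointable_ultraweak_def
    proof (rule weak_closure_annihilator[OF _ induced_functional])
      show "cinner v (induced t Y u) = 0" if "Y \<in> generators" for Y
        using gen[OF that u] v by (simp add: L_def)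
    qed
    then show ?thesis by (simp add: L_def)
  qed
  then show ?thesis
    unfolding L_def[symmetric] Lat_def using \<open>closed L\<close> sL by blast
qed

lemma AlgLat_annihilator:
  assumes T: "T \<in> AlgLat (induced t ` hardy_algebra F)"
    and creation: "\<And>v \<xi>. v \<in> N \<Longrightarrow> adj (induced t (creation F \<xi>)) v \<in> N"
    and lact: "\<And>v a. v \<in> N \<Longrightarrow> adj (induced t (lact F a)) v \<in> N"
    and u: "\<And>v. v \<in> N \<Longrightarrow> cinner v u = 0" and v: "v \<in> N"
  shows "cinner v (T u) = 0"
proof -
  have inv: "\<forall>L\<in>Lat (induced t ` hardy_algebra F). T ` L \<subseteq> L"
    using T by (simp add: AlgLat_def)
  have "T ` {u. \<forall>v\<in>N. cinner v u = 0} \<subseteq> {u. \<forall>v\<in>N. cinner v u = 0}"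
    by (rule bspec[OF inv annihilator_in_Lat[OF creation lact]])
  moreover have "u \<in> {u. \<forall>v\<in>N. cinner v u = 0}" using u by blast
  ultimately have "T u \<in> {u. \<forall>v\<in>N. cinner v u = 0}" by (rule subsetD[OF _ imageI])
  then show ?thesis using v by simp
qed

lemma AlgLat_bcl: "T \<in> AlgLat \<A> \<Longrightarrow> bounded_clinear T"
  by (simp add: AlgLat_def bounded_operators_def)

text \<open>The vectors supported in the slots below j are preserved by the adjoints of the
  generators and are orthogonal to \<open>V j h\<close>.\<close>

lemma AlgLat_triangular:
  assumes T: "T \<in> AlgLat (induced t ` hardy_algebra F)" and ij: "i < j"
  shows "W i (T (V j h)) = 0"
proof (rule cinner_ext)
  fix k
  have "cinner (V i k) (T (V j h)) = 0"
  proof (rule AlgLat_annihilator[OF T, of "{v. \<forall>n\<ge>j. W n v = 0}"])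
    show "cinner v (V j h) = 0" if "v \<in> {v. \<forall>n\<ge>j. W n v = 0}" for v
      using that by (simp add: W_left[symmetric])
    show "V i k \<in> {v. \<forall>n\<ge>j. W n v = 0}"
      using ij by (auto simp: W_V)
  qed (auto simp: adj_creation adj_lact bcl_0[OF bcl])
  then show "cinner k (W i (T (V j h))) = cinner k 0"
    by (simp add: W_right)
qed

text \<open>The subspace annihilating the vectors with \<open>W (i + m) v = \<mu> Z (W i v)\<close>, \<open>i \<ge> k\<close>, is invariant for
  every intertwiner \<open>Z\<close> of \<open>\<pi>\<close> and \<open>\<pi> \<circ> \<alpha>\<^sup>m\<close>. To first order in \<open>\<mu>\<close> this yields a relation between
  matrix entries that are \<open>m\<close> steps apart on the same diagonal.\<close>

lemma AlgLat_intertwine_contraction: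
  assumes T: "T \<in> AlgLat (induced t ` hardy_algebra F)"
    and Z: "Z \<in> intertwiners (\<alpha> ^^ m)" and Z1: "\<And>h. norm (Z h) \<le> norm h" and nm: "n < m"
  shows "W (k + n) (T (V k (adj Z g))) = adj Z (W (k + n + m) (T (V (k + m) g)))"
proof (rule cinner_ext)
  fix h
  have Zb: "bounded_clinear Z" and Z\<pi>: "\<And>a h. Z (\<pi> a h) = \<pi> ((\<alpha> ^^ m) a) (Z h)"
    using Z by (auto simp: intertwiners_def)
  note Tb = AlgLat_bcl[OF T]
  have Zn: "norm ((Z ^^ l) h) \<le> norm h" for l
    by (induction l) (auto intro: order.trans[OF Z1])
  define x y where "x = T (V (k + m) g)" "y = T (V k (adj Z g))"
  define b c where "b = cinner (V (k + n) h) y" "c = cinner (V (k + n + m) (Z h)) x"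
  define K where "K = cmod (cinner (V (k + n + m) (Z h)) y) + 2 * norm h * (norm x + norm y)"
  have K0: "K \<ge> 0" by (simp add: K_def)
  have main: "cmod (c - b) \<le> \<mu> * K" if \<mu>: "0 < \<mu>" "\<mu> \<le> 1/2" for \<mu> :: real
  proof -
    define N where "N = {v. \<forall>i\<ge>k. W (i + m) v = \<mu> *\<^sub>R Z (W i v)}"
    \<comment> \<open>The vectors f l are the terms of an element v of N that starts with h in slot
      k + n; every further m slots contribute a factor \<mu> Z.\<close>
    define f where "f l = \<mu> ^ l *\<^sub>R V (k + n + l * m) ((Z ^^ l) h)" for l
    have nf: "norm (f l) \<le> \<mu> ^ l * norm h" for l
      using \<mu> Zn[of l] by (simp add: f_def norm_V mult_left_mono)
    have geo: "summable (\<lambda>l. \<mu> ^ l * norm h)"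
      using \<mu> by (intro summable_mult2 summable_geometric) simp
    have sf: "summable f"
      by (rule summable_comparison_test'[OF geo nf])
    define v where "v = suminf f"
    have Wv: "W j v = (\<Sum>l. W j (f l))" and Ws: "summable (\<lambda>l. W j (f l))" for j
      unfolding v_def
      by (rule bounded_linear.suminf[OF bounded_clinear_bl[OF W_bcl] sf],
          rule bounded_linear.summable[OF bounded_clinear_bl[OF W_bcl] sf])
    have Wf: "W j (f l) = (if j = k + n + l * m then \<mu> ^ l *\<^sub>R (Z ^^ l) h else 0)" for j l
      by (simp add: f_def bcl_scaleR[OF W_bcl] W_V)
    have vN: "v \<in> N"
      unfolding N_def
    proof (intro CollectI allI impI)
      fix i assume "k \<le> i"
      \<comment> \<open>Since n < m, the initial slot k + n lies below all slots i + m whose entries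
        N prescribes.\<close>
      have 0: "W (i + m) (f 0) = 0" using nm \<open>k \<le> i\<close> by (simp add: Wf)
      have S: "W (i + m) (f (Suc l)) = \<mu> *\<^sub>R Z (W i (f l))" for l
        by (simp add: Wf bcl_scaleR[OF Zb] bcl_0[OF Zb])
      have "W (i + m) v = (\<Sum>l. W (i + m) (f (Suc l)))"
        using suminf_split_head[OF Ws, of "i + m"] by (simp add: Wv 0)
      also have "\<dots> = \<mu> *\<^sub>R Z (W i v)"
        unfolding S Wv bounded_linear.suminf[OF bounded_clinear_bl[OF Zb] Ws]
        by (rule suminf_scaleR_right[symmetric], rule bounded_linear.summable[OF bounded_clinear_bl[OF Zb] Ws])
      finally show "W (i + m) v = \<mu> *\<^sub>R Z (W i v)" .
    qed
    \<comment> \<open>Orthogonality of u to N is the defining condition of N at i = k.\<close>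
    define u where "u = V (k + m) g - \<mu> *\<^sub>R V k (adj Z g)"
    have "cinner v (T u) = 0"
    proof (rule AlgLat_annihilator[OF T, of N])
      have am: "(\<alpha> ^^ (i + m)) a = (\<alpha> ^^ m) ((\<alpha> ^^ i) a)" for i a
        by (simp add: add.commute[of i m] funpow_add)
      have rel: "\<pi> ((\<alpha> ^^ (i + m)) a) (\<mu> *\<^sub>R Z x) = \<mu> *\<^sub>R Z (\<pi> ((\<alpha> ^^ i) a) x)" for i a x
        unfolding am bcl_scaleR[OF bcl] Z\<pi> ..
      show "adj (induced t (creation F \<xi>)) w \<in> N" if w: "w \<in> N" for w \<xi>
        unfolding N_def
      proof (intro CollectI allI impI)
        fix i assume "k \<le> i"
        then have "W (Suc i + m) w = \<mu> *\<^sub>R Z (W (Suc i) w)"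
          using w unfolding N_def by (blast intro: le_SucI)
        then show "W (i + m) (adj (induced t (creation F \<xi>)) w) = \<mu> *\<^sub>R Z (W i (adj (induced t (creation F \<xi>)) w))"
          unfolding adj_creation rel[symmetric] by simp
      qed
      show "adj (induced t (lact F a)) w \<in> N" if w: "w \<in> N" for w a
        unfolding N_def
      proof (intro CollectI allI impI)
        fix i assume "k \<le> i"
        then have "W (i + m) w = \<mu> *\<^sub>R Z (W i w)"
          using w unfolding N_def by blast
        then show "W (i + m) (adj (induced t (lact F a)) w) = \<mu> *\<^sub>R Z (W i (adj (induced t (lact F a)) w))"
          unfolding adj_lact rel[symmetric] by simp
      qed
      show "cinner w u = 0" if "w \<in> N" for w
      proof -
        have "W (k + m) w = \<mu> *\<^sub>R Z (W k w)" using that by (simp add: N_def)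
        then show ?thesis
          by (simp add: u_def cinner_diff_right cinner_scaleR_right cinner_scaleR_left W_left[symmetric] adj_right[OF Zb])
      qed
      show "v \<in> N" by (rule vN)
    qed
    moreover have "T u = x - \<mu> *\<^sub>R y"
      by (simp add: u_def x_y_def bcl_diff[OF Tb] bcl_scaleR[OF Tb])
    moreover define r where "r = (\<Sum>l. f (l + 2))"
    have "v = r + (\<Sum>l<2. f l)"
      unfolding v_def r_def by (rule suminf_split_initial_segment[OF sf])
    then have "v = V (k + n) h + \<mu> *\<^sub>R V (k + n + m) (Z h) + r"
      by (simp add: f_def numeral_2_eq_2)
    \<comment> \<open>Triangularity removes the term of order 0 in \<mu>, so that c - b is the
      coefficient of order 1.\<close>
    moreover have "cinner (V (k + n) h) x = 0"
      using AlgLat_triangular[OF T, of "k + n" "k + m" g] nm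
      by (simp add: W_right[symmetric] x_y_def)
    ultimately have "of_real \<mu> * (c - b) = of_real (\<mu>\<^sup>2) * cinner (V (k + n + m) (Z h)) y - cinner r (x - \<mu> *\<^sub>R y)"
      by (simp add: b_c_def cinner_add_left cinner_diff_right cinner_scaleR_left cinner_scaleR_right
          power2_eq_square algebra_simps)
    then have "\<mu> * cmod (c - b) = cmod (of_real (\<mu>\<^sup>2) * cinner (V (k + n + m) (Z h)) y - cinner r (x - \<mu> *\<^sub>R y))"
      using \<mu> by (metis abs_of_pos norm_mult norm_of_real)
    also have "\<dots> \<le> \<mu>\<^sup>2 * cmod (cinner (V (k + n + m) (Z h)) y) + norm r * norm (x - \<mu> *\<^sub>R y)"
      by (intro order.trans[OF norm_triangle_ineq4] add_mono cinner_Cauchy_Schwarz)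
        (simp add: norm_mult norm_power)
    also have "\<dots> \<le> \<mu>\<^sup>2 * cmod (cinner (V (k + n + m) (Z h)) y) + (\<mu>\<^sup>2 * (2 * norm h)) * (norm x + norm y)"
    proof (intro add_mono mult_mono order.refl)
      show "norm (x - \<mu> *\<^sub>R y) \<le> norm x + norm y"
      proof -
        have "\<mu> * norm y \<le> 1 * norm y" using \<mu> by (intro mult_right_mono) auto
        then show ?thesis using norm_triangle_ineq4[of x "\<mu> *\<^sub>R y"] \<mu> by simp
      qed
      have half: "(\<lambda>l. \<mu>\<^sup>2 * norm h * (1/2) ^ l) sums (\<mu>\<^sup>2 * norm h * (1 / (1 - 1/2)))"
        by (intro sums_mult geometric_sums) simp
      have le: "norm (f (l + 2)) \<le> \<mu>\<^sup>2 * norm h * (1/2) ^ l" for l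
      proof -
        have "norm (f (l + 2)) \<le> \<mu> ^ (l + 2) * norm h" by (rule nf)
        also have "\<dots> = \<mu>\<^sup>2 * norm h * \<mu> ^ l" by (simp add: power_add mult_ac power2_eq_square)
        also have "\<dots> \<le> \<mu>\<^sup>2 * norm h * (1/2) ^ l"
          using \<mu> by (intro mult_left_mono power_mono) auto
        finally show ?thesis .
      qed
      have "norm r \<le> (\<Sum>l. \<mu>\<^sup>2 * norm h * (1/2) ^ l)"
        unfolding r_def by (rule norm_suminf_le[OF le sums_summable[OF half]])
      also have "\<dots> = \<mu>\<^sup>2 * (2 * norm h)" unfolding sums_unique[OF half, symmetric] by simp
      finally show "norm r \<le> \<mu>\<^sup>2 * (2 * norm h)" .
    qed auto
    also have "\<dots> = \<mu> * (\<mu> * K)" by (simp add: K_def power2_eq_square algebra_simps)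
    finally show ?thesis using \<mu> by simp
  qed
  have "c = b"
  proof (rule ccontr)
    assume "c \<noteq> b"
    define d where "d = cmod (c - b)"
    have d: "d > 0" using \<open>c \<noteq> b\<close> by (simp add: d_def)
    define \<mu> where "\<mu> = min (1/2) (d / (2 * (K + 1)))"
    have "d / (2 * (K + 1)) > 0" using d K0 by simp
    then have \<mu>: "0 < \<mu>" "\<mu> \<le> 1/2" "\<mu> \<le> d / (2 * (K + 1))"
      unfolding \<mu>_def by linarith+
    have "d \<le> \<mu> * K" using main[OF \<mu>(1,2)] by (simp add: d_def)
    also have "\<dots> \<le> d / (2 * (K + 1)) * (K + 1)" using \<mu> K0 d by (intro mult_mono) auto
    also have "\<dots> = d / 2" using K0 by (simp add: field_simps)
    finally show False using d by simp
  qed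
  then show "cinner h (W (k + n) (T (V k (adj Z g)))) = cinner h (adj Z (W (k + n + m) (T (V (k + m) g))))"
    by (simp add: adj_right[OF Zb] W_right b_c_def x_y_def)
qed

text \<open>Both sides scale alike in Z. Dividing by \<open>onorm Z + 1\<close> instead of the norm
  also covers Z = 0.\<close>

lemma AlgLat_intertwine:
  assumes T: "T \<in> AlgLat (induced t ` hardy_algebra F)"
    and Z: "Z \<in> intertwiners (\<alpha> ^^ m)" and nm: "n < m"
  shows "W (k + n) (T (V k (adj Z g))) = adj Z (W (k + n + m) (T (V (k + m) g)))"
proof -
  have Zb: "bounded_clinear Z" and Z\<pi>: "\<And>a h. Z (\<pi> a h) = \<pi> ((\<alpha> ^^ m) a) (Z h)"
    using Z by (auto simp: intertwiners_def)
  note Tb = AlgLat_bcl[OF T]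
  define s where "s = onorm Z + 1"
  have s: "s > 0" using onorm_pos_le[OF bounded_clinear_bl[OF Zb]] by (simp add: s_def)
  define Z' where "Z' h = of_real (1 / s) *\<^sub>C Z h" for h
  have Z'b: "bounded_clinear Z'" unfolding Z'_def by (rule bcl_cmult[OF Zb])
  have "Z' \<in> intertwiners (\<alpha> ^^ m)"
    unfolding intertwiners_def using Z'b by (simp add: Z'_def Z\<pi> bcl_scaleC[OF bcl])
  moreover have "norm (Z' h) \<le> norm h" for h
  proof -
    have "norm (Z h) \<le> s * norm h"
      using bcl_norm[OF Zb, of h] by (simp add: s_def distrib_right add_increasing2)
    then show ?thesis using s by (simp add: Z'_def norm_scaleC norm_divide field_simps)
  qed
  ultimately have eq: "W (k + n) (T (V k (adj Z' g))) = adj Z' (W (k + n + m) (T (V (k + m) g)))"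
    by (rule AlgLat_intertwine_contraction[OF T _ _ nm])
  have a: "adj Z' x = of_real (1 / s) *\<^sub>C adj Z x" for x
    by (rule cinner_ext) (simp add: adj_right[OF Z'b] adj_right[OF Zb] Z'_def cinner_scaleC_left cinner_scaleC_right)
  have "of_real (1 / s) *\<^sub>C W (k + n) (T (V k (adj Z g))) = of_real (1 / s) *\<^sub>C adj Z (W (k + n + m) (T (V (k + m) g)))"
    using eq unfolding a bcl_scaleC[OF V_bcl] bcl_scaleC[OF Tb] bcl_scaleC[OF W_bcl] .
  then show ?thesis using s by simp
qed

text \<open>The common kernel of the intertwiners is invariant under \<pi> M and the commutant, so
  it is 0 or everything; \<open>exists_intertwiner\<close> excludes the latter. Hence the ranges of
  the adjoint intertwiners span a dense subspace.\<close>

lemma intertwiner_ranges_total: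
  fixes B :: "'h \<Rightarrow> 'h"
  assumes B: "bounded_clinear B" and \<beta>: "star_automorphism \<beta>"
    and zero: "\<And>Z g. Z \<in> intertwiners \<beta> \<Longrightarrow> B (adj Z g) = 0"
  shows "B x = 0"
proof -
  define L where "L = {x. \<forall>Z\<in>intertwiners \<beta>. Z x = 0}"
  have Zb: "bounded_clinear Z" and Z\<pi>: "Z (\<pi> a h) = \<pi> (\<beta> a) (Z h)" if "Z \<in> intertwiners \<beta>" for Z a h
    using that by (auto simp: intertwiners_def)
  have "L = {0} \<or> L = UNIV"
  proof (rule trivial_reducing)
    show "csubspace L"
      unfolding cvs.subspace_def L_def
      by (auto simp: bcl_0[OF Zb] bcl_add[OF Zb] bcl_scaleC[OF Zb])
    have "L = (\<Inter>Z\<in>intertwiners \<beta>. {x. Z x = 0})" by (auto simp: L_def)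
    moreover have "closed {x. Z x = 0}" if "Z \<in> intertwiners \<beta>" for Z
      by (rule closed_Collect_eq[OF bcl_continuous_on[OF Zb[OF that] continuous_on_id] continuous_on_const])
    ultimately show "closed L" by (simp add: closed_INT)
    show "\<pi> a h \<in> L" if "h \<in> L" for a h
      using that by (auto simp: L_def Z\<pi> bcl_0[OF bcl])
    show "y h \<in> L" if y: "y \<in> commutant" and h: "h \<in> L" for y h
      unfolding L_def
    proof (intro CollectI ballI)
      fix Z assume Z: "Z \<in> intertwiners \<beta>"
      have Zy: "(\<lambda>x. Z (y x)) \<in> intertwiners \<beta>"
        using y Z by (simp add: intertwiners_def commutant_def bcl_compose)
      have "\<forall>Z\<in>intertwiners \<beta>. Z h = 0" using h by (simp add: L_def)
      from bspec[OF this Zy] show "Z (y h) = 0" .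
    qed
  qed
  moreover have "L \<noteq> UNIV" using exists_intertwiner[OF \<beta>] by (auto simp: L_def)
  ultimately have L0: "L = {0}" by blast
  have "adj B w = 0" for w
  proof -
    have "Z (adj B w) = 0" if Z: "Z \<in> intertwiners \<beta>" for Z
    proof (rule cinner_ext)
      fix g
      have "cinner g (Z (adj B w)) = cinner (B (adj Z g)) w"
        by (simp add: adj_left[OF Zb[OF Z], symmetric] adj_right[OF B])
      then show "cinner g (Z (adj B w)) = cinner g 0" by (simp add: zero[OF Z])
    qed
    then have "adj B w \<in> L" by (simp add: L_def)
    then show ?thesis using L0 by blast
  qed
  then have "cinner w (B x) = cinner w 0" for w
    by (simp add: adj_left[OF B, symmetric])
  then show ?thesis by (rule cinner_ext)
qed

text \<open>Besides Z also Z composed with \<open>adj y\<close> is an intertwiner, with adjoint y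
  composed with \<open>adj Z\<close>. Comparing \<open>AlgLat_intertwine\<close> for both, with the
  smallest admissible shift n + 1, gives the relation on the ranges of all
  \<open>adj Z\<close>.\<close>

lemma AlgLat_entry_commutes:
  assumes T: "T \<in> AlgLat (induced t ` hardy_algebra F)" and y: "y \<in> commutant"
  shows "y (W (k + n) (T (V k x))) = W (k + n) (T (V k (y x)))"
proof -
  note Tb = AlgLat_bcl[OF T]
  have yb: "bounded_clinear y" using y by (simp add: commutant_def)
  define M where "M x = W (k + n) (T (V k x))" for x
  have Mb: "bounded_clinear M"
    unfolding M_def by (rule bcl_compose[OF W_bcl bcl_compose[OF Tb V_bcl]])
  have "M (y x) - y (M x) = 0"
  proof (rule intertwiner_ranges_total[where B = "\<lambda>x. M (y x) - y (M x)"])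
    show "bounded_clinear (\<lambda>x. M (y x) - y (M x))"
      by (rule bcl_minus[OF bcl_compose[OF Mb yb] bcl_compose[OF yb Mb]])
    show "star_automorphism (\<alpha> ^^ Suc n)" by (rule star_automorphism_funpow[OF \<alpha>])
    fix Z g assume Z: "Z \<in> intertwiners (\<alpha> ^^ Suc n)"
    then have Zb: "bounded_clinear Z" by (simp add: intertwiners_def)
    define Z' where "Z' x = Z (adj y x)" for x
    have Z'b: "bounded_clinear Z'" unfolding Z'_def by (rule bcl_compose[OF Zb bcl_adj[OF yb]])
    have Z': "Z' \<in> intertwiners (\<alpha> ^^ Suc n)"
      using Z adj_commutant[OF y] Z'b by (simp add: intertwiners_def commutant_def Z'_def)
    have a: "adj Z' g = y (adj Z g)" for g
      by (rule cinner_ext) (simp add: adj_right[OF Z'b] Z'_def adj_right[OF Zb, symmetric] adj_left[OF yb])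
    have "M (y (adj Z g)) = y (adj Z (W (k + n + Suc n) (T (V (k + Suc n) g))))"
      unfolding M_def a[symmetric] by (rule AlgLat_intertwine[OF T Z']) simp
    also have "\<dots> = y (M (adj Z g))"
      unfolding M_def by (subst AlgLat_intertwine[OF T Z]) simp_all
    finally show "M (y (adj Z g)) - y (M (adj Z g)) = 0" by simp
  qed
  then show ?thesis by (simp add: M_def)
qed

lemma AlgLat_matrix:
  assumes T: "T \<in> AlgLat (induced t ` hardy_algebra F)"
  obtains a where "\<And>n k h. W (k + n) (T (V k h)) = \<pi> ((\<alpha> ^^ k) (a n)) h"
proof -
  note Tb = AlgLat_bcl[OF T]
  have "\<exists>b. \<forall>h. \<pi> b h = W (k + n) (T (V k h))" for n k
  proof -
    have Mb: "bounded_clinear (\<lambda>h. W (k + n) (T (V k h)))"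
      by (rule bcl_compose[OF W_bcl bcl_compose[OF Tb V_bcl]])
    show ?thesis
      using bicommutant[OF Mb onorm_pos_le[OF bounded_clinear_bl[OF Mb]] bcl_norm[OF Mb]
          AlgLat_entry_commutes[OF T]] by blast
  qed
  then have "\<forall>n k. \<exists>b. \<forall>h. \<pi> b h = W (k + n) (T (V k h))" by blast
  then obtain b where "\<forall>n k h. \<pi> (b n k) h = W (k + n) (T (V k h))" by metis
  then have b: "\<And>n k h. \<pi> (b n k) h = W (k + n) (T (V k h))" by blast
  have step: "b n (k + m) = (\<alpha> ^^ m) (b n k)" if nm: "n < m" for n k m
  proof -
    have am: "star_automorphism (\<alpha> ^^ m)" by (rule star_automorphism_funpow[OF \<alpha>])
    interpret \<beta>: automorphism "\<alpha> ^^ m" by standard (rule am)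
    define c where "c = inv (\<alpha> ^^ m) (b n (k + m))"
    have c: "(\<alpha> ^^ m) c = b n (k + m)" by (simp add: c_def \<beta>.inv_\<beta>)
    \<comment> \<open>Both operators send \<open>adj Z g\<close> to
      \<open>adj Z (\<pi> (b n (k + m)) g)\<close>: the first by \<open>AlgLat_intertwine\<close>,
      the second because Z is an intertwiner.\<close>
    have "\<pi> (b n k) h - \<pi> c h = 0" for h
    proof (rule intertwiner_ranges_total[OF bcl_minus[OF bcl bcl] am])
      fix Z g assume Z: "Z \<in> intertwiners (\<alpha> ^^ m)"
      then have Zb: "bounded_clinear Z" and Z\<pi>: "\<And>a h. Z (\<pi> a h) = \<pi> ((\<alpha> ^^ m) a) (Z h)"
        by (auto simp: intertwiners_def)
      have "\<pi> c (adj Z g) = adj Z (\<pi> (b n (k + m)) g)"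
      proof (rule cinner_ext)
        fix h
        have "cinner h (\<pi> c (adj Z g)) = cinner (Z (\<pi> (c\<^sup>\<star>) h)) g"
          by (simp add: adj_right[OF Zb, symmetric] star star_star)
        also have "\<dots> = cinner h (adj Z (\<pi> (b n (k + m)) g))"
          by (simp add: Z\<pi> \<beta>.\<beta>_star c star star_star adj_right[OF Zb])
        finally show "cinner h (\<pi> c (adj Z g)) = cinner h (adj Z (\<pi> (b n (k + m)) g))" .
      qed
      also have "\<dots> = \<pi> (b n k) (adj Z g)"
        using AlgLat_intertwine[OF T Z nm, of k g] by (simp add: b add.commute add.left_commute)
      finally show "\<pi> (b n k) (adj Z g) - \<pi> c (adj Z g) = 0" by simp
    qed
    then have "b n k = c" by (intro rep_inj) simp
    then show ?thesis using c by simp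
  qed
  \<comment> \<open>Shifts m \<le> n are not covered by \<open>step\<close>. The index k + n + 2 is
    reached from k + 1 by n + 1 and from k by n + 2 shifts, and \<alpha>^(n+1) is cancelled.\<close>
  have Suc: "b n (Suc k) = \<alpha> (b n k)" for n k
  proof -
    interpret \<beta>: automorphism "\<alpha> ^^ Suc n"
      by standard (rule star_automorphism_funpow[OF \<alpha>])
    have "(\<alpha> ^^ Suc n) (b n (Suc k)) = b n (k + Suc (Suc n))"
      using step[of n "Suc n" "Suc k"] by simp
    also have "\<dots> = (\<alpha> ^^ Suc n) (\<alpha> (b n k))"
      using step[of n "Suc (Suc n)" k] by (simp add: funpow_swap1)
    finally show ?thesis by (rule \<beta>.\<beta>_inj)
  qed
  have "b n k = (\<alpha> ^^ k) (b n 0)" for n k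
    by (induction k) (simp_all add: Suc)
  then show ?thesis using that[of "\<lambda>n. b n 0"] b by metis
qed

end

section \<open>Fejer means and the proof of reflexivity\<close>

context fock_factor_rep
begin

text \<open>If convergence failed for \<omega>, a weak* cluster point along the offending indices
  would have the same vector functionals as y, and so equal y by faithfulness.\<close>

lemma weakstar_convergence:
  assumes bd: "\<And>n. norm (x n) \<le> C" and wot: "\<And>h k. (\<lambda>n. cinner h (\<pi> (x n) k)) \<longlonglongrightarrow> cinner h (\<pi> y k)"
    and \<omega>: "\<omega> \<in> predual"
  shows "(\<lambda>n. \<omega> (x n)) \<longlonglongrightarrow> \<omega> y"
proof (rule ccontr)
  assume "\<not> ?thesis"
  then obtain \<epsilon> where \<epsilon>: "\<epsilon> > 0" "\<not> eventually (\<lambda>n. dist (\<omega> (x n)) (\<omega> y) < \<epsilon>) sequentially"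
    unfolding tendsto_iff by blast
  define G where "G = inf sequentially (principal {n. \<not> dist (\<omega> (x n)) (\<omega> y) < \<epsilon>})"
  have G: "G \<noteq> bot"
  proof
    assume "G = bot"
    then have "eventually (\<lambda>_. False) G" by simp
    then show False using \<epsilon>(2) by (simp add: G_def eventually_inf_principal)
  qed
  have ev: "eventually (\<lambda>n. norm (x n) \<le> C) G" using bd by simp
  obtain G' z where z: "G' \<le> G" "G' \<noteq> bot"
    and lim: "\<And>f. f \<in> predual \<Longrightarrow> ((\<lambda>i. f (x i)) \<longlongrightarrow> f z) G'"
    using weakstar_cluster[OF G ev] by blast
  have G'_seq: "G' \<le> sequentially" using z(1) by (simp add: G_def)
  have "z = y"
  proof (rule rep_inj, rule cinner_ext)
    fix h k
    show "cinner h (\<pi> z k) = cinner h (\<pi> y k)"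
      by (rule tendsto_unique[OF z(2) lim[OF vector_functional_predual] tendsto_mono[OF G'_seq wot]])
  qed
  then have "eventually (\<lambda>n. dist (\<omega> (x n)) (\<omega> y) < \<epsilon>) G'"
    using tendstoD[OF lim[OF \<omega>] \<epsilon>(1)] by simp
  moreover have "eventually (\<lambda>n. \<not> dist (\<omega> (x n)) (\<omega> y) < \<epsilon>) G'"
    by (rule filter_leD[OF z(1)]) (simp add: G_def eventually_inf_principal)
  ultimately have "eventually (\<lambda>_. False) G'" by eventually_elim simp
  then show False using z(2) by simp
qed

text \<open>Any weak* cluster point of the x n represents the limit form.\<close>

lemma bounded_sesquilinear_rep:
  assumes bd: "\<And>n. norm (x n) \<le> C" and wot: "\<And>h k. (\<lambda>n. cinner h (\<pi> (x n) k)) \<longlonglongrightarrow> B h k"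
  shows "\<exists>y. norm y \<le> C \<and> (\<forall>h k. cinner h (\<pi> y k) = B h k)"
proof -
  have ev: "eventually (\<lambda>n. norm (x n) \<le> C) sequentially" using bd by simp
  obtain G' z where z: "G' \<le> sequentially" "G' \<noteq> bot" "norm z \<le> C"
    and lim: "\<And>f. f \<in> predual \<Longrightarrow> ((\<lambda>i. f (x i)) \<longlongrightarrow> f z) G'"
    using weakstar_cluster[OF sequentially_bot ev] by blast
  have "cinner h (\<pi> z k) = B h k" for h k
    by (rule tendsto_unique[OF z(2) lim[OF vector_functional_predual] tendsto_mono[OF z(1) wot]])
  then show ?thesis using z(3) by blast
qed

text \<open>Applying the coefficient before the shift \<open>creation F 1 ^^ n\<close> makes the
  entry at (k + n, k) a multiple of \<pi> (\<alpha>^k (a n)), as in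
  \<open>AlgLat_matrix\<close>.\<close>

definition fejer :: "(nat \<Rightarrow> 'm) \<Rightarrow> nat \<Rightarrow> 'f \<Rightarrow> 'f"
  where "fejer a N x = (\<Sum>n<N. of_real (1 - real n / real N) *\<^sub>C (creation F 1 ^^ n) (lact F (a n) x))"

lemma fejer_generators: "fejer a N \<in> generators"
proof -
  have pw: "(\<lambda>x. (creation F 1 ^^ n) (lact F b x)) \<in> generators" for n b
  proof (induction n)
    case 0
    have "lact F b \<in> generators" by (rule generated_algebra.gen) blast
    then show ?case by simp
  next
    case (Suc n)
    have "creation F 1 \<in> generators" by (rule generated_algebra.gen) blast
    from generated_algebra.mult[OF this Suc] show ?case by (simp add: comp_def)
  qed
  have "(\<lambda>x. \<Sum>n<M. c n *\<^sub>C (creation F 1 ^^ n) (lact F (a n) x)) \<in> generators" for M and c :: "nat \<Rightarrow> complex"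
  proof (induction M)
    case 0
    from generated_algebra.scale[OF pw[of 0 0], of 0] show ?case by simp
  next
    case (Suc M)
    from generated_algebra.add[OF Suc generated_algebra.scale[OF pw]] show ?case by simp
  qed
  then show ?thesis unfolding fejer_def[abs_def] .
qed

lemmas fejer_adjointable = generators_adjointable[OF fejer_generators]

lemma creation_one_power: "(creation F 1 ^^ n) (ract F (e j) b) = ract F (e (j + n)) b"
proof (induction n)
  case (Suc n)
  obtain S where S: "F.module_adjoint (creation F 1) S"
    using creation_adjointable F.adjointable_iff by blast
  interpret a: automorphism "\<alpha> ^^ (j + n)" by standard (rule star_automorphism_funpow[OF \<alpha>])
  have "(creation F 1 ^^ Suc n) (ract F (e j) b) = creation F 1 (ract F (e (j + n)) b)"
    by (simp add: Suc)
  also have "\<dots> = ract F (creation F 1 (e (j + n))) b"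
    by (rule F.module_adjoint_ract[OF S])
  also have "creation F 1 (e (j + n)) = e (j + Suc n)"
    unfolding creation_e a.\<beta>_one F.ract_one by simp
  finally show ?case .
qed simp

text \<open>The triangular Fejer weight, written as a count of common windows so that entrywise
  multiplication by it can be recognized as an average.\<close>

definition weight :: "nat \<Rightarrow> nat \<Rightarrow> nat \<Rightarrow> real"
  where "weight N i j = real (card {s. i < s \<and> j < s \<and> s \<le> i + N \<and> s \<le> j + N}) / real N"

lemma weight_shift:
  assumes "N > 0"
  shows "weight N (j + n) j = (if n < N then 1 - real n / real N else 0)"
proof -
  have "{s. j + n < s \<and> j < s \<and> s \<le> j + n + N \<and> s \<le> j + N} = {j + n <.. j + N}" by auto
  then show ?thesis using assms by (simp add: weight_def of_nat_diff field_simps)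
qed

lemma t_sum_left: "t (\<Sum>i\<in>I. f i) h = (\<Sum>i\<in>I. t (f i) h)"
proof (induction I rule: infinite_finite_induct)
  case (insert x I)
  then show ?case by (simp add: t_add_left)
qed (use t_scaleC_left[of 0 0 h] in auto)

lemma fejer_matrix:
  assumes N: "N > 0" and T0: "\<And>i j h. i < j \<Longrightarrow> W i (T (V j h)) = 0"
    and Ta: "\<And>n k h. W (k + n) (T (V k h)) = \<pi> ((\<alpha> ^^ k) (a n)) h"
  shows "W i (induced t (fejer a N) (V j h)) = weight N i j *\<^sub>R W i (T (V j h))"
proof -
  have "fejer a N (e j) = (\<Sum>n<N. of_real (1 - real n / real N) *\<^sub>C ract F (e (j + n)) ((\<alpha> ^^ j) (a n)))"
    by (simp add: fejer_def lact_e creation_one_power)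
  then have "induced t (fejer a N) (V j h) = (\<Sum>n<N. of_real (1 - real n / real N) *\<^sub>C V (j + n) (\<pi> ((\<alpha> ^^ j) (a n)) h))"
    by (simp add: V_def induced_t[OF fejer_adjointable] t_sum_left t_scaleC_left t_ract)
  then have eq: "W i (induced t (fejer a N) (V j h))
      = (\<Sum>n<N. of_real (1 - real n / real N) *\<^sub>C (if i = j + n then \<pi> ((\<alpha> ^^ j) (a n)) h else 0))"
    by (simp add: bcl_sum[OF W_bcl] bcl_scaleC[OF W_bcl] W_V)
  show ?thesis
  proof (cases "i < j")
    case True
    then have "W i (induced t (fejer a N) (V j h)) = 0"
      unfolding eq by (intro sum.neutral) auto
    then show ?thesis using T0[OF True] by simp
  next
    case False
    then obtain m where m: "i = j + m" by (metis le_Suc_ex not_less)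
    have "W i (induced t (fejer a N) (V j h))
        = (\<Sum>n<N. if m = n then (1 - real m / real N) *\<^sub>R \<pi> ((\<alpha> ^^ j) (a m)) h else 0)"
      unfolding eq by (intro sum.cong refl) (auto simp: m scaleR_scaleC)
    also have "\<dots> = weight N (j + m) j *\<^sub>R W (j + m) (T (V j h))"
      unfolding weight_shift[OF N] Ta by simp
    finally show ?thesis by (simp only: m)
  qed
qed

lemma norm_sq_V_sum: "finite A \<Longrightarrow> (norm (\<Sum>i\<in>A. V i (f i)))\<^sup>2 = (\<Sum>i\<in>A. (norm (f i))\<^sup>2)"
proof -
  assume A: "finite A"
  have "cinner (\<Sum>i\<in>A. V i (f i)) (\<Sum>i\<in>A. V i (f i)) = (\<Sum>i\<in>A. \<Sum>j\<in>A. if i = j then cinner (f i) (f j) else 0)"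
    unfolding cinner_sum_left unfolding cinner_sum_right by (intro sum.cong refl) (simp add: V_orth)
  also have "\<dots> = (\<Sum>i\<in>A. cinner (f i) (f i))"
    by (rule sum.cong[OF refl]) (use A in simp)
  finally have "Re (cinner (\<Sum>i\<in>A. V i (f i)) (\<Sum>i\<in>A. V i (f i))) = Re (\<Sum>i\<in>A. cinner (f i) (f i))" by simp
  then show ?thesis by (simp add: Re_cinner_self)
qed

text \<open>The Fejer weight at \<open>(i, j)\<close> is the proportion of the windows of length \<open>N\<close> around \<open>i\<close> that
  contain \<open>j\<close>. So the Fejer mean is an average of compressions to windows.\<close>

lemma weighted_compression_bound:
  assumes T: "bounded_clinear T" and N: "N > 0"
  shows "cmod (\<Sum>i<L. \<Sum>j<L. of_real (weight N i j) * cinner (W i v) (W i (T (V j (W j u)))))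
    \<le> onorm T * (norm v * norm u)"
proof -
  define win where "win s = {i. i < L \<and> i < s \<and> s \<le> i + N}" for s
  define R where "R s x = (\<Sum>i\<in>win s. V i (W i x))" for s x
  have fw: "finite (win s)" for s by (simp add: win_def)
  have card: "real N * weight N i j = (\<Sum>s<L + N. if i \<in> win s \<and> j \<in> win s then 1 else 0)"
    if "i < L" "j < L" for i j
  proof -
    have "{s. i < s \<and> j < s \<and> s \<le> i + N \<and> s \<le> j + N} = {s \<in> {..<L + N}. i \<in> win s \<and> j \<in> win s}"
      using that by (auto simp: win_def)
    then show ?thesis using N by (simp add: weight_def sum.If_cases Int_def)
  qed
  have summand: "(\<Sum>i<L. \<Sum>j<L. if i \<in> win s \<and> j \<in> win s then cinner (W i v) (W i (T (V j (W j u)))) else 0)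
      = cinner (R s v) (T (R s u))" for s
  proof -
    have "(\<Sum>i<L. \<Sum>j<L. if i \<in> win s \<and> j \<in> win s then cinner (W i v) (W i (T (V j (W j u)))) else 0)
        = (\<Sum>i\<in>win s. \<Sum>j\<in>win s. cinner (W i v) (W i (T (V j (W j u)))))"
    proof -
      have sub: "win s \<subseteq> {..<L}" by (auto simp: win_def)
      have "(\<Sum>i\<in>win s. \<Sum>j\<in>win s. cinner (W i v) (W i (T (V j (W j u)))))
          = (\<Sum>i<L. if i \<in> win s then (\<Sum>j\<in>win s. cinner (W i v) (W i (T (V j (W j u))))) else 0)"
        by (rule sum.mono_neutral_cong_left) (use sub in auto)
      also have "\<dots> = (\<Sum>i<L. \<Sum>j<L. if i \<in> win s \<and> j \<in> win s then cinner (W i v) (W i (T (V j (W j u)))) else 0)"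
      proof (rule sum.cong[OF refl])
        fix i
        have "(\<Sum>j\<in>win s. cinner (W i v) (W i (T (V j (W j u)))))
            = (\<Sum>j<L. if j \<in> win s then cinner (W i v) (W i (T (V j (W j u)))) else 0)"
          by (rule sum.mono_neutral_cong_left) (use sub in auto)
        then show "(if i \<in> win s then (\<Sum>j\<in>win s. cinner (W i v) (W i (T (V j (W j u))))) else 0)
            = (\<Sum>j<L. if i \<in> win s \<and> j \<in> win s then cinner (W i v) (W i (T (V j (W j u)))) else 0)"
          by simp
      qed
      finally show ?thesis by simp
    qed
    also have "\<dots> = cinner (R s v) (T (R s u))"
      unfolding R_def bcl_sum[OF T] unfolding cinner_sum_left unfolding cinner_sum_right W_right ..
    finally show ?thesis .
  qed
  \<comment> \<open>Every index i < L lies in exactly N windows. The two square roots of N that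
    arise from Cauchy-Schwarz over s cancel the denominator of \<open>weight\<close>.\<close>
  have sq: "(\<Sum>s<L + N. (norm (R s x))\<^sup>2) \<le> real N * (norm x)\<^sup>2" for x
  proof -
    have "(\<Sum>s<L + N. (norm (R s x))\<^sup>2) = (\<Sum>s<L + N. \<Sum>i<L. if i \<in> win s then (norm (W i x))\<^sup>2 else 0)"
    proof (rule sum.cong[OF refl])
      fix s
      have "(norm (R s x))\<^sup>2 = (\<Sum>i\<in>win s. (norm (W i x))\<^sup>2)"
        unfolding R_def by (rule norm_sq_V_sum[OF fw])
      also have "\<dots> = (\<Sum>i<L. if i \<in> win s then (norm (W i x))\<^sup>2 else 0)"
        by (rule sum.mono_neutral_cong_left) (auto simp: win_def)
      finally show "(norm (R s x))\<^sup>2 = \<dots>" .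
    qed
    also have "\<dots> = (\<Sum>i<L. \<Sum>s<L + N. if i \<in> win s then (norm (W i x))\<^sup>2 else 0)" by (rule sum.swap)
    also have "\<dots> = (\<Sum>i<L. real N * (norm (W i x))\<^sup>2)"
    proof (rule sum.cong[OF refl])
      fix i assume "i \<in> {..<L}"
      then have "{..<L + N} \<inter> {s. i \<in> win s} = {i <.. i + N}" by (auto simp: win_def)
      then show "(\<Sum>s<L + N. if i \<in> win s then (norm (W i x))\<^sup>2 else 0) = real N * (norm (W i x))\<^sup>2"
        by (simp add: sum.If_cases)
    qed
    also have "\<dots> = real N * (norm (P L x))\<^sup>2"
      unfolding P_def norm_sq_V_sum[OF finite_lessThan] by (rule sum_distrib_left[symmetric])
    also have "\<dots> \<le> real N * (norm x)\<^sup>2"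
      by (intro mult_left_mono power_mono norm_P) auto
    finally show ?thesis .
  qed
  have L2: "L2_set (\<lambda>s. norm (R s x)) {..<L + N} \<le> sqrt (real N) * norm x" for x
    unfolding L2_set_def using real_sqrt_le_mono[OF sq[of x]] by (simp add: real_sqrt_mult)
  have o: "0 \<le> onorm T" by (rule onorm_pos_le[OF bounded_clinear_bl[OF T]])
  let ?S = "\<Sum>i<L. \<Sum>j<L. of_real (weight N i j) * cinner (W i v) (W i (T (V j (W j u))))"
  have "of_nat N * ?S = (\<Sum>i<L. \<Sum>j<L. \<Sum>s<L + N. if i \<in> win s \<and> j \<in> win s then cinner (W i v) (W i (T (V j (W j u)))) else 0)"
    unfolding sum_distrib_left
  proof (intro sum.cong refl)
    fix i j assume "i \<in> {..<L}" "j \<in> {..<L}"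
    then have "of_nat N * (of_real (weight N i j) :: complex) = of_real (\<Sum>s<L + N. if i \<in> win s \<and> j \<in> win s then 1 else 0)"
      using card[of i j, symmetric] by simp
    also have "\<dots> = (\<Sum>s<L + N. if i \<in> win s \<and> j \<in> win s then 1 else 0)"
      unfolding of_real_sum by (intro sum.cong refl) simp
    finally have w: "of_nat N * (of_real (weight N i j) :: complex) = (\<Sum>s<L + N. if i \<in> win s \<and> j \<in> win s then 1 else 0)" .
    show "of_nat N * (of_real (weight N i j) * cinner (W i v) (W i (T (V j (W j u)))))
        = (\<Sum>s<L + N. if i \<in> win s \<and> j \<in> win s then cinner (W i v) (W i (T (V j (W j u)))) else 0)"
      unfolding mult.assoc[symmetric] w sum_distrib_right by (intro sum.cong refl) simp
  qed
  also have "\<dots> = (\<Sum>i<L. \<Sum>s<L + N. \<Sum>j<L. if i \<in> win s \<and> j \<in> win s then cinner (W i v) (W i (T (V j (W j u)))) else 0)"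
    by (intro sum.cong refl sum.swap)
  also have "\<dots> = (\<Sum>s<L + N. \<Sum>i<L. \<Sum>j<L. if i \<in> win s \<and> j \<in> win s then cinner (W i v) (W i (T (V j (W j u)))) else 0)"
    by (rule sum.swap)
  also have "\<dots> = (\<Sum>s<L + N. cinner (R s v) (T (R s u)))" by (simp only: summand)
  finally have "cmod (of_nat N * ?S) = cmod (\<Sum>s<L + N. cinner (R s v) (T (R s u)))"
    by (rule arg_cong)
  then have "real N * cmod ?S = cmod (\<Sum>s<L + N. cinner (R s v) (T (R s u)))"
    by (simp only: norm_mult norm_of_nat)
  also have "\<dots> \<le> (\<Sum>s<L + N. onorm T * (\<bar>norm (R s v)\<bar> * \<bar>norm (R s u)\<bar>))"
  proof (rule sum_norm_le)
    fix s
    have "cmod (cinner (R s v) (T (R s u))) \<le> norm (R s v) * norm (T (R s u))" by (rule cinner_Cauchy_Schwarz)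
    also have "\<dots> \<le> norm (R s v) * (onorm T * norm (R s u))" by (intro mult_left_mono bcl_norm[OF T]) simp
    finally show "cmod (cinner (R s v) (T (R s u))) \<le> onorm T * (\<bar>norm (R s v)\<bar> * \<bar>norm (R s u)\<bar>)"
      by (simp add: mult_ac)
  qed
  also have "\<dots> \<le> onorm T * ((sqrt (real N) * norm v) * (sqrt (real N) * norm u))"
    unfolding sum_distrib_left[symmetric]
    by (intro mult_left_mono o order.trans[OF L2_set_mult_ineq] mult_mono L2) auto
  also have "\<dots> = real N * (onorm T * (norm v * norm u))" by simp
  finally show ?thesis using N by simp
qed

lemma cinner_P:
  assumes T: "bounded_clinear T"
  shows "cinner (P L v) (T (P L u)) = (\<Sum>i<L. \<Sum>j<L. cinner (W i v) (W i (T (V j (W j u)))))"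
  unfolding P_def bcl_sum[OF T] unfolding cinner_sum_left unfolding cinner_sum_right W_right ..

text \<open>On truncations by \<open>P L\<close> this is \<open>weighted_compression_bound\<close>;
  the bound is independent of L, so L can tend to infinity.\<close>

lemma fejer_bound:
  assumes T: "bounded_clinear T" and N: "N > 0" and T0: "\<And>i j h. i < j \<Longrightarrow> W i (T (V j h)) = 0"
    and Ta: "\<And>n k h. W (k + n) (T (V k h)) = \<pi> ((\<alpha> ^^ k) (a n)) h"
  shows "cmod (cinner v (induced t (fejer a N) u)) \<le> onorm T * (norm v * norm u)"
proof (rule tendsto_upperbound)
  let ?Z = "induced t (fejer a N)"
  note Z = induced_bcl[OF fejer_adjointable]
  show "(\<lambda>L. cmod (cinner (P L v) (?Z (P L u)))) \<longlonglongrightarrow> cmod (cinner v (?Z u))"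
    by (intro tendsto_norm tendsto_cinner P_tendsto bcl_tendsto[OF Z])
  show "eventually (\<lambda>L. cmod (cinner (P L v) (?Z (P L u))) \<le> onorm T * (norm v * norm u)) sequentially"
  proof (intro always_eventually allI)
    fix L
    show "cmod (cinner (P L v) (?Z (P L u))) \<le> onorm T * (norm v * norm u)"
      using weighted_compression_bound[OF T N]
      by (simp add: cinner_P[OF Z] fejer_matrix[OF N T0 Ta] cinner_scaleR_right)
  qed
qed simp

lemma weight_tendsto: "(\<lambda>N. weight (Suc N) i j) \<longlonglongrightarrow> 1"
proof -
  have *: "(\<lambda>N. weight (Suc N) (j + n) j) \<longlonglongrightarrow> 1" for j n
  proof (rule Lim_transform_eventually)
    show "(\<lambda>N. 1 - real n * (1 / real (Suc N))) \<longlonglongrightarrow> 1"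
      using tendsto_diff[OF tendsto_const tendsto_mult_left[OF LIMSEQ_Suc[OF lim_1_over_n], of "real n"], of 1] by simp
    show "eventually (\<lambda>N. 1 - real n * (1 / real (Suc N)) = weight (Suc N) (j + n) j) sequentially"
      using eventually_ge_at_top[of n] by (rule eventually_mono) (simp add: weight_shift)
  qed
  have sym: "weight N i j = weight N j i" for N
    unfolding weight_def by (rule arg_cong[where f = "\<lambda>S. real (card S) / real N"]) auto
  show ?thesis
    using *[of j "i - j"] *[of i "j - i"] by (cases "j \<le> i") (simp_all add: sym[of _] )
qed

text \<open>By \<open>fejer_bound\<close> the error of truncating to finitely many coordinates is
  uniform in N. For a fixed truncation there are finitely many entries, with weights tending to
  1.\<close>

lemma fejer_tendsto:
  assumes T: "bounded_clinear T" and T0: "\<And>i j h. i < j \<Longrightarrow> W i (T (V j h)) = 0"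
    and Ta: "\<And>n k h. W (k + n) (T (V k h)) = \<pi> ((\<alpha> ^^ k) (a n)) h"
  shows "(\<lambda>N. cinner v (induced t (fejer a (Suc N)) u)) \<longlonglongrightarrow> cinner v (T u)"
proof (rule metric_LIMSEQ_I)
  fix \<epsilon> :: real assume \<epsilon>: "\<epsilon> > 0"
  define Z where "Z N = induced t (fejer a (Suc N))" for N
  have Zb: "bounded_clinear (Z N)" for N unfolding Z_def by (rule induced_bcl[OF fejer_adjointable])
  have Zn: "cmod (cinner v (Z N u)) \<le> onorm T * (norm v * norm u)" for N v u
    unfolding Z_def by (rule fejer_bound[OF T _ T0 Ta]) simp
  have Tn: "cmod (cinner v (T u)) \<le> onorm T * (norm v * norm u)" for v u
    using order.trans[OF cinner_Cauchy_Schwarz[of v "T u"] mult_left_mono[OF bcl_norm[OF T, of u] norm_ge_zero[of v]]]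
    by (simp add: mult_ac)
  define \<delta> where "\<delta> L = onorm T * (norm (v - P L v) * norm u + norm (P L v) * norm (u - P L u))" for L
  have diff: "cmod (cinner v (S u) - cinner (P L v) (S (P L u))) \<le> \<delta> L"
    if S: "bounded_clinear S" "\<And>v u. cmod (cinner v (S u)) \<le> onorm T * (norm v * norm u)" for S L
  proof -
    have "cinner v (S u) - cinner (P L v) (S (P L u)) = cinner (v - P L v) (S u) + cinner (P L v) (S (u - P L u))"
      by (simp add: cinner_diff_left cinner_diff_right bcl_diff[OF S(1)])
    also have "cmod \<dots> \<le> onorm T * (norm (v - P L v) * norm u) + onorm T * (norm (P L v) * norm (u - P L u))"
      by (rule order.trans[OF norm_triangle_ineq add_mono[OF S(2) S(2)]])
    finally show ?thesis by (simp add: \<delta>_def distrib_left)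
  qed
  have "\<delta> \<longlonglongrightarrow> onorm T * (norm (v - v) * norm u + norm v * norm (u - u))"
    unfolding \<delta>_def by (intro tendsto_intros P_tendsto)
  then have "\<delta> \<longlonglongrightarrow> 0" by simp
  then have "eventually (\<lambda>L. \<delta> L < \<epsilon> / 3) sequentially"
    by (rule order_tendstoD(2)) (use \<epsilon> in simp)
  then obtain L where "\<delta> L < \<epsilon> / 3"
    using eventually_happens'[OF sequentially_bot] by blast
  have ZW: "cinner g (W i (Z N (V j h))) = of_real (weight (Suc N) i j) * cinner g (W i (T (V j h)))" for g i j h N
    unfolding Z_def by (simp only: fejer_matrix[OF zero_less_Suc T0 Ta] cinner_scaleR_right)
  have "(\<lambda>N. cinner (P L v) (Z N (P L u))) \<longlonglongrightarrow> (\<Sum>i<L. \<Sum>j<L. of_real 1 * cinner (W i v) (W i (T (V j (W j u)))))"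
    unfolding cinner_P[OF Zb] ZW
    by (intro tendsto_sum tendsto_mult tendsto_of_real weight_tendsto tendsto_const)
  then have "(\<lambda>N. cinner (P L v) (Z N (P L u))) \<longlonglongrightarrow> cinner (P L v) (T (P L u))"
    by (simp add: cinner_P[OF T])
  then obtain M where M: "\<And>N. N \<ge> M \<Longrightarrow> dist (cinner (P L v) (Z N (P L u))) (cinner (P L v) (T (P L u))) < \<epsilon> / 3"
    using metric_LIMSEQ_D \<epsilon> by (metis divide_pos_pos zero_less_numeral)
  have "dist (cinner v (Z N u)) (cinner v (T u)) < \<epsilon>" if "N \<ge> M" for N
  proof -
    have "cinner v (Z N u) - cinner v (T u) = (cinner v (Z N u) - cinner (P L v) (Z N (P L u)))
        + (cinner (P L v) (Z N (P L u)) - cinner (P L v) (T (P L u))) - (cinner v (T u) - cinner (P L v) (T (P L u)))"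
      by simp
    also have "cmod \<dots> \<le> cmod (cinner v (Z N u) - cinner (P L v) (Z N (P L u)))
        + cmod (cinner (P L v) (Z N (P L u)) - cinner (P L v) (T (P L u))) + cmod (cinner v (T u) - cinner (P L v) (T (P L u)))"
      by (rule order.trans[OF norm_triangle_ineq4 add_right_mono[OF norm_triangle_ineq]])
    also have "\<dots> < \<epsilon>"
      using diff[OF Zb Zn, of N L] diff[OF T Tn, of L] M[OF that] \<open>\<delta> L < \<epsilon> / 3\<close>
      by (simp add: dist_norm)
    finally show ?thesis by (simp add: dist_norm)
  qed
  then show "\<exists>no. \<forall>N\<ge>no. dist (cinner v (induced t (fejer a (Suc N)) u)) (cinner v (T u)) < \<epsilon>"
    unfolding Z_def by blast
qed

text \<open>The Fejer means converge to T on the Hilbert space, whereas membership in the Hardy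
  algebra concerns the module. The limits \<open>m \<xi> \<eta>\<close> of
  \<open>minner F \<xi> (Y N \<eta>)\<close> form a bounded M-valued form, and self-duality in each
  variable yields an adjointable X with X \<otimes> I = T.\<close>

lemma AlgLat_in_hardy:
  assumes "T \<in> AlgLat (induced t ` hardy_algebra F)"
  shows "T \<in> induced t ` hardy_algebra F"
proof -
  note T = AlgLat_bcl[OF assms] and T0 = AlgLat_triangular[OF assms]
  obtain a where Ta: "\<And>n k h. W (k + n) (T (V k h)) = \<pi> ((\<alpha> ^^ k) (a n)) h"
    using AlgLat_matrix[OF assms] by blast
  define Y where "Y N = fejer a (Suc N)" for N
  have Ya: "Y N \<in> adjointable F" for N unfolding Y_def by (rule fejer_adjointable)
  have Yb: "cmod (cinner v (induced t (Y N) u)) \<le> onorm T * (norm v * norm u)" for N v u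
    unfolding Y_def by (rule fejer_bound[OF T zero_less_Suc T0 Ta])
  have Yl: "(\<lambda>N. cinner v (induced t (Y N) u)) \<longlonglongrightarrow> cinner v (T u)" for v u
    unfolding Y_def by (rule fejer_tendsto[OF T T0 Ta])
  \<comment> \<open>The factor 6 is that of \<open>rep_norm_lower\<close>.\<close>
  define C where "C = 6 * onorm T"
  have o: "0 \<le> onorm T" by (rule onorm_pos_le[OF bounded_clinear_bl[OF T]])
  have mY: "norm (minner F \<xi> (Y N \<eta>)) \<le> C * (norm \<xi> * norm \<eta>)" for \<xi> \<eta> N
  proof -
    have "norm (\<pi> (minner F \<xi> (Y N \<eta>)) k) \<le> onorm T * (norm \<xi> * norm \<eta>) * norm k" for k
    proof (rule norm_le_of_cinner)
      fix h
      have "cmod (cinner h (\<pi> (minner F \<xi> (Y N \<eta>)) k)) \<le> onorm T * (norm (t \<xi> h) * norm (t \<eta> k))"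
        unfolding t_inner[symmetric] induced_t[OF Ya, symmetric] by (rule Yb)
      also have "\<dots> \<le> onorm T * ((norm \<xi> * norm h) * (norm \<eta> * norm k))"
        by (intro mult_left_mono mult_mono norm_t o) auto
      finally show "cmod (cinner h (\<pi> (minner F \<xi> (Y N \<eta>)) k)) \<le> onorm T * (norm \<xi> * norm \<eta>) * norm k * norm h"
        by (simp add: mult_ac)
    qed (use o in simp)
    then have "norm (minner F \<xi> (Y N \<eta>)) \<le> 6 * (onorm T * (norm \<xi> * norm \<eta>))"
      using o by (intro rep_norm_lower) auto
    then show ?thesis by (simp add: C_def)
  qed
  have Yt: "(\<lambda>N. cinner h (\<pi> (minner F \<xi> (Y N \<eta>)) k)) \<longlonglongrightarrow> cinner (t \<xi> h) (T (t \<eta> k))" for \<xi> \<eta> h k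
    unfolding t_inner[symmetric] induced_t[OF Ya, symmetric] by (rule Yl)
  have "\<exists>m. norm m \<le> C * (norm \<xi> * norm \<eta>) \<and> (\<forall>h k. cinner h (\<pi> m k) = cinner (t \<xi> h) (T (t \<eta> k)))" for \<xi> \<eta>
    by (rule bounded_sesquilinear_rep[OF mY Yt])
  then obtain m where m: "\<And>\<xi> \<eta>. norm (m \<xi> \<eta>) \<le> C * (norm \<xi> * norm \<eta>)"
    "\<And>\<xi> \<eta> h k. cinner h (\<pi> (m \<xi> \<eta>) k) = cinner (t \<xi> h) (T (t \<eta> k))" by metis
  have ms: "cinner h (\<pi> ((m \<xi> \<eta>)\<^sup>\<star>) k) = cinner (T (t \<eta> h)) (t \<xi> k)" for \<xi> \<eta> h k
    unfolding star[symmetric] by (rule cinner_swap[OF m(2)])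
  have "\<exists>S. m \<xi> = minner F S" for \<xi>
  proof (rule F.self_dual)
    show "bounded_clinear (m \<xi>)"
    proof (rule bounded_clinearI)
      show "m \<xi> (x + y) = m \<xi> x + m \<xi> y" for x y
        by (rule rep_inj, rule cinner_ext)
          (simp add: m(2) add cinner_add_right t_add_left bcl_add[OF T])
      show "m \<xi> (c *\<^sub>C x) = c *\<^sub>C m \<xi> x" for c x
        by (rule rep_inj, rule cinner_ext)
          (simp add: m(2) scaleC cinner_scaleC_right t_scaleC_left bcl_scaleC[OF T])
      show "norm (m \<xi> x) \<le> C * norm \<xi> * norm x" for x using m(1)[of \<xi> x] by (simp add: mult_ac)
    qed
    show "m \<xi> (ract F x b) = m \<xi> x * b" for x b
      by (rule rep_inj, rule cinner_ext) (simp add: m(2) mult t_ract)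
  qed
  then obtain S where S: "\<And>\<xi> \<eta>. m \<xi> \<eta> = minner F (S \<xi>) \<eta>" by metis
  \<comment> \<open>The form is conjugate linear in \<xi>; taking adjoints makes it a module map in
    \<xi>, so that self-duality applies.\<close>
  have "\<exists>X. (\<lambda>\<xi>. (m \<xi> \<eta>)\<^sup>\<star>) = minner F X" for \<eta>
  proof (rule F.self_dual)
    show "bounded_clinear (\<lambda>\<xi>. (m \<xi> \<eta>)\<^sup>\<star>)"
    proof (rule bounded_clinearI)
      show "(m (x + y) \<eta>)\<^sup>\<star> = (m x \<eta>)\<^sup>\<star> + (m y \<eta>)\<^sup>\<star>" for x y
        by (rule rep_inj, rule cinner_ext)
          (simp add: ms add cinner_add_right t_add_left)
      show "(m (c *\<^sub>C x) \<eta>)\<^sup>\<star> = c *\<^sub>C (m x \<eta>)\<^sup>\<star>" for c x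
        by (rule rep_inj, rule cinner_ext)
          (simp add: ms scaleC cinner_scaleC_right t_scaleC_left)
      show "norm ((m x \<eta>)\<^sup>\<star>) \<le> C * norm \<eta> * norm x" for x using m(1)[of x \<eta>] by (simp add: mult_ac)
    qed
    show "(m (ract F x b) \<eta>)\<^sup>\<star> = (m x \<eta>)\<^sup>\<star> * b" for x b
      by (rule rep_inj, rule cinner_ext) (simp add: ms mult t_ract)
  qed
  then obtain X where X: "\<And>\<xi> \<eta>. (m \<xi> \<eta>)\<^sup>\<star> = minner F (X \<eta>) \<xi>" by metis
  have mX: "m \<xi> \<eta> = minner F \<xi> (X \<eta>)" for \<xi> \<eta>
  proof -
    have "((m \<xi> \<eta>)\<^sup>\<star>)\<^sup>\<star> = (minner F (X \<eta>) \<xi>)\<^sup>\<star>" by (simp only: X)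
    then show ?thesis by (simp only: star_star F.minner_star)
  qed
  have "F.module_adjoint S X" by (simp add: F.module_adjoint_def S[symmetric] mX)
  then have XS: "F.module_adjoint X S" by (rule F.module_adjoint_sym)
  then have Xa: "X \<in> adjointable F" using F.adjointable_iff by blast
  have XT: "induced t X = T"
    by (rule induced_eqI[OF T], rule total_eqI) (simp add: t_inner mX[symmetric] m(2))
  have "X \<in> hardy_algebra F"
    unfolding hardy_algebra_def in_closure_of F.topspace_adjointable
  proof (intro conjI Xa allI impI)
    fix U assume "X \<in> U \<and> openin (adjointable_ultraweak F) U"
    then obtain Fs \<epsilon> where Fs: "finite Fs" "Fs \<subseteq> adjointable_predual F" "\<epsilon> > 0"
      and U: "\<And>Z. Z \<in> adjointable F \<Longrightarrow> \<forall>f\<in>Fs. cmod (f Z - f X) < \<epsilon> \<Longrightarrow> Z \<in> U"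
      unfolding adjointable_ultraweak_def using weak_topology_nbhd by metis
    \<comment> \<open>Ultraweak functionals are norm limits of finite sums, so replacing them by
      such sums is uniform only on bounded sets; B bounds X and all Y N.\<close>
    define B where "B = max C (onorm X)"
    have B0: "0 \<le> B" using o by (simp add: B_def C_def)
    have YB: "onorm (Y N) \<le> B" for N
    proof -
      have "onorm (Y N) \<le> C"
      proof (rule onorm_bound)
        show "norm (Y N \<eta>) \<le> C * norm \<eta>" for \<eta>
          by (rule F.norm_le_of_minner) (use mY[of "Y N \<eta>" N \<eta>] o in \<open>simp_all add: mult_ac C_def\<close>)
      qed (use o in \<open>simp add: C_def\<close>)
      then show ?thesis by (simp add: B_def)
    qed
    have "(\<lambda>N. f (Y N)) \<longlonglongrightarrow> f X" if f: "f \<in> adjointable_predual F" for f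
    proof (rule metric_LIMSEQ_I)
      fix r :: real assume r: "r > 0"
      define d where "d = r / (3 * (B + 1))"
      have d: "d > 0" "d * B < r / 3"
      proof -
        show "d > 0" using r B0 by (simp add: d_def)
        then have "d * B < d * (B + 1)" by simp
        also have "\<dots> = r / 3" 
        proof -
          have "B + 1 \<noteq> 0" using B0 by simp
          then show ?thesis by (simp only: d_def) (simp only: times_divide_eq_left mult_divide_mult_cancel_right simp_thms)
        qed
        finally show "d * B < r / 3" .
      qed
      obtain gs where gs: "set gs \<subseteq> {\<lambda>T. \<omega> (minner F x (T y)) | \<omega> x y. \<omega> \<in> predual}"
        and fg: "\<And>Z. Z \<in> adjointable F \<Longrightarrow> cmod (f Z - (\<Sum>g\<leftarrow>gs. g Z)) \<le> d * onorm Z"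
        using f d(1) unfolding adjointable_predual_def closed_sums_def by blast
      have "(\<lambda>N. g (Y N)) \<longlonglongrightarrow> g X" if g: "g \<in> set gs" for g
      proof -
        obtain \<omega> x y where g: "g = (\<lambda>T. \<omega> (minner F x (T y)))" "\<omega> \<in> predual" using gs g by blast
        show ?thesis
          unfolding g(1)
        proof (rule weakstar_convergence[OF mY _ g(2)])
          show "(\<lambda>n. cinner h (\<pi> (minner F x (Y n y)) k)) \<longlonglongrightarrow> cinner h (\<pi> (minner F x (X y)) k)" for h k
            unfolding mX[symmetric] m(2) by (rule Yt)
        qed
      qed
      then have "(\<lambda>N. \<Sum>g\<leftarrow>gs. g (Y N)) \<longlonglongrightarrow> (\<Sum>g\<leftarrow>gs. g X)"
        by (induction gs) (auto intro!: tendsto_add)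
      then obtain M where M: "\<And>N. N \<ge> M \<Longrightarrow> dist (\<Sum>g\<leftarrow>gs. g (Y N)) (\<Sum>g\<leftarrow>gs. g X) < r / 3"
        using metric_LIMSEQ_D r by (metis divide_pos_pos zero_less_numeral)
      have fB: "cmod (f Z - (\<Sum>g\<leftarrow>gs. g Z)) < r / 3" if "Z \<in> adjointable F" "onorm Z \<le> B" for Z
        using fg[OF that(1)] mult_left_mono[OF that(2), of d] d by linarith
      have "dist (f (Y N)) (f X) < r" if "N \<ge> M" for N
      proof -
        have "f (Y N) - f X = (f (Y N) - (\<Sum>g\<leftarrow>gs. g (Y N))) + ((\<Sum>g\<leftarrow>gs. g (Y N)) - (\<Sum>g\<leftarrow>gs. g X))
            - (f X - (\<Sum>g\<leftarrow>gs. g X))" by simp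
        also have "cmod \<dots> \<le> cmod (f (Y N) - (\<Sum>g\<leftarrow>gs. g (Y N))) + cmod ((\<Sum>g\<leftarrow>gs. g (Y N)) - (\<Sum>g\<leftarrow>gs. g X))
            + cmod (f X - (\<Sum>g\<leftarrow>gs. g X))"
          by (rule order.trans[OF norm_triangle_ineq4 add_right_mono[OF norm_triangle_ineq]])
        also have "\<dots> < r"
          using fB[OF Ya YB, of N] fB[OF Xa] M[OF that] by (simp add: dist_norm B_def)
        finally show ?thesis by (simp add: dist_norm)
      qed
      then show "\<exists>no. \<forall>N\<ge>no. dist (f (Y N)) (f X) < r" by blast
    qed
    then have "eventually (\<lambda>N. \<forall>f\<in>Fs. dist (f (Y N)) (f X) < \<epsilon>) sequentially"
      using Fs by (intro eventually_ball_finite ballI tendstoD) auto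
    then obtain N where "\<forall>f\<in>Fs. dist (f (Y N)) (f X) < \<epsilon>"
      using eventually_happens'[OF sequentially_bot] by blast
    then have "Y N \<in> U" using U[OF Ya] by (simp add: dist_norm)
    moreover have "Y N \<in> generators" unfolding Y_def by (rule fejer_generators)
    ultimately show "\<exists>Z. Z \<in> generators \<and> Z \<in> U" by blast
  qed
  then show ?thesis using XT by blast
qed

lemma reflexive_hardy: "reflexive (induced t ` hardy_algebra F)"
  unfolding reflexive_def
proof
  show "induced t ` hardy_algebra F \<subseteq> AlgLat (induced t ` hardy_algebra F)"
    using induced_bcl[OF hardy_adjointable] by (auto simp: AlgLat_def Lat_def bounded_operators_def)
qed (use AlgLat_in_hardy in blast)

end

theorem corollary3p22:
  fixes \<alpha> :: "'m::wstar_algebra \<Rightarrow> 'm"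
    and \<pi> :: "'m \<Rightarrow> 'h::complex_hilbert \<Rightarrow> 'h"
    and F :: "('m, 'm, 'f::complex_banach) fock_module"
    and t :: "'f \<Rightarrow> 'h \<Rightarrow> 'k::complex_hilbert"
  assumes factor: "(center :: 'm set) = range (\<lambda>c. c *\<^sub>C 1)"
    and "star_automorphism \<alpha>"
    and "full_fock_space (twisted \<alpha>) F"
    and "normal_representation \<pi>"
    and "is_hilbert_tensor F \<pi> t"
  shows "reflexive (induced t ` hardy_algebra F)"
proof (cases "\<exists>h::'h. h \<noteq> 0")
  case True
  interpret full_fock_space "twisted \<alpha>" F by fact
  interpret normal_representation \<pi> by fact
  interpret fock_factor_rep \<alpha> F \<pi> t
    by unfold_locales (use assms True in auto)
  show ?thesis by (rule reflexive_hardy)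
next
  \<comment> \<open>If H = 0, the induced space is 0 and carries a single map. Both sides of the
    asserted equality are nonempty sets of maps, hence equal.\<close>
  case False
  interpret full_fock_space "twisted \<alpha>" F by fact
  have "cinner (t \<xi> h) (t \<xi> h) = 0" for \<xi> h
    using assms(5) False cinner_zero_left by (metis is_hilbert_tensor_def)
  then have "t \<xi> h = 0" for \<xi> h by (simp add: cinner_norm)
  then have "{t \<xi> h | \<xi> h. True} \<subseteq> {0}" by auto
  then have "cspan {t \<xi> h | \<xi> h. True} \<subseteq> {0}" by (rule cvs.span_minimal) (rule cvs.subspace_single_0)
  then have "closure (cspan {t \<xi> h | \<xi> h. True}) \<subseteq> {0}" by (rule closure_minimal) simp
  then have triv: "x = 0" for x :: 'k using assms(5) by (auto simp: is_hilbert_tensor_def)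
  then have all_eq: "f = g" for f g :: "'k \<Rightarrow> 'k" by (intro ext) metis
  have "lact F 0 \<in> generated_algebra (range (creation F) \<union> range (lact F))"
    by (rule generated_algebra.gen) blast
  moreover have "lact F 0 \<in> topspace (adjointable_ultraweak F)"
    by (simp add: F.topspace_adjointable lact_adjointable)
  ultimately have "lact F 0 \<in> hardy_algebra F"
    unfolding hardy_algebra_def in_closure_of by blast
  then obtain f where f: "f \<in> induced t ` hardy_algebra F" by blast
  have "(\<lambda>x. x) \<in> AlgLat (induced t ` hardy_algebra F)"
    by (simp add: AlgLat_def bounded_operators_def bcl_id Lat_def)
  moreover have "S = UNIV" if S: "g \<in> S" for S and g :: "'k \<Rightarrow> 'k"
  proof -
    have "f \<in> S" for f
    proof -
      have "f = g" by (rule all_eq)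
      then show ?thesis using S by simp
    qed
    then show ?thesis by blast
  qed
  ultimately show ?thesis
    unfolding reflexive_def using f by blast
qed

end
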